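(* Let $M,N$ be standard Borel spaces, $\mathcal{E}=M\times N$, $\pi:\mathcal{E}\to M$ the projection to the first factor, $f:M\to M$ an invertible bimeasurable map preserving a probability measure $m$, and $F:\mathcal{E}\to\mathcal{E}$ an invertible bimeasurable map with $\pi\circ F=f\circ\pi$. Let $\sigma$ be a measurable partition of $(M,m)$ which is increasing ($f^{-1}\sigma\geq\sigma$) and generating ($\bigvee_{n\ge 0}f^{-n}\sigma$ is the partition into points). Let $\mu$ be an $F$-invariant probability measure on $\mathcal{E}$ with $\pi_*\mu=m$. Put $\xi^{cu}:=\pi^{-1}(\sigma)$ and let $\xi^u$ be a measurable partition of $\mathcal{E}$ such that (0) $\xi^u$ is increasing, i.e. $F^{-1}\xi^u\geq\xi^u$; (1) $\xi^u\geq\xi^{cu}$; (2) $\pi(\xi^u(x))=\sigma(\pi(x))$ for every $x\in\mathcal{E}$; (3) for any two fibers $\{p\}\times N$, $\{q\}\times N$ contained in the same atom of $\xi^{cu}$, the holonomy $h^u_{p,q}:\{p\}\times N\to\{q\}\times N$ which sends $z$ to the point of $\xi^u(z)\cap(\{q\}\times N)$ is well defined, injective and surjective. Then $$h_\mu(F,\xi^u)\le h_m(f,\sigma),$$ and equality holds if and only if the disintegration of $\mu$ along the fibers $\{p\}\times N$ is invariant under the holonomy defined by $\xi^u$.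
   Context: For partitions, $\alpha\le\beta$ means every atom of $\alpha$ is a union of atoms of $\beta$ (so $\beta$ is finer); $\alpha(x)$ is the atom containing $x$. A partition is measurable if, on a full measure set, it is countably generated; by Rokhlin's theorem a probability measure $\mu$ then has an essentially unique system of conditional probability measures $\mu^{\alpha}_x$ on the atoms $\alpha(x)$. Conditional entropy: $H_\mu(\alpha|\beta):=\int -\log\mu^{\beta}_x(\alpha(x))\,d\mu(x)$. For an increasing measurable partition, $h_\mu(F,\xi^u):=H_\mu(F^{-1}\xi^u|\xi^u)$ and $h_m(f,\sigma):=H_m(f^{-1}\sigma|\sigma)$, where $(F^{-1}\xi^u)(x)=F^{-1}(\xi^u(F(x)))$ and similarly for $f$. For $x\in\mathcal{E}$ let $\mu^c_x$ denote the conditional probability measure of $\mu$ on the fiber $\{\pi(x)\}\times N$. The disintegration of $\mu$ along the fibers is invariant under the holonomy defined by $\xi^u$ if there is a set of full $\mu$-measure such that for any two points $x,y$ of it lying in the same atom of $\xi^{cu}$, $(h^u_{\pi(x),\pi(y)})_*\mu^c_x=\mu^c_y$.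
   Formalization: The implication from equality of the entropies to holonomy invariance is proved under the additional assumption that h_m(f,σ) is finite; without it the implication fails when both entropies are infinite. The inequality and the converse implication need no such assumption. *)

theory Defs
  imports "HOL-Probability.Probability"
begin

section \<open>Standard Borel spaces and invertible bimeasurable maps\<close>

text \<open>
  As usual, measurable spaces are represented by measures of which only \<open>space\<close> and
  \<open>sets\<close> matter. A standard Borel space carries the Borel sets of a Polish topology.
\<close>

definition standard_borel_space :: "'a measure \<Rightarrow> bool" where
  "standard_borel_space M \<longleftrightarrow>
     (\<exists>T. topspace T = space M \<and> completely_metrizable_space T \<and> second_countable T \<and>
          sets M = sigma_sets (space M) {U. openin T U})"

definition bimeasurable_bijection :: "'a measure \<Rightarrow> ('a \<Rightarrow> 'a) \<Rightarrow> bool" where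
  "bimeasurable_bijection M f \<longleftrightarrow>
     bij_betw f (space M) (space M) \<and> f \<in> M \<rightarrow>\<^sub>M M \<and> the_inv_into (space M) f \<in> M \<rightarrow>\<^sub>M M"


section \<open>Partitions\<close>

text \<open>
  Partitions are sets of atoms (\<^const>\<open>partition_on\<close>). The order and the join below are
  meant everywhere, not modulo null sets.
\<close>

definition atom :: "'a set set \<Rightarrow> 'a \<Rightarrow> 'a set" where
  "atom \<alpha> x = (THE A. A \<in> \<alpha> \<and> x \<in> A)"

definition finer :: "'a set set \<Rightarrow> 'a set set \<Rightarrow> bool" where
  "finer \<beta> \<alpha> \<longleftrightarrow> (\<forall>A\<in>\<alpha>. \<exists>C\<subseteq>\<beta>. A = \<Union>C)"

definition pullback :: "'a measure \<Rightarrow> ('a \<Rightarrow> 'b) \<Rightarrow> 'b set set \<Rightarrow> 'a set set" where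
  "pullback M f \<alpha> = (\<lambda>A. f -` A \<inter> space M) ` \<alpha>"

definition join :: "'a measure \<Rightarrow> (nat \<Rightarrow> 'a set set) \<Rightarrow> 'a set set" where
  "join M \<alpha> = (\<lambda>x. \<Inter>n. atom (\<alpha> n) x) ` space M"

text \<open>
  On a set \<open>X\<close> of full measure the partition is the one generated by countably many
  measurable sets \<open>A n\<close>; outside \<open>X\<close> the atoms are arbitrary, so they need
  not be measurable for \<open>\<mu>\<close>, only for completions.
\<close>

definition measurable_partition :: "'a measure \<Rightarrow> 'a set set \<Rightarrow> bool" where
  "measurable_partition \<mu> \<alpha> \<longleftrightarrow>
     partition_on (space \<mu>) \<alpha> \<and>
     (\<exists>X\<in>sets \<mu>. emeasure \<mu> (space \<mu> - X) = 0 \<and>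
        (\<exists>A :: nat \<Rightarrow> 'a set. range A \<subseteq> sets \<mu> \<and>
           (\<forall>x\<in>X. atom \<alpha> x \<inter> X = {y\<in>X. \<forall>n. y \<in> A n \<longleftrightarrow> x \<in> A n})))"

definition increasing_partition :: "'a measure \<Rightarrow> ('a \<Rightarrow> 'a) \<Rightarrow> 'a set set \<Rightarrow> bool" where
  "increasing_partition M f \<alpha> \<longleftrightarrow> finer (pullback M f \<alpha>) \<alpha>"

definition generating_partition :: "'a measure \<Rightarrow> ('a \<Rightarrow> 'a) \<Rightarrow> 'a set set \<Rightarrow> bool" where
  "generating_partition M f \<alpha> \<longleftrightarrow>
     join M (\<lambda>n. pullback M (f ^^ n) \<alpha>) = (\<lambda>x. {x}) ` space M"


section \<open>Conditional measures and conditional entropy\<close>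

text \<open>
  A system of conditional probability measures in the sense of Rokhlin, written as a
  function \<open>\<kappa>\<close> of the point which is constant on atoms. Since \<^const>\<open>emeasure\<close> is 0 on
  non-measurable sets, the second condition includes that the atom of \<open>x\<close> is
  measurable for the completion of \<open>\<kappa> x\<close>.
\<close>

definition conditional_system :: "'a measure \<Rightarrow> 'a set set \<Rightarrow> ('a \<Rightarrow> 'a measure) \<Rightarrow> bool" where
  "conditional_system \<mu> \<alpha> \<kappa> \<longleftrightarrow>
     (\<forall>x\<in>space \<mu>. prob_space (\<kappa> x) \<and> sets (\<kappa> x) = sets \<mu>) \<and>
     (AE x in \<mu>. emeasure (completion (\<kappa> x)) (atom \<alpha> x) = 1) \<and>
     (\<forall>A\<in>\<alpha>. \<forall>x\<in>A. \<forall>y\<in>A. \<kappa> x = \<kappa> y) \<and>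
     (\<forall>B\<in>sets \<mu>. (\<lambda>x. emeasure (\<kappa> x) B) \<in> borel_measurable (completion \<mu>) \<and>
                   emeasure \<mu> B = (\<integral>\<^sup>+x. emeasure (\<kappa> x) B \<partial>completion \<mu>))"

text \<open>
  By Rokhlin's theorem such a system exists, and any two agree almost everywhere, for a
  probability measure on a standard Borel space and a measurable partition.
\<close>

definition cond_measure :: "'a measure \<Rightarrow> 'a set set \<Rightarrow> 'a \<Rightarrow> 'a measure" where
  "cond_measure \<mu> \<alpha> = (SOME \<kappa>. conditional_system \<mu> \<alpha> \<kappa>)"

text \<open>The function \<open>-log\<close> on the unit interval, with value infinity at 0.\<close>

definition neg_log :: "real \<Rightarrow> ennreal" where
  "neg_log t = (if t = 0 then \<infinity> else ennreal (- ln t))"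

definition cond_entropy :: "'a measure \<Rightarrow> 'a set set \<Rightarrow> 'a set set \<Rightarrow> ennreal" where
  "cond_entropy \<mu> \<alpha> \<beta> =
     (\<integral>\<^sup>+x. neg_log (measure (completion (cond_measure \<mu> \<beta> x)) (atom \<alpha> x)) \<partial>\<mu>)"

definition partition_entropy :: "'a measure \<Rightarrow> ('a \<Rightarrow> 'a) \<Rightarrow> 'a set set \<Rightarrow> ennreal" where
  "partition_entropy \<mu> f \<alpha> = cond_entropy \<mu> (pullback \<mu> f \<alpha>) \<alpha>"


section \<open>Fibers and holonomy\<close>

definition fiber :: "'b measure \<Rightarrow> 'a \<Rightarrow> ('a \<times> 'b) set" where
  "fiber N p = {p} \<times> space N"

definition fiber_partition :: "'a measure \<Rightarrow> 'b measure \<Rightarrow> ('a \<times> 'b) set set" where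
  "fiber_partition M N = fiber N ` space M"

definition holonomy ::
  "'b measure \<Rightarrow> ('a \<times> 'b) set set \<Rightarrow> 'a \<Rightarrow> 'a \<Rightarrow> 'a \<times> 'b \<Rightarrow> 'a \<times> 'b" where
  "holonomy N \<xi> p q z = (THE w. w \<in> atom \<xi> z \<inter> fiber N q)"

definition holonomies_bijective ::
  "'a measure \<Rightarrow> 'b measure \<Rightarrow> ('a \<times> 'b) set set \<Rightarrow> ('a \<times> 'b) set set \<Rightarrow> bool" where
  "holonomies_bijective M N \<xi>cu \<xi>u \<longleftrightarrow>
     (\<forall>p\<in>space M. \<forall>q\<in>space M. (\<exists>A\<in>\<xi>cu. fiber N p \<subseteq> A \<and> fiber N q \<subseteq> A) \<longrightarrow>
        (\<forall>z\<in>fiber N p. \<exists>!w. w \<in> atom \<xi>u z \<inter> fiber N q) \<and>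
        bij_betw (holonomy N \<xi>u p q) (fiber N p) (fiber N q))"

text \<open>
  \<open>push_forward_eq \<mu> D g E \<nu>\<close>: the image under \<open>g\<close>, a map defined on \<open>D\<close>, of the
  measure \<open>\<mu>\<close> carried by \<open>D\<close> is \<open>\<nu>\<close>. Holonomies of a measurable partition are only
  controlled modulo null sets, hence \<open>g\<close> is required to be measurable for the completion.
\<close>

definition push_forward_eq ::
  "'a measure \<Rightarrow> 'a set \<Rightarrow> ('a \<Rightarrow> 'b) \<Rightarrow> 'b measure \<Rightarrow> 'b measure \<Rightarrow> bool" where
  "push_forward_eq \<mu> D g E \<nu> \<longleftrightarrow>
     g \<in> restrict_space (completion \<mu>) D \<rightarrow>\<^sub>M E \<and>
     distr (restrict_space (completion \<mu>) D) E g = \<nu>"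

definition holonomy_invariant ::
  "'a measure \<Rightarrow> 'b measure \<Rightarrow> ('a \<times> 'b) measure \<Rightarrow>
     ('a \<times> 'b) set set \<Rightarrow> ('a \<times> 'b) set set \<Rightarrow> bool" where
  "holonomy_invariant M N \<mu> \<xi>cu \<xi>u \<longleftrightarrow>
     (\<exists>S\<in>sets \<mu>. emeasure \<mu> (space \<mu> - S) = 0 \<and>
        (\<forall>x\<in>S. \<forall>y\<in>S. atom \<xi>cu x = atom \<xi>cu y \<longrightarrow>
           push_forward_eq (cond_measure \<mu> (fiber_partition M N) x) (fiber N (fst x))
             (holonomy N \<xi>u (fst x) (fst y)) (M \<Otimes>\<^sub>M N)
             (cond_measure \<mu> (fiber_partition M N) y)))"

end

theory Submission
  imports Defs
begin

text \<open>
  Each atom of \<open>\<xi>u\<close> is a graph over an atom of \<open>\<sigma>\<close>, and the atoms of \<open>F\<^sup>-\<^sup>1 \<xi>u\<close> are cut out of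
  these graphs by the atoms of \<open>f\<^sup>-\<^sup>1 \<sigma>\<close>. So the two entropies are the integrals of \<open>-log v\<close> and
  \<open>-log u\<close>, where \<open>v\<close> and \<open>u\<close> are the masses that the atom of \<open>f\<^sup>-\<^sup>1 \<sigma>\<close> at the base point receives
  from the projected conditional measure of \<open>\<mu>\<close> given \<open>\<xi>u\<close> and from the conditional measure of \<open>m\<close>
  given \<open>\<sigma>\<close>. Since the integral of \<open>u / v\<close> is at most 1, the inequality
  follows from \<open>log r \<le> r - 1\<close>, and equality forces \<open>u = v\<close>: given \<open>\<sigma>\<close>, the partition
  \<open>f\<^sup>-\<^sup>1 \<sigma>\<close> is independent of \<open>\<xi>u\<close>. By invariance this extends to all \<open>f\<^sup>-\<^sup>n \<sigma>\<close>, hence,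
  as \<open>\<sigma>\<close> generates, to the whole base: given \<open>\<sigma>\<close>, the base point is independent of the atom of
  \<open>\<xi>u\<close>. By symmetry, the law of the atom of \<open>\<xi>u\<close> under the conditional
  measure on a fiber depends only on the atom of \<open>\<sigma>\<close>, which is the invariance of the
  disintegration under holonomies. The converse runs through the same equivalences.
\<close>

section \<open>Coding standard Borel spaces by binary sequences\<close>

text \<open>Conditional measures are determined only almost everywhere, atoms and holonomies need
  not be Borel, and yet invariance compares uncountably many pairs of fibers. Hence partitions are
  replaced by real codes \<open>s\<close> and \<open>t\<close>, and conditional measures by Borel
  kernels over these codes; kernels are compared on rational half-lines, at the cost of countably
  many null sets. Fibers are never matched pair by pair: each one is compared with the conditional
  measure given \<xi>cu, a reference common to all fibers over one atom of \<sigma>. The integral of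
  \<open>u / v\<close> is bounded by rewriting it as a countable sum in which the denominators
  cancel, and for this the projected conditional law has to be purely atomic. Finiteness of the
  entropy of \<sigma> provides this, since it makes \<open>u\<close> positive almost everywhere; it
  also allows one to pass from equal integrals to equal integrands.\<close>

definition ternary :: "(nat \<Rightarrow> bool) \<Rightarrow> real" where
  "ternary a = (\<Sum>n. (if a n then 2 else 0) * (1 / 3) ^ Suc n)"

text \<open>With digits 0 and 2 in base 3 the value lies in [0, 1/3] or in [2/3, 1] according to the
  first digit, so the threshold 1/2 reads it off and no real has two such expansions. The iterated
  map removes the leading digit; it is defined on all reals, so decoding is a total Borel
  operation.\<close>

definition ternary_digit :: "nat \<Rightarrow> real \<Rightarrow> bool" where
  "ternary_digit n x \<longleftrightarrow> 1 / 2 \<le> ((\<lambda>y. 3 * y - (if 1 / 2 \<le> y then 2 else 0)) ^^ n) x"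

lemma summable_ternary: "summable (\<lambda>n. (if a n then 2 else 0) * (1 / 3 :: real) ^ Suc n)"
proof (rule summable_comparison_test')
  show "summable (\<lambda>n. 2 * (1 / 3 :: real) ^ Suc n)"
    by (intro summable_mult) (simp add: summable_geometric)
  show "norm ((if a n then 2 else 0) * (1 / 3 :: real) ^ Suc n) \<le> 2 * (1 / 3) ^ Suc n" if "n \<ge> 0" for n
    by simp
qed

lemma ternary_nonneg: "0 \<le> ternary a"
  unfolding ternary_def by (intro suminf_nonneg summable_ternary) auto

lemma ternary_le_1: "ternary a \<le> 1"
proof -
  have "(\<lambda>n. (1 / 3 :: real) ^ Suc n) sums (1 / 2)"
    using sums_mult[OF geometric_sums[of "1 / 3 :: real"], of "1 / 3"] by simp
  then have s: "(\<lambda>n. 2 * (1 / 3 :: real) ^ Suc n) sums 1"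
    using sums_mult[of "\<lambda>n. (1 / 3 :: real) ^ Suc n" "1/2" 2] by simp
  have "ternary a \<le> (\<Sum>n. 2 * (1 / 3 :: real) ^ Suc n)"
    unfolding ternary_def using s by (intro suminf_le summable_ternary) (auto simp: sums_iff)
  also have "\<dots> = 1"
    using s by (simp add: sums_iff)
  finally show ?thesis .
qed

lemma ternary_unfold: "ternary a = ((if a 0 then 2 else 0) + ternary (\<lambda>n. a (Suc n))) / 3"
proof -
  have "ternary a = (\<Sum>n. (if a (Suc n) then 2 else 0) * (1 / 3) ^ Suc (Suc n)) + (if a 0 then 2 else 0) / 3"
    unfolding ternary_def using suminf_split_head[OF summable_ternary, of a] by simp
  also have "(\<Sum>n. (if a (Suc n) then 2 else 0) * (1 / 3 :: real) ^ Suc (Suc n))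
      = ternary (\<lambda>n. a (Suc n)) / 3"
    unfolding ternary_def
    using suminf_divide[OF summable_ternary, of "\<lambda>n. a (Suc n)" 3] by (simp add: field_simps)
  finally show ?thesis by (simp add: field_simps)
qed

lemma ternary_digit_ternary: "ternary_digit n (ternary a) \<longleftrightarrow> a n"
proof -
  have *: "1 / 2 \<le> ternary a \<longleftrightarrow> a 0" for a
    using ternary_unfold[of a] ternary_nonneg[of "\<lambda>n. a (Suc n)"] ternary_le_1[of "\<lambda>n. a (Suc n)"]
    by (auto split: if_splits)
  have "((\<lambda>y. 3 * y - (if 1 / 2 \<le> y then 2 else 0)) ^^ n) (ternary a) = ternary (\<lambda>k. a (n + k))"
  proof (induction n)
    case (Suc n)
    have "((\<lambda>y. 3 * y - (if 1 / 2 \<le> y then 2 else 0)) ^^ Suc n) (ternary a)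
        = 3 * ternary (\<lambda>k. a (n + k)) - (if 1 / 2 \<le> ternary (\<lambda>k. a (n + k)) then 2 else 0)"
      by (simp only: funpow.simps o_apply Suc)
    also have "\<dots> = ternary (\<lambda>k. a (Suc n + k))"
      using ternary_unfold[of "\<lambda>k. a (n + k)"] *[of "\<lambda>k. a (n + k)"] by simp
    finally show ?case .
  qed simp
  with *[of "\<lambda>k. a (n + k)"] show ?thesis
    by (simp add: ternary_digit_def)
qed

lemma ternary_inject: "ternary a = ternary b \<longleftrightarrow> (\<forall>n. a n \<longleftrightarrow> b n)"
proof
  assume "ternary a = ternary b"
  then show "\<forall>n. a n \<longleftrightarrow> b n" by (metis ternary_digit_ternary)
next
  assume "\<forall>n. a n \<longleftrightarrow> b n"
  then have "a = b" by (intro ext) simp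
  then show "ternary a = ternary b" by simp
qed

lemma measurable_ternary [measurable]:
  assumes [measurable]: "\<And>n. Measurable.pred E (P n)"
  shows "(\<lambda>x. ternary (\<lambda>n. P n x)) \<in> borel_measurable E"
  unfolding ternary_def by measurable

lemma measurable_ternary_digit [measurable]: "Measurable.pred borel (ternary_digit n)"
proof -
  have step: "(\<lambda>y::real. 3 * y - (if 1 / 2 \<le> y then 2 else 0)) \<in> borel \<rightarrow>\<^sub>M borel"
    by measurable
  have iter: "((\<lambda>y::real. 3 * y - (if 1 / 2 \<le> y then 2 else 0)) ^^ n) \<in> borel \<rightarrow>\<^sub>M borel"
  proof (induction n)
    case (Suc n)
    then show ?case
      unfolding funpow.simps by (rule measurable_comp[OF _ step])
  qed (simp add: id_def)
  have le: "Measurable.pred borel (\<lambda>y::real. 1 / 2 \<le> y)"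
    by measurable
  show ?thesis
    unfolding ternary_digit_def[abs_def] by (rule measurable_compose[OF iter le])
qed

text \<open>
  By ternary expansion this embeds the space into the unit interval with a measurable
  retraction, which replaces the Borel isomorphism theorem: no measurability of images is needed.
\<close>

definition binary_coded :: "'a measure \<Rightarrow> bool" where
  "binary_coded E \<longleftrightarrow>
     (\<exists>P g. (\<forall>n. Measurable.pred E (P n)) \<and> g \<in> borel \<rightarrow>\<^sub>M E \<and>
        (\<forall>x\<in>space E. g (ternary (\<lambda>n. P n x)) = x))"

text \<open>The bounds 0 and 1 are recorded because they make the conditional distribution functions
  in \<open>real_kernel_exists\<close> constant outside the unit interval, which settles their
  limits at infinity.\<close>

lemma binary_coded_imp_retract:
  fixes E :: "'a measure"
  assumes "binary_coded E"
  shows "\<exists>\<phi> g. \<phi> \<in> borel_measurable E \<and> g \<in> borel \<rightarrow>\<^sub>M E \<and> (\<forall>x\<in>space E. g (\<phi> x) = x) \<and>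
    (\<forall>x. 0 \<le> \<phi> x \<and> \<phi> x \<le> (1::real))"
proof -
  from assms obtain P g where *: "\<And>n. Measurable.pred E (P n)" "g \<in> borel \<rightarrow>\<^sub>M E"
    "\<forall>x\<in>space E. g (ternary (\<lambda>n. P n x)) = x"
    unfolding binary_coded_def by blast
  show ?thesis
    by (rule exI[of _ "\<lambda>x. ternary (\<lambda>n. P n x)"], rule exI[of _ g])
      (use * ternary_nonneg ternary_le_1 in auto)
qed

lemma binary_coded_cong:
  assumes "sets E = sets E'"
  shows "binary_coded E \<longleftrightarrow> binary_coded E'"
  unfolding binary_coded_def
  by (simp only: measurable_cong_sets[OF assms refl] measurable_cong_sets[OF refl assms]
      sets_eq_imp_space_eq[OF assms])

lemma binary_coded_pair:
  assumes "binary_coded M" "binary_coded N"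
  shows "binary_coded (M \<Otimes>\<^sub>M N)"
proof -
  from assms(1) obtain P g where P [measurable]: "\<And>n. Measurable.pred M (P n)" "g \<in> borel \<rightarrow>\<^sub>M M"
    and g: "\<forall>x\<in>space M. g (ternary (\<lambda>n. P n x)) = x"
    unfolding binary_coded_def by blast
  from assms(2) obtain Q h where Q [measurable]: "\<And>n. Measurable.pred N (Q n)" "h \<in> borel \<rightarrow>\<^sub>M N"
    and h: "\<forall>x\<in>space N. h (ternary (\<lambda>n. Q n x)) = x"
    unfolding binary_coded_def by blast
  \<comment> \<open>Interleaving: even positions carry the code of the first coordinate, odd
    positions that of the second; \<open>k\<close> decodes the two halves separately.\<close>
  define R where "R n x = (if even n then P (n div 2) (fst x) else Q (n div 2) (snd x))" for n x
  define k where "k y = (g (ternary (\<lambda>n. ternary_digit (2 * n) y)),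
      h (ternary (\<lambda>n. ternary_digit (2 * n + 1) y)))" for y
  have "Measurable.pred (M \<Otimes>\<^sub>M N) (R n)" for n
    unfolding R_def[abs_def] by (cases "even n") simp_all
  moreover have "k \<in> borel \<rightarrow>\<^sub>M M \<Otimes>\<^sub>M N"
    unfolding k_def[abs_def] by measurable
  moreover have "k (ternary (\<lambda>n. R n x)) = x" if "x \<in> space (M \<Otimes>\<^sub>M N)" for x
    using that g h by (auto simp: k_def ternary_digit_ternary R_def space_pair_measure)
  ultimately show ?thesis unfolding binary_coded_def by blast
qed

text \<open>
  A point is coded by the indices of the first points of a dense sequence at distance
  less than \<open>2^-k\<close>, and recovered as the limit of these points.
\<close>

lemma standard_borel_space_imp_binary_coded:
  assumes "standard_borel_space E" and ne: "space E \<noteq> {}"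
  shows "binary_coded E"
proof -
  from assms(1) obtain T where T: "topspace T = space E" "completely_metrizable_space T"
    "second_countable T" and sE: "sets E = sigma_sets (space E) {U. openin T U}"
    unfolding standard_borel_space_def by blast
  from T(2) obtain S d where S: "Metric_space S d" "Metric_space.mcomplete S d"
    and TS: "T = Metric_space.mtopology S d"
    unfolding completely_metrizable_space_def by blast
  interpret Metric_space S d by (fact S(1))
  have SE: "S = space E" using T(1) by (simp add: TS)
  from second_countable_imp_separable_space[OF T(3)] obtain D where D: "countable D" "D \<subseteq> S"
    "mtopology closure_of D = S"
    unfolding separable_space_def by (auto simp: TS)
  have "D \<noteq> {}" using D(3) ne SE by (metis closure_of_empty)
  define e where "e = from_nat_into D"
  have eD: "range e = D" unfolding e_def using D \<open>D \<noteq> {}\<close> by (simp add: range_from_nat_into)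
  have eS [simp]: "e n \<in> S" for n using eD D by blast
  have dense: "\<exists>n. d x (e n) < r" if "x \<in> S" "r > 0" for x r
  proof -
    from that D(3) have "\<exists>y\<in>D. y \<in> mball x r"
      unfolding metric_closure_of by blast
    then show ?thesis using eD by (auto simp: in_mball)
  qed
  have open_sets: "U \<in> sets E" if "openin mtopology U" for U
    unfolding sE using that TS by auto
  \<comment> \<open>The index \<open>n\<close> encodes a pair (i, k), and the bit records whether
    \<open>x\<close> is within 2^-k of the dense point \<open>e i\<close>.\<close>
  define P where "P n x \<longleftrightarrow> d (e (fst (prod_decode n))) x < (1/2) ^ snd (prod_decode n)" for n x
  have P: "Measurable.pred E (P n)" for n
  proof -
    have "{x \<in> space E. P n x} = mball (e (fst (prod_decode n))) ((1/2) ^ snd (prod_decode n))"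
      by (auto simp: P_def in_mball simp flip: SE)
    then show ?thesis using open_sets[OF openin_mball] by (simp add: pred_def)
  qed
  \<comment> \<open>If no bit is set at level \<open>k\<close>, \<open>LEAST\<close> still denotes
    some number, so \<open>s y\<close> is a sequence of dense points for every real
    \<open>y\<close>. Whether it converges is decided by a Cauchy test, with \<open>e 0\<close> as
    the default limit.\<close>
  define N where "N k y = (LEAST n. ternary_digit (prod_encode (n, k)) y)" for k y
  have [measurable]: "N k \<in> borel \<rightarrow>\<^sub>M count_space UNIV" for k
    unfolding N_def[abs_def] by (intro measurable_Least measurable_ternary_digit)
  define s where "s y k = e (N k y)" for y k
  have dm' [measurable]: "(\<lambda>y. d (e n) (s y l)) \<in> borel_measurable borel" for n l
    unfolding s_def by (rule measurable_compose[of "N l" borel "count_space UNIV"]) auto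
  have dm [measurable]: "(\<lambda>y. d (s y k) (s y l)) \<in> borel_measurable borel" for k l
    using measurable_compose_countable[of "\<lambda>i y. d (e i) (s y l)" borel borel "N k"]
    by (simp add: s_def)
  \<comment> \<open>Tolerances 1/(j+1) make the criterion a countable combination of Borel
    conditions on \<open>y\<close>.\<close>
  have Cauchy: "MCauchy (s y) \<longleftrightarrow> (\<forall>j. \<exists>K. \<forall>k l. K \<le> k \<longrightarrow> K \<le> l \<longrightarrow> d (s y k) (s y l) < 1 / real (Suc j))" for y
  proof
    assume L: "MCauchy (s y)"
    show "\<forall>j. \<exists>K. \<forall>k l. K \<le> k \<longrightarrow> K \<le> l \<longrightarrow> d (s y k) (s y l) < 1 / real (Suc j)"
    proof
      fix j
      have "0 < 1 / real (Suc j)" by simp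
      then show "\<exists>K. \<forall>k l. K \<le> k \<longrightarrow> K \<le> l \<longrightarrow> d (s y k) (s y l) < 1 / real (Suc j)"
        using L unfolding MCauchy_def by blast
    qed
  next
    assume R: "\<forall>j. \<exists>K. \<forall>k l. K \<le> k \<longrightarrow> K \<le> l \<longrightarrow> d (s y k) (s y l) < 1 / real (Suc j)"
    show "MCauchy (s y)" unfolding MCauchy_def
    proof (intro conjI allI impI)
      fix \<epsilon> :: real assume "\<epsilon> > 0"
      then obtain j where j: "1 / real (Suc j) < \<epsilon>"
        using nat_approx_posE by blast
      from R obtain K where "\<forall>k l. K \<le> k \<longrightarrow> K \<le> l \<longrightarrow> d (s y k) (s y l) < 1 / real (Suc j)" by blast
      then show "\<exists>K. \<forall>n n'. K \<le> n \<longrightarrow> K \<le> n' \<longrightarrow> d (s y n) (s y n') < \<epsilon>"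
        using j by (meson less_trans)
    qed (auto simp: s_def)
  qed
  have Cm [measurable]: "Measurable.pred borel (\<lambda>y. MCauchy (s y))"
    unfolding Cauchy by measurable
  define g where "g y = (if MCauchy (s y) then SOME l. limitin mtopology (s y) l sequentially else e 0)" for y
  have glim: "limitin mtopology (s y) (g y) sequentially" if "MCauchy (s y)" for y
    using S(2) that unfolding g_def mcomplete_def by (auto intro: someI_ex)
  have gS: "g y \<in> S" for y
    using glim[of y] limitin_topspace[of mtopology] by (cases "MCauchy (s y)") (auto simp: g_def)
  \<comment> \<open>Measurability of the limit is tested through its distances to the dense points.
    These are real limits of Borel functions, and they describe the preimages of open sets
    below.\<close>
  have dg [measurable]: "(\<lambda>y. d (e n) (g y)) \<in> borel_measurable borel" for n
  proof -
    have "d (e n) (g y) = (if MCauchy (s y) then lim (\<lambda>k. d (e n) (s y k)) else d (e n) (e 0))" for y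
    proof (cases "MCauchy (s y)")
      case True
      have "(\<lambda>k. d (e n) (s y k)) \<longlonglongrightarrow> d (e n) (g y)"
      proof (rule metric_LIMSEQ_I)
        fix r :: real assume "r > 0"
        then obtain K where "\<forall>k\<ge>K. d (s y k) (g y) < r"
          using glim[OF True] unfolding limit_metric_sequentially by blast
        moreover have "dist (d (e n) (s y k)) (d (e n) (g y)) \<le> d (s y k) (g y)" for k
          using triangle[of "e n" "s y k" "g y"] triangle[of "e n" "g y" "s y k"] gS[of y]
          by (auto simp: dist_real_def s_def commute)
        ultimately show "\<exists>no. \<forall>k\<ge>no. dist (d (e n) (s y k)) (d (e n) (g y)) < r"
          by (meson le_less_trans)
      qed
      with True show ?thesis by (simp add: limI)
    qed (simp add: g_def)
    then have eq: "(\<lambda>y. d (e n) (g y)) =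
        (\<lambda>y. if MCauchy (s y) then lim (\<lambda>k. d (e n) (s y k)) else d (e n) (e 0))"
      by (rule ext)
    show ?thesis unfolding eq by measurable
  qed
  have "g \<in> borel \<rightarrow>\<^sub>M E"
  proof (rule measurable_sigma_sets[OF sE])
    show "{U. openin T U} \<subseteq> Pow (space E)" using T(1) openin_subset by auto
    show "g \<in> space borel \<rightarrow> space E" using gS SE by auto
    fix U assume "U \<in> {U. openin T U}"
    then have U: "openin mtopology U" by (simp add: TS)
    \<comment> \<open>An open set is the union of those balls inside it that have a dense point as
      centre and a radius 1/(j+1): a countable union.\<close>
    have "g y \<in> U \<longleftrightarrow> (\<exists>n j. mball (e n) (1 / real (Suc j)) \<subseteq> U \<and> d (e n) (g y) < 1 / real (Suc j))" for y
    proof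
      assume "g y \<in> U"
      then obtain r where r: "r > 0" "mball (g y) r \<subseteq> U"
        using U unfolding openin_mtopology by blast
      obtain j where j: "1 / real (Suc j) < r / 2" using nat_approx_posE[of "r/2"] r by auto
      obtain n where n: "d (g y) (e n) < 1 / real (Suc j)"
        using dense[OF gS, of "1 / real (Suc j)" y] by auto
      have "mball (e n) (1 / real (Suc j)) \<subseteq> mball (g y) r"
      proof
        fix z assume "z \<in> mball (e n) (1 / real (Suc j))"
        then show "z \<in> mball (g y) r"
          using n j triangle[of "g y" "e n" z] gS[of y] by (auto simp: in_mball)
      qed
      then show "\<exists>n j. mball (e n) (1 / real (Suc j)) \<subseteq> U \<and> d (e n) (g y) < 1 / real (Suc j)"
        using r n by (metis commute order_trans)
    next
      assume "\<exists>n j. mball (e n) (1 / real (Suc j)) \<subseteq> U \<and> d (e n) (g y) < 1 / real (Suc j)"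
      then show "g y \<in> U" using gS[of y] eS by (metis in_mball subsetD)
    qed
    then have "g -` U \<inter> space borel = {y \<in> space borel. \<exists>n j. mball (e n) (1 / real (Suc j)) \<subseteq> U \<and> d (e n) (g y) < 1 / real (Suc j)}"
      by auto
    also have "\<dots> \<in> sets borel" by measurable
    finally show "g -` U \<inter> space borel \<in> sets borel" .
  qed
  moreover have "g (ternary (\<lambda>n. P n x)) = x" if "x \<in> space E" for x
  proof -
    let ?y = "ternary (\<lambda>n. P n x)"
    have x: "x \<in> S" using that SE by simp
    have close: "d (s ?y k) x < (1/2) ^ k" for k
    proof -
      obtain n where "d x (e n) < (1/2) ^ k" using dense[OF x, of "(1/2)^k"] by auto
      then have "ternary_digit (prod_encode (n, k)) ?y"
        by (simp add: ternary_digit_ternary P_def commute)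
      then have "ternary_digit (prod_encode (N k ?y, k)) ?y"
        unfolding N_def by (rule LeastI)
      then show ?thesis by (simp add: ternary_digit_ternary P_def s_def)
    qed
    have lim: "limitin mtopology (s ?y) x sequentially"
      unfolding limit_metric_sequentially
    proof (intro conjI x allI impI)
      fix r :: real assume "r > 0"
      have "(\<lambda>k. (1/2 :: real) ^ k) \<longlonglongrightarrow> 0" by (rule LIMSEQ_realpow_zero) auto
      with \<open>r > 0\<close> obtain K where K: "\<forall>k\<ge>K. (1/2 :: real) ^ k < r"
        by (metis eventually_sequentially order_tendstoD(2))
      show "\<exists>K. \<forall>k\<ge>K. s ?y k \<in> S \<and> d (s ?y k) x < r"
        using K close by (intro exI[of _ K]) (auto simp: s_def intro: less_trans)
    qed
    then have "MCauchy (s ?y)"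
      by (intro convergent_imp_MCauchy) (auto simp: s_def)
    then have "limitin mtopology (s ?y) (g ?y) sequentially" by (rule glim)
    with lim show ?thesis
      by (meson limitin_metric_unique trivial_limit_sequentially)
  qed
  ultimately show ?thesis unfolding binary_coded_def using P by blast
qed

section \<open>Regular conditional distributions\<close>

lemma AE_le_if_nn_integral_le:
  assumes [measurable]: "f \<in> borel_measurable M" "g \<in> borel_measurable M"
    and le: "\<And>A. A \<in> sets M \<Longrightarrow> (\<integral>\<^sup>+x. indicator A x * f x \<partial>M) \<le> (\<integral>\<^sup>+x. indicator A x * g x \<partial>M)"
    and fin: "(\<integral>\<^sup>+x. g x \<partial>M) < \<infinity>"
  shows "AE x in M. f x \<le> (g x :: ennreal)"
proof -
  define A where "A = {x \<in> space M. g x < f x}"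
  have A [measurable]: "A \<in> sets M" unfolding A_def by measurable
  have "(\<integral>\<^sup>+x. indicator A x * g x \<partial>M) \<le> (\<integral>\<^sup>+x. g x \<partial>M)"
    by (intro nn_integral_mono) (auto split: split_indicator)
  with fin have finA: "(\<integral>\<^sup>+x. indicator A x * g x \<partial>M) \<noteq> \<infinity>" by (auto simp: top_unique)
  have "(\<integral>\<^sup>+x. indicator A x * f x - indicator A x * g x \<partial>M)
      = (\<integral>\<^sup>+x. indicator A x * f x \<partial>M) - (\<integral>\<^sup>+x. indicator A x * g x \<partial>M)"
    using finA by (intro nn_integral_diff AE_I2) (auto simp: A_def split: split_indicator)
  also have "\<dots> = 0" using le[OF A] by (metis diff_eq_0_iff_ennreal finA le_less_trans less_top infinity_ennreal_def)
  finally have "AE x in M. indicator A x * f x - indicator A x * g x = 0"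
    by (subst (asm) nn_integral_0_iff_AE) auto
  moreover have "AE x in M. g x \<noteq> \<infinity>"
    using fin by (intro nn_integral_PInf_AE) auto
  ultimately show ?thesis
    using AE_space
  proof eventually_elim
    case (elim x)
    then show ?case
      by (cases "x \<in> A") (auto simp: A_def ennreal_minus_eq_0)
  qed
qed

lemma borel_eq_atMost_rat: "borel = sigma UNIV (range (\<lambda>q. {..real_of_rat q}))"
proof (rule borel_eq_sigmaI1[OF borel_eq_atMost, where F = "\<lambda>q. {..real_of_rat q}" and A = UNIV])
  fix X assume "X \<in> range (atMost :: real \<Rightarrow> _)"
  then obtain x where X: "X = {..x}" by blast
  have "{..x} = (\<Inter>q\<in>{q. x < of_rat q}. {..real_of_rat q})"
  proof safe
    fix y assume y: "y \<in> (\<Inter>q\<in>{q. x < of_rat q}. {..real_of_rat q})"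
    show "y \<le> x"
    proof (rule ccontr)
      assume "\<not> y \<le> x"
      then obtain q where "x < of_rat q" "of_rat q < y" using of_rat_dense[of x y] by auto
      with y show False by auto
    qed
  qed auto
  also have "\<dots> \<in> sets (sigma UNIV (range (\<lambda>q. {..real_of_rat q})))"
    by (intro sets.countable_INT'') (auto intro: sigma_sets_top)
  finally show "X \<in> sets (sigma UNIV (range (\<lambda>q. {..real_of_rat q})))" by (simp only: X)
qed auto

text \<open>Only countably many sets are tested, so equality of two kernels at almost every point
  can be derived from identities each of which holds almost everywhere.\<close>

lemma borel_measure_eqI_rat:
  assumes sets: "sets P = sets borel" "sets Q = sets borel"
    and eq: "\<And>q. emeasure P {..real_of_rat q} = emeasure Q {..real_of_rat q}"
    and fin: "\<And>q. emeasure P {..real_of_rat q} \<noteq> \<infinity>"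
  shows "P = Q"
proof (rule measure_eqI_generator_eq_countable)
  let ?E = "range (\<lambda>q. {..real_of_rat q})"
  show "Int_stable ?E"
  proof (rule Int_stableI)
    fix a b assume "a \<in> ?E" "b \<in> ?E"
    then obtain p q where "a = {..real_of_rat p}" "b = {..real_of_rat q}" by blast
    then have "a \<inter> b = {..real_of_rat (min p q)}"
      by (auto simp: min_def of_rat_less_eq intro: order_trans)
    then show "a \<inter> b \<in> ?E" by blast
  qed
  show "sets P = sigma_sets UNIV ?E" "sets Q = sigma_sets UNIV ?E"
    unfolding sets by (subst borel_eq_atMost_rat, simp)+
  show "\<Union>?E = UNIV"
  proof safe
    fix x :: real
    obtain q where "x < of_rat q" using of_rat_dense[of x "x + 1"] by auto
    then show "x \<in> \<Union>?E" by (auto intro: less_imp_le)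
  qed auto
qed (use eq fin in auto)

text \<open>Each \<open>B\<close> has its own exceptional null set. Coding the space on the line
  leaves only the preimages of rational half-lines to be tested; the retraction then carries
  equality of the image measures back.\<close>

lemma AE_kernel_eqI:
  fixes E :: "'a measure"
  assumes E: "binary_coded E"
    and K: "\<And>x. x \<in> space M \<Longrightarrow> K x \<in> space (prob_algebra E)"
    and K': "\<And>x. x \<in> space M \<Longrightarrow> K' x \<in> space (prob_algebra E)"
    and eq: "\<And>B. B \<in> sets E \<Longrightarrow> AE x in M. emeasure (K x) B = emeasure (K' x) B"
  shows "AE x in M. K x = K' x"
proof -
  from binary_coded_imp_retract[OF E] obtain \<phi> :: "'a \<Rightarrow> real" and g
    where [measurable]: "\<phi> \<in> borel_measurable E" "g \<in> borel \<rightarrow>\<^sub>M E"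
      and g: "\<And>x. x \<in> space E \<Longrightarrow> g (\<phi> x) = x" by blast
  have "AE x in M. \<forall>q. emeasure (K x) (\<phi> -` {..real_of_rat q} \<inter> space E) = emeasure (K' x) (\<phi> -` {..real_of_rat q} \<inter> space E)"
    unfolding AE_all_countable by (intro allI eq) measurable
  with AE_space show ?thesis
  proof eventually_elim
    fix x assume x: "x \<in> space M" and q: "\<forall>q. emeasure (K x) (\<phi> -` {..real_of_rat q} \<inter> space E) = emeasure (K' x) (\<phi> -` {..real_of_rat q} \<inter> space E)"
    have s: "sets (K x) = sets E" "sets (K' x) = sets E" "prob_space (K x)" "prob_space (K' x)"
      using K[OF x] K'[OF x] by (auto simp: space_prob_algebra)
    note [measurable_cong] = s(1,2)
    note sp = sets_eq_imp_space_eq[OF s(1)] sets_eq_imp_space_eq[OF s(2)]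
    have "distr (K x) borel \<phi> = distr (K' x) borel \<phi>"
      using q finite_measure.emeasure_finite[OF prob_space.finite_measure[OF s(4)]]
      by (intro borel_measure_eqI_rat) (auto simp: emeasure_distr sp)
    then have "distr (distr (K x) borel \<phi>) E g = distr (distr (K' x) borel \<phi>) E g" by simp
    then have "distr (K x) E (g \<circ> \<phi>) = distr (K' x) E (g \<circ> \<phi>)" by (simp add: distr_distr)
    moreover have "distr (K x) E (g \<circ> \<phi>) = distr (K x) (K x) (\<lambda>x. x)"
      using g s by (intro distr_cong) (auto simp: sp)
    moreover have "distr (K' x) E (g \<circ> \<phi>) = distr (K' x) (K' x) (\<lambda>x. x)"
      using g s by (intro distr_cong) (auto simp: sp)
    ultimately show "K x = K' x" by simp
  qed
qed

text \<open>Radon-Nikodym derivatives give, for each \<open>r\<close>, the conditional probability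
  of \<open>\<phi> x \<le> r\<close> up to a null set. Monotonicity and bounds are secured
  simultaneously for rational \<open>r\<close>, and approximation from the right by rationals then
  yields genuine distribution functions that depend measurably on the value of
  \<open>t\<close>.\<close>

lemma real_kernel_exists:
  assumes "prob_space \<mu>" and [measurable]: "\<phi> \<in> borel_measurable \<mu>" and t [measurable]: "t \<in> \<mu> \<rightarrow>\<^sub>M L"
    and \<phi>: "\<And>x. 0 \<le> \<phi> x" "\<And>x. \<phi> x \<le> (1::real)"
  shows "\<exists>K\<in>L \<rightarrow>\<^sub>M prob_algebra borel. \<forall>B\<in>sets borel. \<forall>D\<in>sets L.
     emeasure \<mu> {x \<in> space \<mu>. t x \<in> D \<and> \<phi> x \<in> B} = (\<integral>\<^sup>+x. indicator D (t x) * emeasure (K (t x)) B \<partial>\<mu>)"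
proof -
  interpret \<mu>: prob_space \<mu> by fact
  define \<nu> where "\<nu> = distr \<mu> L t"
  interpret \<nu>: prob_space \<nu> unfolding \<nu>_def by (rule \<mu>.prob_space_distr) fact
  have sl [measurable_cong]: "sets \<nu> = sets L" and spl [simp]: "space \<nu> = space L" by (auto simp: \<nu>_def)
  let ?S = "\<lambda>D r. {x \<in> space \<mu>. t x \<in> D \<and> \<phi> x \<le> r}"
  define N where "N r = distr (density \<mu> (indicator {x\<in>space \<mu>. \<phi> x \<le> r})) L t" for r
  have N: "emeasure (N r) D = emeasure \<mu> (?S D r)" if D [measurable]: "D \<in> sets L" for r D
  proof -
    have "emeasure (N r) D = emeasure (density \<mu> (indicator {x\<in>space \<mu>. \<phi> x \<le> r})) (t -` D \<inter> space \<mu>)"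
      unfolding N_def using D by (subst emeasure_distr) auto
    also have "\<dots> = (\<integral>\<^sup>+ x. indicator {x\<in>space \<mu>. \<phi> x \<le> r} x * indicator (t -` D \<inter> space \<mu>) x \<partial>\<mu>)"
      by (intro emeasure_density) measurable
    also have "\<dots> = (\<integral>\<^sup>+ x. indicator (?S D r) x \<partial>\<mu>)"
      by (intro nn_integral_cong) (auto split: split_indicator)
    also have "\<dots> = emeasure \<mu> (?S D r)"
      using D by (intro nn_integral_indicator) measurable
    finally show ?thesis .
  qed
  define F where "F r = RN_deriv \<nu> (N r)" for r
  have Fm [measurable]: "F r \<in> borel_measurable L" for r
    using borel_measurable_RN_deriv[of \<nu> "N r"] by (simp add: F_def measurable_def)
  have ac: "absolutely_continuous \<nu> (N r)" for r
  proof (unfold absolutely_continuous_def, safe)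
    fix D assume "D \<in> null_sets \<nu>"
    then have D: "D \<in> sets L" "emeasure \<mu> (t -` D \<inter> space \<mu>) = 0"
      by (auto simp: null_sets_def \<nu>_def emeasure_distr)
    have "emeasure \<mu> (?S D r) = 0"
      using D by (intro emeasure_eq_0[OF _ D(2)]) auto
    then have "emeasure (N r) D = 0" using N[OF D(1)] by (simp only:)
    moreover have "D \<in> sets (N r)" using D(1) by (simp add: N_def)
    ultimately show "D \<in> null_sets (N r)" by (rule null_setsI)
  qed
  have F: "(\<integral>\<^sup>+y. indicator D y * F r y \<partial>\<nu>) = emeasure \<mu> (?S D r)"
    if D: "D \<in> sets L" for r D
  proof -
    have "sets (N r) = sets \<nu>" by (simp add: N_def sl)
    moreover have "indicator D \<in> borel_measurable \<nu>" using D by (intro borel_measurable_indicator) (simp add: sl)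
    ultimately have "integral\<^sup>N (N r) (indicator D) = (\<integral>\<^sup>+y. F r y * indicator D y \<partial>\<nu>)"
      unfolding F_def by (rule \<nu>.RN_deriv_nn_integral[OF ac])
    also have "integral\<^sup>N (N r) (indicator D) = emeasure (N r) D"
      using D by (intro nn_integral_indicator) (simp add: N_def)
    finally show ?thesis using N[OF D] by (simp add: mult.commute)
  qed
  have lt: "emeasure \<mu> {x \<in> space \<mu>. t x \<in> D} = (\<integral>\<^sup>+y. indicator D y * 1 \<partial>\<nu>)" if D: "D \<in> sets L" for D
  proof -
    have "{x \<in> space \<mu>. t x \<in> D} = t -` D \<inter> space \<mu>" by auto
    then show ?thesis using D by (simp add: \<nu>_def emeasure_distr)
  qed
  have fin: "(\<integral>\<^sup>+y. F r y \<partial>\<nu>) < \<infinity>" for r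
  proof -
    have "(\<integral>\<^sup>+y. F r y \<partial>\<nu>) = (\<integral>\<^sup>+y. indicator (space L) y * F r y \<partial>\<nu>)"
      by (intro nn_integral_cong) (auto split: split_indicator)
    then show ?thesis using F[of "space L" r] by (simp add: \<mu>.emeasure_finite less_top[symmetric])
  qed
  have F_le: "AE y in \<nu>. F r y \<le> g y"
    if "g \<in> borel_measurable L" "(\<integral>\<^sup>+y. g y \<partial>\<nu>) < \<infinity>"
      and "\<And>D. D \<in> sets L \<Longrightarrow> emeasure \<mu> (?S D r) \<le> (\<integral>\<^sup>+y. indicator D y * g y \<partial>\<nu>)" for r g
    using that by (intro AE_le_if_nn_integral_le) (simp_all add: F sl)
  have mono: "AE y in \<nu>. F r y \<le> F s y" if "r \<le> s" for r s
    by (rule F_le) (use that fin[of s] in \<open>auto simp: F intro!: emeasure_mono\<close>)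
  have Fle1: "AE y in \<nu>. F r y \<le> 1" for r
  proof (rule F_le)
    fix D assume D: "D \<in> sets L"
    show "emeasure \<mu> (?S D r) \<le> (\<integral>\<^sup>+y. indicator D y * 1 \<partial>\<nu>)"
      unfolding lt[OF D, symmetric] using D by (intro emeasure_mono) auto
  qed (use \<nu>.emeasure_space_1 in auto)
  have Fge1: "AE y in \<nu>. 1 \<le> F r y" if "1 \<le> r" for r
  proof (rule AE_le_if_nn_integral_le)
    fix A assume "A \<in> sets \<nu>"
    then have A: "A \<in> sets L" by (simp add: sl)
    show "(\<integral>\<^sup>+y. indicator A y * 1 \<partial>\<nu>) \<le> (\<integral>\<^sup>+y. indicator A y * F r y \<partial>\<nu>)"
      unfolding F[OF A] lt[OF A, symmetric] using A \<phi> that order_trans[OF \<phi>(2)] by (intro emeasure_mono) auto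
  qed (use fin[of r] in auto)
  have F0: "AE y in \<nu>. F r y \<le> 0" if "r < 0" for r
  proof (rule F_le)
    fix D
    have "?S D r = {}"
      using \<phi>(1) \<open>r < 0\<close> by (auto simp: not_le intro: less_le_trans)
    then show "emeasure \<mu> (?S D r) \<le> (\<integral>\<^sup>+y. indicator D y * 0 \<partial>\<nu>)"
      by (simp only: emeasure_empty mult_zero_right zero_le)
  qed auto
  \<comment> \<open>Only rational arguments enter, so the exceptional set is a countable union of
    null sets.\<close>
  define good where "good y \<longleftrightarrow> (\<forall>p q :: rat. p \<le> q \<longrightarrow> F (of_rat p) y \<le> F (of_rat q) y) \<and>
      (\<forall>q. F (of_rat q) y \<le> 1) \<and> (\<forall>q :: rat. 1 \<le> q \<longrightarrow> 1 \<le> F (of_rat q) y) \<and> (\<forall>q :: rat. q < 0 \<longrightarrow> F (of_rat q) y \<le> 0)" for y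
  have good_m [measurable]: "Measurable.pred L good"
    unfolding good_def[abs_def] by measurable
  have AE_good: "AE y in \<nu>. good y"
    unfolding good_def AE_conj_iff AE_all_countable
    by (intro conjI allI AE_impI) (auto intro!: mono Fle1 Fge1 F0[simplified] simp: of_rat_less_eq)
  \<comment> \<open>An infimum over the rationals beyond \<open>r\<close> is right continuous in
    \<open>r\<close>. The value 1 at the other rationals is neutral, since \<open>F\<close> is at
    most 1 there at good points, and it lets the infimum run over one fixed countable set.\<close>
  define H where "H y r = (INF q::rat. if r < of_rat q then F (of_rat q) y else 1)" for y and r :: real
  have Hm [measurable]: "(\<lambda>y. H y r) \<in> borel_measurable L" for r
    unfolding H_def by measurable
  have H1: "H y r \<le> 1" if "good y" for y r
  proof -
    have "H y r \<le> (if r < of_rat 0 then F (of_rat 0) y else 1)" unfolding H_def by (rule INF_lower) simp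
    also have "\<dots> \<le> 1" using that unfolding good_def by (auto simp del: of_rat_0)
    finally show ?thesis .
  qed
  have Hle: "H y r \<le> F (of_rat q) y" if "r < of_rat q" for y r q
  proof -
    have "H y r \<le> (if r < of_rat q then F (of_rat q) y else 1)" unfolding H_def by (rule INF_lower) simp
    with that show ?thesis by simp
  qed
  have Hmono: "H y r \<le> H y s" if "good y" "r \<le> s" for y r s
    unfolding H_def
  proof (rule INF_mono')
    fix q :: rat
    have "F (of_rat q) y \<le> 1" using that(1) by (simp add: good_def)
    then show "(if r < of_rat q then F (of_rat q) y else 1) \<le> (if s < of_rat q then F (of_rat q) y else 1)"
      using that(2) by (cases "s < of_rat q") auto
  qed
  define h where "h y r = enn2real (H y r)" for y r
  have Hh: "ennreal (h y r) = H y r" if "good y" for y r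
    using le_less_trans[OF H1[OF that, of r] ennreal_one_less_top] by (simp add: h_def)
  have hmono: "h y r \<le> h y s" if "good y" "r \<le> s" for y r s
    using Hmono[OF that] H1[OF that(1), of s] unfolding h_def
    by (intro enn2real_mono) (auto intro: le_less_trans)
  have h0: "h y r = 0" if "good y" "r < 0" for y r
  proof -
    obtain q where q: "r < of_rat q" "of_rat q < (0::real)" using of_rat_dense[OF \<open>r < 0\<close>] by auto
    then have "F (of_rat q) y \<le> 0" using that(1) by (auto simp: good_def)
    with Hle[OF q(1), of y] show ?thesis by (simp add: h_def)
  qed
  have h1: "h y r = 1" if "good y" "1 \<le> r" for y r
  proof -
    have "1 \<le> H y r" unfolding H_def
    proof (rule INF_greatest)
      fix q :: rat
      show "1 \<le> (if r < of_rat q then F (of_rat q) y else 1)"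
      proof (cases "r < of_rat q")
        case True
        with \<open>1 \<le> r\<close> have "1 < real_of_rat q" by linarith
        then have "real_of_rat 1 < of_rat q" by (simp only: of_rat_1)
        then have "1 < q" by (simp only: of_rat_less)
        with \<open>good y\<close> True show ?thesis by (simp add: good_def)
      qed simp
    qed
    with H1[OF that(1), of r] show ?thesis by (simp add: h_def)
  qed
  have hcont: "continuous (at_right a) (h y)" if "good y" for y a
  proof (subst continuous_at_right_real_increasing)
    show "\<forall>e>0. \<exists>d>0. h y (a + d) - h y a < e"
    proof safe
      fix e :: real assume e: "e > 0"
      have "H y a < H y a + ennreal e"
      proof -
        have "ennreal (h y a) < ennreal (h y a + e)"
          using e by (subst ennreal_less_iff) (auto simp: h_def)
        also have "\<dots> = ennreal (h y a) + ennreal e"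
          using e by (intro ennreal_plus) (auto simp: h_def)
        finally show ?thesis by (simp add: Hh that)
      qed
      then obtain q where q: "(if a < of_rat q then F (of_rat q) y else 1) < H y a + ennreal e"
        unfolding H_def INF_less_iff by blast
      show "\<exists>d>0. h y (a + d) - h y a < e"
      proof (cases "a < of_rat q")
        case True
        define d where "d = (of_rat q - a) / 2"
        have d: "d > 0" "a + d < of_rat q" using True by (auto simp: d_def field_simps)
        have "ennreal (h y (a + d)) < ennreal (h y a) + ennreal e"
          using le_less_trans[OF Hle[OF d(2), of y]] q True by (simp add: Hh that)
        also have "\<dots> = ennreal (h y a + e)"
          using e by (intro ennreal_plus[symmetric]) (auto simp: h_def)
        finally have "ennreal (h y (a + d)) < ennreal (h y a + e)" .
        then have "h y (a + d) < h y a + e"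
          using e by (subst (asm) ennreal_less_iff) (auto simp: h_def)
        with d show ?thesis by (intro exI[of _ d]) auto
      next
        case False
        with q have "1 < ennreal (h y a) + ennreal e" by (simp add: Hh that)
        also have "\<dots> = ennreal (h y a + e)"
          using e by (intro ennreal_plus[symmetric]) (auto simp: h_def)
        finally have "1 < ennreal (h y a + e)" .
        then have "1 < h y a + e" by (simp add: ennreal_1[symmetric] ennreal_less_iff del: ennreal_1)
        moreover have "h y (a + 1) \<le> 1"
          unfolding h_def using enn2real_mono[OF H1[OF that, of "a + 1"]] by simp
        ultimately show ?thesis by (intro exI[of _ 1]) auto
      qed
    qed
  qed (use hmono that in auto)
  \<comment> \<open>A point mass on the exceptional set keeps every \<open>K y\<close> a probability
    measure.\<close>
  define K where "K y = (if good y then interval_measure (h y) else return borel 0)" for y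
  have hbot: "(h y \<longlongrightarrow> 0) at_bot" and htop: "(h y \<longlongrightarrow> 1) at_top" if "good y" for y
    using that by (auto intro!: tendsto_eventually eventually_at_top_linorderI[of 1] h1 eventually_at_bot_linorderI[of "-1"] h0)
  have Kp: "prob_space (K y) \<and> sets (K y) = sets borel" for y
  proof (cases "good y")
    case True
    then interpret real_distribution "interval_measure (h y)"
      by (intro real_distribution_interval_measure hmono hcont hbot htop)
    show ?thesis using True prob_space_axioms by (simp add: K_def)
  qed (auto simp: K_def intro!: prob_space_return)
  have KH: "emeasure (K y) {..r} = (if good y then H y r else indicator {..r} 0)" for y r
  proof (cases "good y")
    case True
    then interpret real_distribution "interval_measure (h y)"
      by (intro real_distribution_interval_measure hmono hcont hbot htop)
    have "measure (interval_measure (h y)) {..r} = h y r"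
      using cdf_interval_measure[OF hmono hcont hbot] True by (simp add: cdf_def fun_eq_iff)
    then show ?thesis using True Hh[OF True] by (simp add: K_def emeasure_eq_measure)
  qed (simp add: K_def)
  have K [measurable]: "K \<in> L \<rightarrow>\<^sub>M prob_algebra borel"
  proof (rule measurable_prob_algebra_generated)
    show "sets borel = sigma_sets UNIV (range (\<lambda>r::real. {..r}))"
      by (subst borel_eq_atMost) simp
    show "Int_stable (range (\<lambda>r::real. {..r}))"
      by (auto simp: Int_stable_def)
    show "(\<lambda>y. emeasure (K y) A) \<in> borel_measurable L" if "A \<in> range (\<lambda>r::real. {..r})" for A
      using that by (auto simp: KH)
  qed (use Kp in auto)
  \<comment> \<open>The upper bound uses \<open>F\<close> at rationals just above \<open>r\<close>
    together with continuity of \<mu> from above; the lower bound uses that \<open>F r\<close> is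
    almost everywhere below \<open>F\<close> at all those rationals.\<close>
  have HF: "(\<integral>\<^sup>+y. indicator D y * emeasure (K y) {..r} \<partial>\<nu>) = emeasure \<mu> (?S D r)"
    (is "?l = _") if D: "D \<in> sets L" for D r
  proof (rule antisym)
    have le: "?l \<le> emeasure \<mu> (?S D (r + 1 / real (Suc n)))" for n
    proof -
      have "r < r + 1 / real (Suc n)" by simp
      then obtain q where q: "r < of_rat q" "of_rat q < r + 1 / real (Suc n)" using of_rat_dense by blast
      have "?l \<le> (\<integral>\<^sup>+y. indicator D y * F (of_rat q) y \<partial>\<nu>)"
        using AE_good
        by (intro nn_integral_mono_AE) (auto elim!: eventually_mono simp: KH Hle[OF q(1)] mult_left_mono)
      also have "\<dots> \<le> emeasure \<mu> (?S D (r + 1 / real (Suc n)))"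
        unfolding F[OF D] using q D by (intro emeasure_mono) auto
      finally show ?thesis .
    qed
    have "?l \<le> (INF n. emeasure \<mu> (?S D (r + 1 / real (Suc n))))"
      using le by (rule INF_greatest)
    also have "\<dots> = emeasure \<mu> (\<Inter>n. ?S D (r + 1 / real (Suc n)))"
    proof (rule INF_emeasure_decseq)
      show "decseq (\<lambda>n. ?S D (r + 1 / real (Suc n)))"
      proof (rule decseq_SucI, safe)
        fix n x assume "\<phi> x \<le> r + 1 / real (Suc (Suc n))"
        moreover have "1 / real (Suc (Suc n)) \<le> 1 / real (Suc n)" by (simp add: field_simps)
        ultimately show "\<phi> x \<le> r + 1 / real (Suc n)" by linarith
      qed
    qed (use D in auto)
    also have "(\<Inter>n. ?S D (r + 1 / real (Suc n))) = ?S D r"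
    proof safe
      fix x assume *: "x \<in> (\<Inter>n. ?S D (r + 1 / real (Suc n)))"
      show "\<phi> x \<le> r"
      proof (rule field_le_epsilon)
        fix e :: real assume "e > 0"
        then obtain n where "1 / real (Suc n) < e" using nat_approx_posE by blast
        moreover have "\<phi> x \<le> r + 1 / real (Suc n)" using * by blast
        ultimately show "\<phi> x \<le> r + e" by linarith
      qed
    next
      fix x n assume "\<phi> x \<le> r"
      moreover have "0 \<le> 1 / real (Suc n)" by simp
      ultimately show "\<phi> x \<le> r + 1 / real (Suc n)" by linarith
    qed auto
    finally show "?l \<le> emeasure \<mu> (?S D r)" .
  next
    have "AE y in \<nu>. \<forall>q. r < of_rat q \<longrightarrow> F r y \<le> F (of_rat q) y"
      unfolding AE_all_countable by (auto intro: mono)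
    with AE_good Fle1[of r] have ae: "AE y in \<nu>. F r y \<le> emeasure (K y) {..r}"
    proof eventually_elim
      case (elim y)
      have "F r y \<le> H y r"
        unfolding H_def by (rule INF_greatest) (use elim in auto)
      then show ?case using elim by (simp add: KH)
    qed
    have "emeasure \<mu> (?S D r) = (\<integral>\<^sup>+y. indicator D y * F r y \<partial>\<nu>)"
      by (simp add: F[OF D])
    also have "\<dots> \<le> ?l" using ae by (intro nn_integral_mono_AE) (auto elim!: eventually_mono intro!: mult_left_mono)
    finally show "emeasure \<mu> (?S D r) \<le> ?l" .
  qed
  have "emeasure \<mu> {x \<in> space \<mu>. t x \<in> D \<and> \<phi> x \<in> B} = (\<integral>\<^sup>+x. indicator D (t x) * emeasure (K (t x)) B \<partial>\<mu>)"
    if [measurable]: "B \<in> sets borel" "D \<in> sets L" for B D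
  proof -
    \<comment> \<open>For fixed \<open>D\<close> both sides are finite measures in \<open>B\<close>,
      so agreement on rational half-lines suffices.\<close>
    define P where "P = distr (density \<mu> (\<lambda>x. indicator D (t x))) borel \<phi>"
    define Q where "Q = density \<nu> (indicator D) \<bind> K"
    have nel: "space (density \<nu> (indicator D :: _ \<Rightarrow> ennreal)) \<noteq> {}" using \<nu>.not_empty by simp
    have K' [measurable]: "K \<in> density \<nu> (indicator D) \<rightarrow>\<^sub>M subprob_algebra borel"
    proof -
      have "sets (density \<nu> (indicator D)) = sets L" by (simp add: sl)
      from measurable_cong_sets[OF this refl] show ?thesis
        using measurable_prob_algebraD[OF K] by blast
    qed
    have Pe: "emeasure P C = emeasure \<mu> {x \<in> space \<mu>. t x \<in> D \<and> \<phi> x \<in> C}" if [measurable]: "C \<in> sets borel" for C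
    proof -
      have "emeasure P C = emeasure (density \<mu> (\<lambda>x. indicator D (t x))) (\<phi> -` C \<inter> space \<mu>)"
        unfolding P_def by (subst emeasure_distr) auto
      also have "\<dots> = (\<integral>\<^sup>+x. indicator D (t x) * indicator (\<phi> -` C \<inter> space \<mu>) x \<partial>\<mu>)"
        by (intro emeasure_density) measurable
      also have "\<dots> = (\<integral>\<^sup>+x. indicator {x \<in> space \<mu>. t x \<in> D \<and> \<phi> x \<in> C} x \<partial>\<mu>)"
        by (intro nn_integral_cong) (auto split: split_indicator)
      also have "\<dots> = emeasure \<mu> {x \<in> space \<mu>. t x \<in> D \<and> \<phi> x \<in> C}"
        by (intro nn_integral_indicator) measurable
      finally show ?thesis .
    qed
    have Qe: "emeasure Q C = (\<integral>\<^sup>+y. indicator D y * emeasure (K y) C \<partial>\<nu>)" if C [measurable]: "C \<in> sets borel" for C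
      unfolding Q_def by (subst emeasure_bind[OF nel K' C], subst nn_integral_density) measurable
    have "P = Q"
    proof (rule borel_measure_eqI_rat)
      show "sets P = sets borel" by (simp add: P_def)
      show "sets Q = sets borel" unfolding Q_def by (rule sets_bind[OF _ nel]) (rule sets_kernel[OF K'])
    qed (simp_all add: Pe Qe HF \<mu>.emeasure_finite)
    then have "emeasure P B = emeasure Q B" by simp
    then show ?thesis unfolding Pe[OF that(1)] Qe[OF that(1)] unfolding \<nu>_def by (simp add: nn_integral_distr)
  qed
  with K show ?thesis by blast
qed

section \<open>Disintegrations and measurable partitions\<close>

lemma measurable_completion_cong_AE:
  assumes f: "f \<in> M \<rightarrow>\<^sub>M N" and eq: "AE x in M. f x = g x" and g: "g \<in> space M \<rightarrow> space N"
  shows "g \<in> completion M \<rightarrow>\<^sub>M N"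
proof (rule measurableI)
  show "g x \<in> space N" if "x \<in> space (completion M)" for x
    using that g by auto
  fix A assume A: "A \<in> sets N"
  show "g -` A \<inter> space (completion M) \<in> sets (completion M)"
  proof (rule completion.in_sets_AE)
    show "f -` A \<inter> space M \<in> sets (completion M)"
      using measurable_sets[OF f A] by (rule sets_completionI_sets)
    show "AE x in completion M. x \<in> f -` A \<inter> space M \<longleftrightarrow> x \<in> g -` A \<inter> space (completion M)"
      using eq by (intro AE_completion) (auto elim: eventually_mono)
  qed auto
qed

lemma AE_imp_sets_completion:
  assumes "AE x in M. x \<in> A" "A \<subseteq> space M"
  shows "A \<in> sets (completion M)"
proof (rule completion.in_sets_AE)
  show "space M \<in> sets (completion M)" by (rule sets_completionI_sets) simp
  show "AE x in completion M. x \<in> space M \<longleftrightarrow> x \<in> A"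
    using assms by (intro AE_completion) (auto elim: eventually_mono)
qed (use assms in auto)

lemma (in prob_space) emeasure_completion_eq_1:
  assumes "AE x in M. x \<in> A" "A \<subseteq> space M"
  shows "emeasure (completion M) A = 1"
proof -
  interpret c: prob_space "completion M" by (rule prob_space_completion)
  show ?thesis
    using AE_imp_sets_completion[OF assms] AE_completion[OF assms(1)] by (rule c.emeasure_eq_1_AE)
qed

lemma AE_eq_if_nn_integral_eq:
  fixes f g :: "'a \<Rightarrow> ennreal"
  assumes [measurable]: "f \<in> borel_measurable M" "g \<in> borel_measurable M"
    and eq: "\<And>A. A \<in> sets M \<Longrightarrow> (\<integral>\<^sup>+x. indicator A x * f x \<partial>M) = (\<integral>\<^sup>+x. indicator A x * g x \<partial>M)"
    and fin: "(\<integral>\<^sup>+x. g x \<partial>M) < \<infinity>"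
  shows "AE x in M. f x = g x"
proof -
  have "(\<integral>\<^sup>+x. indicator (space M) x * f x \<partial>M) = (\<integral>\<^sup>+x. f x \<partial>M)"
    "(\<integral>\<^sup>+x. indicator (space M) x * g x \<partial>M) = (\<integral>\<^sup>+x. g x \<partial>M)"
    by (auto intro!: nn_integral_cong)
  with eq[OF sets.top] fin have fin': "(\<integral>\<^sup>+x. f x \<partial>M) < \<infinity>" by simp
  have "AE x in M. f x \<le> g x" using fin by (intro AE_le_if_nn_integral_le) (auto simp: eq)
  moreover have "AE x in M. g x \<le> f x" using fin' by (intro AE_le_if_nn_integral_le) (auto simp: eq)
  ultimately show ?thesis by eventually_elim auto
qed

text \<open>
  The injective function makes the level sets of \<open>t\<close> measurable, so that \<open>K (t x)\<close> lives on
  the level set of \<open>x\<close>.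
\<close>

locale disintegration = prob_space \<mu>
  for \<mu> :: "'a measure" and L :: "'c measure" and t :: "'a \<Rightarrow> 'c" and K :: "'c \<Rightarrow> 'a measure" +
  assumes t [measurable]: "t \<in> \<mu> \<rightarrow>\<^sub>M L"
    and K [measurable]: "K \<in> L \<rightarrow>\<^sub>M prob_algebra \<mu>"
    and disint: "\<And>B D. B \<in> sets \<mu> \<Longrightarrow> D \<in> sets L \<Longrightarrow>
      emeasure \<mu> (t -` D \<inter> B) = (\<integral>\<^sup>+x. indicator D (t x) * emeasure (K (t x)) B \<partial>\<mu>)"
    and separated: "\<exists>\<phi>\<in>borel_measurable L. inj_on (\<phi> :: 'c \<Rightarrow> real) (space L)"
begin

lemma K_prob_algebra: "y \<in> space L \<Longrightarrow> K y \<in> space (prob_algebra \<mu>)"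
  using measurable_space[OF K] .

lemma K_prob_space: "y \<in> space L \<Longrightarrow> prob_space (K y)"
  and sets_K: "y \<in> space L \<Longrightarrow> sets (K y) = sets \<mu>"
  and space_K: "y \<in> space L \<Longrightarrow> space (K y) = space \<mu>"
  using K_prob_algebra[of y] by (auto simp: space_prob_algebra dest: sets_eq_imp_space_eq)

lemma t_space: "x \<in> space \<mu> \<Longrightarrow> t x \<in> space L"
  using measurable_space[OF t] .

lemma measurable_K_subprob [measurable]: "K \<in> L \<rightarrow>\<^sub>M subprob_algebra \<mu>"
  using measurable_prob_algebraD[OF K] .

text \<open>Two identities of measures replace approximation by simple functions: for fixed
  \<open>B\<close> the images under \<open>t\<close> agree, which allows an arbitrary weight
  \<open>h\<close>; for fixed \<open>h\<close> the weighted measure is then a mixture of the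
  \<open>K (t x)\<close>, which allows an arbitrary integrand \<open>g\<close>.\<close>

lemma nn_integral_disint:
  assumes g [measurable]: "g \<in> borel_measurable \<mu>" and h [measurable]: "h \<in> borel_measurable L"
  shows "(\<integral>\<^sup>+x. h (t x) * g x \<partial>\<mu>) = (\<integral>\<^sup>+x. h (t x) * (\<integral>\<^sup>+z. g z \<partial>K (t x)) \<partial>\<mu>)"
proof -
  have 1: "(\<integral>\<^sup>+x. h (t x) * indicator B x \<partial>\<mu>) = (\<integral>\<^sup>+x. h (t x) * emeasure (K (t x)) B \<partial>\<mu>)"
    if B [measurable]: "B \<in> sets \<mu>" for B
  proof -
    have "distr (density \<mu> (indicator B)) L t = distr (density \<mu> (\<lambda>x. emeasure (K (t x)) B)) L t"
    proof (rule measure_eqI)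
      fix D assume "D \<in> sets (distr (density \<mu> (indicator B)) L t)"
      then have D [measurable]: "D \<in> sets L" by simp
      have sB: "B \<subseteq> space \<mu>" using sets.sets_into_space[OF B] .
      have "emeasure (distr (density \<mu> (indicator B)) L t) D
          = (\<integral>\<^sup>+x. indicator B x * indicator (t -` D \<inter> space \<mu>) x \<partial>\<mu>)"
        by (subst emeasure_distr, simp, simp, subst emeasure_density) auto
      also have "\<dots> = (\<integral>\<^sup>+x. indicator (t -` D \<inter> B) x \<partial>\<mu>)"
        using sB by (intro nn_integral_cong) (auto split: split_indicator)
      also have "\<dots> = emeasure \<mu> (t -` D \<inter> B)"
      proof (rule nn_integral_indicator)
        have "t -` D \<inter> B = (t -` D \<inter> space \<mu>) \<inter> B" using sB by auto
        then show "t -` D \<inter> B \<in> sets \<mu>" by simp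
      qed
      also have "\<dots> = (\<integral>\<^sup>+x. emeasure (K (t x)) B * indicator (t -` D \<inter> space \<mu>) x \<partial>\<mu>)"
        unfolding disint[OF B D] by (intro nn_integral_cong) (auto split: split_indicator)
      also have "\<dots> = emeasure (distr (density \<mu> (\<lambda>x. emeasure (K (t x)) B)) L t) D"
        by (subst emeasure_distr, simp, simp, subst emeasure_density) auto
      finally show "emeasure (distr (density \<mu> (indicator B)) L t) D
          = emeasure (distr (density \<mu> (\<lambda>x. emeasure (K (t x)) B)) L t) D" .
    qed simp
    then have "(\<integral>\<^sup>+y. h y \<partial>distr (density \<mu> (indicator B)) L t)
        = (\<integral>\<^sup>+y. h y \<partial>distr (density \<mu> (\<lambda>x. emeasure (K (t x)) B)) L t)" by simp
    then show ?thesis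
      by (simp add: nn_integral_distr nn_integral_density mult.commute)
  qed
  have ne: "space (density \<mu> (\<lambda>x. h (t x))) \<noteq> {}" using not_empty by simp
  have Kt: "(\<lambda>x. K (t x)) \<in> density \<mu> (\<lambda>x. h (t x)) \<rightarrow>\<^sub>M subprob_algebra \<mu>"
  proof -
    have "(\<lambda>x. K (t x)) \<in> \<mu> \<rightarrow>\<^sub>M subprob_algebra \<mu>" by measurable
    then show ?thesis using measurable_cong_sets[OF sets_density refl] by blast
  qed
  have "density \<mu> (\<lambda>x. h (t x)) = density \<mu> (\<lambda>x. h (t x)) \<bind> (\<lambda>x. K (t x))"
  proof (rule measure_eqI)
    have "sets (density \<mu> (\<lambda>x. h (t x)) \<bind> (\<lambda>x. K (t x))) = sets \<mu>"
      by (rule sets_bind[OF _ ne]) (rule sets_kernel[OF Kt])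
    then show "sets (density \<mu> (\<lambda>x. h (t x))) = sets (density \<mu> (\<lambda>x. h (t x)) \<bind> (\<lambda>x. K (t x)))"
      by simp
    fix B assume "B \<in> sets (density \<mu> (\<lambda>x. h (t x)))"
    then have B [measurable]: "B \<in> sets \<mu>" by simp
    have "emeasure (density \<mu> (\<lambda>x. h (t x))) B = (\<integral>\<^sup>+x. h (t x) * indicator B x \<partial>\<mu>)"
      by (subst emeasure_density) auto
    also have "\<dots> = (\<integral>\<^sup>+x. emeasure (K (t x)) B \<partial>density \<mu> (\<lambda>x. h (t x)))"
      unfolding 1[OF B] by (subst nn_integral_density) auto
    also have "\<dots> = emeasure (density \<mu> (\<lambda>x. h (t x)) \<bind> (\<lambda>x. K (t x))) B"
      by (rule emeasure_bind[OF ne Kt B, symmetric])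
    finally show "emeasure (density \<mu> (\<lambda>x. h (t x))) B = emeasure (density \<mu> (\<lambda>x. h (t x)) \<bind> (\<lambda>x. K (t x))) B" .
  qed
  then have "(\<integral>\<^sup>+z. g z \<partial>density \<mu> (\<lambda>x. h (t x))) = (\<integral>\<^sup>+z. g z \<partial>(density \<mu> (\<lambda>x. h (t x)) \<bind> (\<lambda>x. K (t x))))"
    by simp
  also have "\<dots> = (\<integral>\<^sup>+x. \<integral>\<^sup>+z. g z \<partial>K (t x) \<partial>density \<mu> (\<lambda>x. h (t x)))"
    by (rule nn_integral_bind[OF g Kt])
  finally show ?thesis
    by (simp add: nn_integral_density)
qed

lemma nn_integral_disint': "g \<in> borel_measurable \<mu> \<Longrightarrow> (\<integral>\<^sup>+x. g x \<partial>\<mu>) = (\<integral>\<^sup>+x. \<integral>\<^sup>+z. g z \<partial>K (t x) \<partial>\<mu>)"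
  using nn_integral_disint[of g "\<lambda>_. 1"] by simp

lemma AE_disint:
  assumes "AE x in \<mu>. P x"
  shows "AE x in \<mu>. AE z in K (t x). P z"
proof -
  from assms obtain N where N: "{x \<in> space \<mu>. \<not> P x} \<subseteq> N" "emeasure \<mu> N = 0" and [measurable]: "N \<in> sets \<mu>"
    by (rule AE_E)
  have "(\<integral>\<^sup>+x. emeasure (K (t x)) N \<partial>\<mu>) = emeasure \<mu> N"
    using disint[of N "space L"] t_space sets.sets_into_space[of N \<mu>]
    by (subst nn_integral_cong[of \<mu> _ "\<lambda>x. indicator (space L) (t x) * emeasure (K (t x)) N"])
      (auto simp: Int_absorb1 subset_iff intro!: arg_cong[where f="emeasure \<mu>"])
  with N have "AE x in \<mu>. emeasure (K (t x)) N = 0"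
    by (simp add: nn_integral_0_iff_AE)
  with AE_space show ?thesis
  proof eventually_elim
    case (elim x)
    then have x: "t x \<in> space L" by (simp add: t_space)
    show ?case
      by (rule AE_I'[of N]) (use elim x N in \<open>auto simp: null_sets_def sets_K space_K\<close>)
  qed
qed

text \<open>For a fixed measurable \<open>D\<close>, almost every kernel at a point with
  \<open>t x\<close> in \<open>D\<close> gives full mass to the points whose code is in
  \<open>D\<close>. Countably many such sets, cut out by rational thresholds of the injective
  function, determine the value of \<open>t\<close>.\<close>

lemma AE_const: "AE x in \<mu>. AE z in K (t x). t z = t x"
proof -
  obtain \<phi> where \<phi> [measurable]: "\<phi> \<in> borel_measurable L" and inj: "inj_on (\<phi> :: 'c \<Rightarrow> real) (space L)"
    using separated by blast
  have *: "AE x in \<mu>. t x \<in> D \<longrightarrow> (AE z in K (t x). t z \<in> D)" if D [measurable]: "D \<in> sets L" for D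
  proof -
    have "(\<integral>\<^sup>+x. indicator D (t x) * (\<integral>\<^sup>+z. indicator (space L - D) (t z) \<partial>K (t x)) \<partial>\<mu>)
        = (\<integral>\<^sup>+x. indicator D (t x) * indicator (space L - D) (t x) \<partial>\<mu>)"
      by (rule nn_integral_disint[symmetric]) measurable
    also have "\<dots> = (\<integral>\<^sup>+x. 0 \<partial>\<mu>)"
      by (intro nn_integral_cong) (auto split: split_indicator)
    also have "\<dots> = 0" by simp
    finally have "AE x in \<mu>. indicator D (t x) * (\<integral>\<^sup>+z. indicator (space L - D) (t z) \<partial>K (t x)) = 0"
      by (subst (asm) nn_integral_0_iff_AE) auto
    with AE_space show ?thesis
    proof eventually_elim
      case (elim x)
      then have x: "t x \<in> space L" by (simp add: t_space)
      have "(\<lambda>z. indicator (space L - D) (t z) :: ennreal) \<in> borel_measurable \<mu>" by measurable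
      then have m: "(\<lambda>z. indicator (space L - D) (t z) :: ennreal) \<in> borel_measurable (K (t x))"
        using measurable_cong_sets[OF sets_K[OF x] refl] by blast
      show ?case
      proof
        assume "t x \<in> D"
        with elim have "(\<integral>\<^sup>+z. indicator (space L - D) (t z) \<partial>K (t x)) = 0" by simp
        then have "AE z in K (t x). indicator (space L - D) (t z) = (0::ennreal)"
          using m by (simp only: nn_integral_0_iff_AE)
        with AE_space show "AE z in K (t x). t z \<in> D"
          by eventually_elim (auto simp: space_K[OF x] t_space split: split_indicator_asm)
      qed
    qed
  qed
  have "AE x in \<mu>. \<forall>q. (\<phi> (t x) \<le> real_of_rat q \<longrightarrow> (AE z in K (t x). \<phi> (t z) \<le> real_of_rat q)) \<and>
      (\<not> \<phi> (t x) \<le> real_of_rat q \<longrightarrow> (AE z in K (t x). \<not> \<phi> (t z) \<le> real_of_rat q))"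
  proof (unfold AE_all_countable AE_conj_iff, intro allI conjI)
    fix q
    have D: "{y \<in> space L. \<phi> y \<le> real_of_rat q} \<in> sets L" "{y \<in> space L. \<not> \<phi> y \<le> real_of_rat q} \<in> sets L"
      by measurable
    show "AE x in \<mu>. \<phi> (t x) \<le> real_of_rat q \<longrightarrow> (AE z in K (t x). \<phi> (t z) \<le> real_of_rat q)"
      using *[OF D(1)] AE_space by eventually_elim (auto simp: t_space elim: eventually_mono)
    show "AE x in \<mu>. \<not> \<phi> (t x) \<le> real_of_rat q \<longrightarrow> (AE z in K (t x). \<not> \<phi> (t z) \<le> real_of_rat q)"
      using *[OF D(2)] AE_space by eventually_elim (auto simp: t_space elim: eventually_mono)
  qed
  with AE_space show ?thesis
  proof eventually_elim
    case (elim x)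
    then have x: "t x \<in> space L" by (simp add: t_space)
    have "AE z in K (t x). \<forall>q. \<phi> (t z) \<le> real_of_rat q \<longleftrightarrow> \<phi> (t x) \<le> real_of_rat q"
      unfolding AE_all_countable
    proof
      fix q show "AE z in K (t x). \<phi> (t z) \<le> real_of_rat q \<longleftrightarrow> \<phi> (t x) \<le> real_of_rat q"
        using elim(2)[rule_format, of q] by (cases "\<phi> (t x) \<le> real_of_rat q") auto
    qed
    with AE_space show ?case
    proof eventually_elim
      case (elim z)
      have "\<phi> (t z) = \<phi> (t x)"
      proof (rule ccontr)
        assume "\<phi> (t z) \<noteq> \<phi> (t x)"
        then consider "\<phi> (t z) < \<phi> (t x)" | "\<phi> (t x) < \<phi> (t z)" by linarith
        then show False
        proof cases
          case 1
          from of_rat_dense[OF this] obtain q where "\<phi> (t z) < of_rat q" "of_rat q < \<phi> (t x)" by blast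
          with elim(2)[rule_format, of q] show False by auto
        next
          case 2
          from of_rat_dense[OF this] obtain q where "\<phi> (t x) < of_rat q" "of_rat q < \<phi> (t z)" by blast
          with elim(2)[rule_format, of q] show False by auto
        qed
      qed
      with inj x elim(1) show "t z = t x" by (auto simp: space_K[OF x] t_space inj_on_def)
    qed
  qed
qed

text \<open>This turns set-theoretic facts about two points of one level set into statements about
  conditional measures: both points may be assumed to lie in a given set of full measure.\<close>

lemma AE_disint_const:
  assumes "AE x in \<mu>. P x" and "\<And>x z. P x \<Longrightarrow> P z \<Longrightarrow> x \<in> space \<mu> \<Longrightarrow> z \<in> space \<mu> \<Longrightarrow> t z = t x \<Longrightarrow> Q x z"
  shows "AE x in \<mu>. AE z in K (t x). Q x z"
  using AE_space assms(1) AE_disint[OF assms(1)] AE_const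
proof eventually_elim
  case (elim x)
  from elim(3,4) AE_space show ?case
    by eventually_elim (use elim in \<open>auto simp: space_K t_space intro!: assms(2)\<close>)
qed

text \<open>
  A function that is constant almost everywhere on the level sets of \<open>t\<close> is almost everywhere
  a measurable function of \<open>t\<close>, namely its fibrewise integral.
\<close>

lemma emeasure_K_eqI:
  assumes B [measurable]: "B \<in> sets \<mu>" and g [measurable]: "g \<in> borel_measurable \<mu>"
    and const: "AE x in \<mu>. AE z in K (t x). g z = g x"
    and eq: "\<And>D. D \<in> sets L \<Longrightarrow> emeasure \<mu> (t -` D \<inter> B) = (\<integral>\<^sup>+x. indicator D (t x) * g x \<partial>\<mu>)"
  shows "AE x in \<mu>. emeasure (K (t x)) B = g x"
proof -
  define G where "G y = (\<integral>\<^sup>+z. g z \<partial>K y)" for y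
  have G [measurable]: "G \<in> borel_measurable L" unfolding G_def by measurable
  have Gg: "AE x in \<mu>. G (t x) = g x"
    using AE_space const
  proof eventually_elim
    case (elim x)
    then interpret Kx: prob_space "K (t x)" by (intro K_prob_space t_space)
    have "G (t x) = (\<integral>\<^sup>+z. g x \<partial>K (t x))"
      unfolding G_def using elim(2) by (rule nn_integral_cong_AE)
    then show ?case by (simp add: Kx.emeasure_space_1)
  qed
  have KB [measurable]: "(\<lambda>y. emeasure (K y) B) \<in> borel_measurable L" by measurable
  have "AE y in distr \<mu> L t. emeasure (K y) B = G y"
  proof (rule AE_eq_if_nn_integral_eq)
    fix D assume "D \<in> sets (distr \<mu> L t)"
    then have D [measurable]: "D \<in> sets L" by simp
    have "(\<integral>\<^sup>+y. indicator D y * emeasure (K y) B \<partial>distr \<mu> L t) = emeasure \<mu> (t -` D \<inter> B)"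
      unfolding disint[OF B D] by (subst nn_integral_distr) auto
    also have "\<dots> = (\<integral>\<^sup>+x. indicator D (t x) * G (t x) \<partial>\<mu>)"
      unfolding eq[OF D] using Gg by (intro nn_integral_cong_AE) (auto elim: eventually_mono)
    also have "\<dots> = (\<integral>\<^sup>+y. indicator D y * G y \<partial>distr \<mu> L t)"
      by (subst nn_integral_distr) auto
    finally show "(\<integral>\<^sup>+y. indicator D y * emeasure (K y) B \<partial>distr \<mu> L t)
        = (\<integral>\<^sup>+y. indicator D y * G y \<partial>distr \<mu> L t)" .
  next
    have "(\<integral>\<^sup>+y. G y \<partial>distr \<mu> L t) = (\<integral>\<^sup>+x. g x \<partial>\<mu>)"
      by (subst nn_integral_distr, simp, simp) (rule nn_integral_cong_AE[OF Gg])
    also have "\<dots> = (\<integral>\<^sup>+x. indicator (space L) (t x) * g x \<partial>\<mu>)"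
      by (intro nn_integral_cong) (auto simp: t_space)
    also have "\<dots> = emeasure \<mu> (t -` space L \<inter> B)" by (rule eq[symmetric]) simp
    also have "\<dots> < \<infinity>" by (simp add: less_top[symmetric])
    finally show "(\<integral>\<^sup>+y. G y \<partial>distr \<mu> L t) < \<infinity>" .
  qed (use G KB in auto)
  then have "AE x in \<mu>. emeasure (K (t x)) B = G (t x)"
    by (subst (asm) AE_distr_iff) measurable
  with Gg show ?thesis by eventually_elim simp
qed

end

section \<open>Existence of disintegrations\<close>

lemma binary_coded_imp_separated:
  fixes E :: "'a measure"
  assumes "binary_coded E"
  shows "\<exists>\<phi>\<in>borel_measurable E. inj_on (\<phi> :: 'a \<Rightarrow> real) (space E)"
proof -
  from binary_coded_imp_retract[OF assms] obtain \<phi> :: "'a \<Rightarrow> real" and g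
    where "\<phi> \<in> borel_measurable E" and g: "\<forall>x\<in>space E. g (\<phi> x) = x" by blast
  moreover have "inj_on \<phi> (space E)" using g by (intro inj_on_inverseI[of _ g]) blast
  ultimately show ?thesis by blast
qed

lemma real_separated: "\<exists>\<phi>\<in>borel_measurable borel. inj_on (\<phi> :: real \<Rightarrow> real) (space borel)"
  by (rule bexI[of _ "\<lambda>x. x"]) auto

text \<open>The kernel is built on the line, as the law of the code \<open>\<phi>\<close> given
  \<open>t\<close>, and pushed back to the space by the retraction \<open>g\<close>.\<close>

lemma disintegration_exists:
  fixes \<mu> :: "'a measure" and L :: "'c measure"
  assumes \<mu>: "prob_space \<mu>" "binary_coded \<mu>" and t [measurable]: "t \<in> \<mu> \<rightarrow>\<^sub>M L"
    and L: "\<exists>\<phi>\<in>borel_measurable L. inj_on (\<phi> :: 'c \<Rightarrow> real) (space L)"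
  shows "\<exists>K. disintegration \<mu> L t K"
proof -
  from binary_coded_imp_retract[OF \<mu>(2)] obtain \<phi> :: "'a \<Rightarrow> real" and g
    where \<phi> [measurable]: "\<phi> \<in> borel_measurable \<mu>" and g [measurable]: "g \<in> borel \<rightarrow>\<^sub>M \<mu>"
      and g\<phi>: "\<And>x. x \<in> space \<mu> \<Longrightarrow> g (\<phi> x) = x" and b: "\<And>x. 0 \<le> \<phi> x" "\<And>x. \<phi> x \<le> 1" by blast
  from real_kernel_exists[OF \<mu>(1) \<phi> t b] obtain K where K: "K \<in> L \<rightarrow>\<^sub>M prob_algebra borel"
    and *: "\<And>B D. B \<in> sets borel \<Longrightarrow> D \<in> sets L \<Longrightarrow> emeasure \<mu> {x \<in> space \<mu>. t x \<in> D \<and> \<phi> x \<in> B} =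
      (\<integral>\<^sup>+ x. indicator D (t x) * emeasure (K (t x)) B \<partial>\<mu>)" by blast
  interpret prob_space \<mu> by fact
  have "disintegration \<mu> L t (\<lambda>y. distr (K y) \<mu> g)"
  proof unfold_locales
    show "(\<lambda>y. distr (K y) \<mu> g) \<in> L \<rightarrow>\<^sub>M prob_algebra \<mu>"
      by (rule measurable_compose[OF K measurable_distr_prob_space[OF g]])
    fix B D assume B: "B \<in> sets \<mu>" and D: "D \<in> sets L"
    have "t -` D \<inter> B = {x \<in> space \<mu>. t x \<in> D \<and> \<phi> x \<in> g -` B}"
      using g\<phi> sets.sets_into_space[OF B] by auto
    then have "emeasure \<mu> (t -` D \<inter> B) = (\<integral>\<^sup>+ x. indicator D (t x) * emeasure (K (t x)) (g -` B) \<partial>\<mu>)"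
      using *[of "g -` B" D] measurable_sets[OF g B] D by simp
    also have "\<dots> = (\<integral>\<^sup>+ x. indicator D (t x) * emeasure (distr (K (t x)) \<mu> g) B \<partial>\<mu>)"
    proof (rule nn_integral_cong)
      fix x assume "x \<in> space \<mu>"
      then have "K (t x) \<in> space (prob_algebra borel)"
        using measurable_space[OF K] measurable_space[OF t] by blast
      then have s: "sets (K (t x)) = sets borel" by (simp add: space_prob_algebra)
      then have "g \<in> K (t x) \<rightarrow>\<^sub>M \<mu>" using g measurable_cong_sets[OF s refl] by blast
      then show "indicator D (t x) * emeasure (K (t x)) (g -` B) = indicator D (t x) * emeasure (distr (K (t x)) \<mu> g) B"
        using B sets_eq_imp_space_eq[OF s] by (simp add: emeasure_distr)
    qed
    finally show "emeasure \<mu> (t -` D \<inter> B) = (\<integral>\<^sup>+ x. indicator D (t x) * emeasure (distr (K (t x)) \<mu> g) B \<partial>\<mu>)" .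
  qed (use L t in auto)
  then show ?thesis by blast
qed

section \<open>Atoms of partitions\<close>

lemma atom_unique: "partition_on \<Omega> \<alpha> \<Longrightarrow> A \<in> \<alpha> \<Longrightarrow> x \<in> A \<Longrightarrow> atom \<alpha> x = A"
  unfolding atom_def partition_on_def disjoint_def by (rule the_equality) blast+

lemma atom_mem:
  assumes "partition_on \<Omega> \<alpha>" "x \<in> \<Omega>"
  shows "atom \<alpha> x \<in> \<alpha> \<and> x \<in> atom \<alpha> x"
proof -
  have "x \<in> \<Union>\<alpha>" using assms(2) unfolding partition_onD1[OF assms(1)] .
  then obtain A where A: "A \<in> \<alpha>" "x \<in> A" by (rule UnionE)
  show ?thesis unfolding atom_unique[OF assms(1) A] using A by (rule conjI)
qed

lemmas atom_in = atom_mem[THEN conjunct1] and atom_self = atom_mem[THEN conjunct2]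

lemma atom_eq:
  assumes "partition_on \<Omega> \<alpha>" "x \<in> \<Omega>" "y \<in> atom \<alpha> x"
  shows "atom \<alpha> y = atom \<alpha> x"
  by (rule atom_unique[OF assms(1) atom_in[OF assms(1,2)] assms(3)])

lemma atom_subset: "partition_on \<Omega> \<alpha> \<Longrightarrow> x \<in> \<Omega> \<Longrightarrow> atom \<alpha> x \<subseteq> \<Omega>"
  using atom_in[of \<Omega> \<alpha> x] partition_onD1[of \<Omega> \<alpha>] by (metis Union_upper)

lemma atom_eq_iff:
  assumes "partition_on \<Omega> \<alpha>" "x \<in> \<Omega>" "y \<in> \<Omega>"
  shows "atom \<alpha> x = atom \<alpha> y \<longleftrightarrow> y \<in> atom \<alpha> x"
  using atom_eq[OF assms(1,2)] atom_self[OF assms(1,3)] by auto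

section \<open>Rokhlin's theorem: existence and uniqueness of conditional measures\<close>

locale coded_partition = disintegration \<mu> L t K
  for \<mu> :: "'a measure" and L :: "'c measure" and t K +
  fixes \<alpha> :: "'a set set" and X :: "'a set"
  assumes \<alpha>: "partition_on (space \<mu>) \<alpha>" and X [measurable]: "X \<in> sets \<mu>"
    and X_full: "AE x in \<mu>. x \<in> X"
    and coded: "\<And>x. x \<in> X \<Longrightarrow> atom \<alpha> x \<inter> X = {y \<in> X. t y = t x}"
    and coded_space: "binary_coded \<mu>"
begin

lemma X_space: "x \<in> X \<Longrightarrow> x \<in> space \<mu>"
  using sets.sets_into_space[OF X] by auto

lemma atom_eq_iff_code:
  assumes "x \<in> X" "y \<in> X"
  shows "atom \<alpha> x = atom \<alpha> y \<longleftrightarrow> t x = t y"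
proof -
  have "y \<in> atom \<alpha> x \<longleftrightarrow> t y = t x" using coded[OF assms(1)] assms(2) by blast
  then show ?thesis
    unfolding atom_eq_iff[OF \<alpha> X_space X_space, OF assms] by (simp only: eq_commute)
qed

lemma conditional_system_exists: "\<exists>\<kappa>. conditional_system \<mu> \<alpha> \<kappa>"
proof -
  \<comment> \<open>A conditional system has to be constant on every atom, also off
    \<open>X\<close>, where \<open>t\<close> need not respect atoms. So the kernel is read at a
    chosen point of the atom inside \<open>X\<close>; atoms that miss \<open>X\<close> receive
    \<mu>.\<close>
  define \<kappa> where "\<kappa> x = (if atom \<alpha> x \<inter> X \<noteq> {} then K (t (SOME z. z \<in> atom \<alpha> x \<inter> X)) else \<mu>)" for x
  have \<kappa>K: "\<kappa> x = K (t x)" if "x \<in> X" for x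
  proof -
    have "x \<in> atom \<alpha> x \<inter> X" using that atom_self[OF \<alpha> X_space] by blast
    then have "(SOME z. z \<in> atom \<alpha> x \<inter> X) \<in> atom \<alpha> x \<inter> X" by (rule someI)
    then have "t (SOME z. z \<in> atom \<alpha> x \<inter> X) = t x" using coded[OF that] by auto
    with \<open>x \<in> atom \<alpha> x \<inter> X\<close> show ?thesis by (auto simp: \<kappa>_def)
  qed
  have AE_\<kappa>: "AE x in \<mu>. \<kappa> x = K (t x)"
    using X_full by eventually_elim (rule \<kappa>K)
  have "conditional_system \<mu> \<alpha> \<kappa>"
    unfolding conditional_system_def
  proof (intro conjI ballI)
    fix x assume x: "x \<in> space \<mu>"
    show "prob_space (\<kappa> x)" "sets (\<kappa> x) = sets \<mu>"
    proof -
      have "t (SOME z. z \<in> atom \<alpha> x \<inter> X) \<in> space L" if "atom \<alpha> x \<inter> X \<noteq> {}"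
        using some_in_eq[of "atom \<alpha> x \<inter> X"] that X_space t_space by blast
      then show "prob_space (\<kappa> x)" "sets (\<kappa> x) = sets \<mu>"
        using prob_space_axioms by (auto simp: \<kappa>_def K_prob_space sets_K)
    qed
  next
    have "AE x in \<mu>. AE z in K (t x). z \<in> atom \<alpha> x"
      by (rule AE_disint_const[OF X_full]) (use coded in blast)
    with AE_space AE_\<kappa> show "AE x in \<mu>. emeasure (completion (\<kappa> x)) (atom \<alpha> x) = 1"
    proof eventually_elim
      case (elim x)
      then show ?case
        using prob_space.emeasure_completion_eq_1[OF K_prob_space[OF t_space[OF elim(1)]], of "atom \<alpha> x"]
          atom_subset[OF \<alpha> elim(1)] space_K[OF t_space[OF elim(1)]] by simp
    qed
  next
    fix A x y assume "A \<in> \<alpha>" "x \<in> A" "y \<in> A"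
    then show "\<kappa> x = \<kappa> y" by (simp add: \<kappa>_def atom_unique[OF \<alpha>])
  next
    fix B assume B [measurable]: "B \<in> sets \<mu>"
    have AEB: "AE x in \<mu>. emeasure (K (t x)) B = emeasure (\<kappa> x) B"
      using AE_\<kappa> by eventually_elim simp
    show "(\<lambda>x. emeasure (\<kappa> x) B) \<in> borel_measurable (completion \<mu>)"
      by (rule measurable_completion_cong_AE[OF _ AEB]) measurable
    have "emeasure \<mu> B = (\<integral>\<^sup>+x. indicator B x \<partial>\<mu>)" by simp
    also have "\<dots> = (\<integral>\<^sup>+x. emeasure (K (t x)) B \<partial>\<mu>)"
      by (subst nn_integral_disint') (auto intro!: nn_integral_cong simp: sets_K t_space)
    also have "\<dots> = (\<integral>\<^sup>+x. emeasure (\<kappa> x) B \<partial>completion \<mu>)"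
      unfolding nn_integral_completion by (rule nn_integral_cong_AE[OF AEB])
    finally show "emeasure \<mu> B = (\<integral>\<^sup>+x. emeasure (\<kappa> x) B \<partial>completion \<mu>)" .
  qed
  then show ?thesis by blast
qed

text \<open>An arbitrary conditional system is measurable only for completions. Full mass on the
  atom and on \<open>X\<close> concentrates \<open>\<kappa> x\<close> on the level set of
  \<open>t\<close> through \<open>x\<close>; a Borel version of
  \<open>emeasure (\<kappa> x) B\<close> then satisfies the identity that characterizes the
  kernel.\<close>

lemma conditional_system_unique:
  assumes "conditional_system \<mu> \<alpha> \<kappa>"
  shows "AE x in \<mu>. \<kappa> x = K (t x)"
proof (rule AE_kernel_eqI[OF coded_space])
  have \<kappa>: "\<And>x. x \<in> space \<mu> \<Longrightarrow> prob_space (\<kappa> x)" "\<And>x. x \<in> space \<mu> \<Longrightarrow> sets (\<kappa> x) = sets \<mu>"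
    and atom1: "AE x in \<mu>. emeasure (completion (\<kappa> x)) (atom \<alpha> x) = 1"
    and const: "\<And>A x y. A \<in> \<alpha> \<Longrightarrow> x \<in> A \<Longrightarrow> y \<in> A \<Longrightarrow> \<kappa> x = \<kappa> y"
    and meas: "\<And>B. B \<in> sets \<mu> \<Longrightarrow> (\<lambda>x. emeasure (\<kappa> x) B) \<in> borel_measurable (completion \<mu>)"
    and int: "\<And>B. B \<in> sets \<mu> \<Longrightarrow> emeasure \<mu> B = (\<integral>\<^sup>+x. emeasure (\<kappa> x) B \<partial>\<mu>)"
    using assms unfolding conditional_system_def nn_integral_completion by blast+
  show "\<kappa> x \<in> space (prob_algebra \<mu>)" if "x \<in> space \<mu>" for x
    using \<kappa> that by (auto simp: space_prob_algebra)
  show "K (t x) \<in> space (prob_algebra \<mu>)" if "x \<in> space \<mu>" for x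
    using that by (intro K_prob_algebra t_space)
  fix B assume B [measurable]: "B \<in> sets \<mu>"
  have "emeasure \<mu> (space \<mu> - X) = 0"
    using X_full by (subst AE_iff_measurable[symmetric, where P="\<lambda>x. x \<in> X"]) auto
  then have "(\<integral>\<^sup>+x. emeasure (\<kappa> x) (space \<mu> - X) \<partial>completion \<mu>) = 0"
    using int[of "space \<mu> - X"] by (simp add: nn_integral_completion)
  then have "AE x in \<mu>. emeasure (\<kappa> x) (space \<mu> - X) = 0"
    using meas[of "space \<mu> - X"] by (subst (asm) nn_integral_0_iff_AE) (auto simp: AE_completion_iff)
  with AE_space X_full atom1 have conc: "AE x in \<mu>. AE z in \<kappa> x. t z = t x"
  proof eventually_elim
    case (elim x)
    interpret \<kappa>x: prob_space "\<kappa> x" using elim \<kappa> by blast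
    interpret cx: prob_space "completion (\<kappa> x)" by (rule \<kappa>x.prob_space_completion)
    have "atom \<alpha> x \<in> sets (completion (\<kappa> x))"
      using elim(3) by (metis emeasure_notin_sets zero_neq_one)
    then have "AE z in completion (\<kappa> x). z \<in> atom \<alpha> x"
      using elim(3) by (intro cx.AE_prob_1) (simp add: measure_def)
    then have "AE z in \<kappa> x. z \<in> atom \<alpha> x" by (simp only: AE_completion_iff)
    moreover have "AE z in \<kappa> x. z \<in> X"
      by (rule AE_I'[of "space \<mu> - X"]) (use elim \<kappa> sets_eq_imp_space_eq[OF \<kappa>(2)] in \<open>auto simp: null_sets_def\<close>)
    ultimately show ?case
      by eventually_elim (use coded[OF elim(2)] in blast)
  qed
  from completion_ex_borel_measurable[OF meas[OF B]] obtain g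
    where g [measurable]: "g \<in> borel_measurable \<mu>" and AEg: "AE x in \<mu>. emeasure (\<kappa> x) B = g x" by blast
  have "AE x in \<mu>. emeasure (K (t x)) B = g x"
  proof (rule emeasure_K_eqI[OF B g])
    have "AE x in \<mu>. x \<in> X \<and> emeasure (\<kappa> x) B = g x" using X_full AEg by eventually_elim simp
    then show "AE x in \<mu>. AE z in K (t x). g z = g x"
    proof (rule AE_disint_const)
      fix x z assume x: "x \<in> X \<and> emeasure (\<kappa> x) B = g x" and z: "z \<in> X \<and> emeasure (\<kappa> z) B = g z"
        and "x \<in> space \<mu>" "t z = t x"
      then have "z \<in> atom \<alpha> x" using coded[of x] by blast
      then have "\<kappa> z = \<kappa> x"
        using const atom_in[OF \<alpha>] atom_self[OF \<alpha>] \<open>x \<in> space \<mu>\<close> by blast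
      with x z show "g z = g x" by metis
    qed
    fix D assume D [measurable]: "D \<in> sets L"
    have tDB: "t -` D \<inter> B = {x \<in> space \<mu>. t x \<in> D \<and> x \<in> B}" using sets.sets_into_space[OF B] by auto
    have [measurable]: "t -` D \<inter> B \<in> sets \<mu>" unfolding tDB by measurable
    have "emeasure \<mu> (t -` D \<inter> B) = (\<integral>\<^sup>+x. emeasure (\<kappa> x) (t -` D \<inter> B) \<partial>\<mu>)" by (rule int) simp
    also have "\<dots> = (\<integral>\<^sup>+x. indicator D (t x) * g x \<partial>\<mu>)"
    proof (rule nn_integral_cong_AE)
      show "AE x in \<mu>. emeasure (\<kappa> x) (t -` D \<inter> B) = indicator D (t x) * g x"
        using AE_space conc AEg
      proof eventually_elim
        case (elim x)
        have s: "sets (\<kappa> x) = sets \<mu>" using \<kappa> elim by blast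
        show ?case
        proof (cases "t x \<in> D")
          case True
          have "emeasure (\<kappa> x) (t -` D \<inter> B) = emeasure (\<kappa> x) B"
            using elim(2) True by (intro emeasure_eq_AE) (auto simp: s elim: eventually_mono)
          with True elim show ?thesis by simp
        next
          case False
          have "emeasure (\<kappa> x) (t -` D \<inter> B) = emeasure (\<kappa> x) {}"
            using elim(2) False by (intro emeasure_eq_AE) (auto simp: s elim: eventually_mono)
          with False show ?thesis by simp
        qed
      qed
    qed
    finally show "emeasure \<mu> (t -` D \<inter> B) = (\<integral>\<^sup>+x. indicator D (t x) * g x \<partial>\<mu>)" .
  qed
  with AEg show "AE x in \<mu>. emeasure (\<kappa> x) B = emeasure (K (t x)) B"
    by eventually_elim simp
qed

lemma AE_cond_measure: "AE x in \<mu>. cond_measure \<mu> \<alpha> x = K (t x)"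
  unfolding cond_measure_def
  by (rule conditional_system_unique) (rule someI_ex[OF conditional_system_exists])

end

lemma measurable_partition_code:
  assumes "measurable_partition \<mu> \<alpha>"
  shows "\<exists>X t. X \<in> sets \<mu> \<and> (AE x in \<mu>. x \<in> X) \<and> t \<in> borel_measurable \<mu> \<and>
    (\<forall>x\<in>X. atom \<alpha> x \<inter> X = {y \<in> X. t y = (t x :: real)})"
proof -
  from assms obtain X A where X: "X \<in> sets \<mu>" "emeasure \<mu> (space \<mu> - X) = 0"
    and A: "range A \<subseteq> sets \<mu>" "\<forall>x\<in>X. atom \<alpha> x \<inter> X = {y\<in>X. \<forall>n::nat. y \<in> A n \<longleftrightarrow> x \<in> A n}"
    unfolding measurable_partition_def by blast
  have [measurable]: "A n \<in> sets \<mu>" for n using A(1) by blast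
  have "AE x in \<mu>. x \<in> X"
    by (rule AE_I'[of "space \<mu> - X"]) (use X in \<open>auto simp: null_sets_def\<close>)
  moreover have "(\<lambda>x. ternary (\<lambda>n. x \<in> A n)) \<in> borel_measurable \<mu>" by measurable
  ultimately show ?thesis
    using X A(2) by (intro exI[of _ X] exI[of _ "\<lambda>x. ternary (\<lambda>n. x \<in> A n)"]) (auto simp: ternary_inject)
qed

section \<open>Atoms of probability measures on the line\<close>

lemma measurable_emeasure_singleton:
  assumes "prob_space \<rho>" "sets \<rho> = sets (borel :: real measure)"
  shows "(\<lambda>y. emeasure \<rho> {y}) \<in> borel_measurable borel"
proof (rule emeasure_measurable_subprob_algebra2)
  have "(SIGMA y:space borel. {y}) = {z :: real \<times> real. fst z = snd z}" by auto
  also have "\<dots> \<in> sets (borel \<Otimes>\<^sub>M borel)"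
    unfolding borel_prod by (intro borel_closed closed_Collect_eq) (auto intro: continuous_intros)
  finally show "(SIGMA y:space borel. {y :: real}) \<in> sets (borel \<Otimes>\<^sub>M borel)" .
  show "(\<lambda>y. \<rho>) \<in> borel \<rightarrow>\<^sub>M subprob_algebra borel"
    using assms by (intro measurable_const) (auto simp: space_subprob_algebra prob_space_imp_subprob_space)
qed

lemma nn_integral_countable_set:
  fixes \<nu> :: "real measure"
  assumes sets: "sets \<nu> = sets borel" and D: "countable D" and h: "h \<in> borel_measurable borel"
  shows "(\<integral>\<^sup>+y. h y * indicator D y \<partial>\<nu>) = (\<integral>\<^sup>+y. h y * emeasure \<nu> {y} \<partial>count_space D)"
proof -
  have h': "h \<in> borel_measurable \<nu>" using h measurable_cong_sets[OF sets refl] by blast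
  have "(\<integral>\<^sup>+y. h y * indicator D y \<partial>\<nu>) = (\<integral>\<^sup>+y. \<integral>\<^sup>+d. h y * indicator {d} y \<partial>count_space D \<partial>\<nu>)"
  proof (rule nn_integral_cong)
    fix y
    have "(\<integral>\<^sup>+d. h y * indicator {d} y \<partial>count_space D) = (\<integral>\<^sup>+d. h y * indicator {d} y * indicator D d \<partial>count_space UNIV)"
      by (simp add: nn_integral_count_space_indicator)
    also have "\<dots> = (\<integral>\<^sup>+d. h y * indicator D y * indicator {y} d \<partial>count_space UNIV)"
      by (rule nn_integral_cong) (auto split: split_indicator)
    also have "\<dots> = h y * indicator D y" by (simp add: nn_integral_cmult_indicator)
    finally show "h y * indicator D y = (\<integral>\<^sup>+d. h y * indicator {d} y \<partial>count_space D)" ..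
  qed
  also have "\<dots> = (\<integral>\<^sup>+d. \<integral>\<^sup>+y. h y * indicator {d} y \<partial>\<nu> \<partial>count_space D)"
    using h' D sets by (intro nn_integral_count_space_nn_integral) auto
  also have "\<dots> = (\<integral>\<^sup>+d. h d * emeasure \<nu> {d} \<partial>count_space D)"
  proof (rule nn_integral_cong)
    fix d
    have "(\<integral>\<^sup>+y. h y * indicator {d} y \<partial>\<nu>) = (\<integral>\<^sup>+y. h d * indicator {d} y \<partial>\<nu>)"
      by (intro nn_integral_cong) (auto split: split_indicator)
    also have "\<dots> = h d * emeasure \<nu> {d}" by (intro nn_integral_cmult_indicator) (simp add: sets)
    finally show "(\<integral>\<^sup>+y. h y * indicator {d} y \<partial>\<nu>) = h d * emeasure \<nu> {d}" .
  qed
  finally show ?thesis .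
qed

lemma countable_atoms:
  assumes "prob_space (\<rho> :: real measure)"
  shows "countable {y. emeasure \<rho> {y} \<noteq> 0}"
proof -
  interpret prob_space \<rho> by fact
  show ?thesis using countable_support by (simp add: emeasure_eq_measure)
qed

text \<open>The measure \<nu> lives on the countable set of atoms of \<rho>; those of them that it
  does not charge form a countable, hence null, set.\<close>

lemma AE_atom_if_AE_atom:
  fixes \<nu> \<rho> :: "real measure"
  assumes \<nu>: "prob_space \<nu>" "sets \<nu> = sets borel" and \<rho>: "prob_space \<rho>"
    and AE: "AE y in \<nu>. emeasure \<rho> {y} \<noteq> 0"
  shows "AE y in \<nu>. emeasure \<nu> {y} \<noteq> 0"
proof -
  define B where "B = {y. emeasure \<rho> {y} \<noteq> 0 \<and> emeasure \<nu> {y} = 0}"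
  have "countable B" unfolding B_def by (rule countable_subset[OF _ countable_atoms[OF \<rho>]]) auto
  then have "(\<Union>y\<in>B. {y}) \<in> null_sets \<nu>"
    by (intro null_sets_UN') (auto simp: B_def null_sets_def \<nu>)
  then have "AE y in \<nu>. y \<notin> (\<Union>y\<in>B. {y})" by (rule AE_not_in)
  with AE show ?thesis by eventually_elim (auto simp: B_def)
qed

text \<open>Written as a sum over the atoms of \<nu>, the integral loses its denominators and
  becomes the integral of \<open>g\<close> over the part of \<rho> on these atoms. It is only a
  bound because \<rho> may have mass elsewhere.\<close>

lemma nn_integral_atom_ratio_le:
  fixes \<nu> \<rho> :: "real measure"
  assumes \<nu>: "prob_space \<nu>" "sets \<nu> = sets borel" and \<rho>: "prob_space \<rho>" "sets \<rho> = sets borel"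
    and AE: "AE y in \<nu>. emeasure \<nu> {y} \<noteq> 0"
    and g: "g \<in> borel_measurable borel"
  shows "(\<integral>\<^sup>+y. g y * (emeasure \<rho> {y} / emeasure \<nu> {y}) \<partial>\<nu>) \<le> (\<integral>\<^sup>+y. g y \<partial>\<rho>)"
proof -
  interpret \<nu>: prob_space \<nu> by fact
  define D where "D = {y. emeasure \<nu> {y} \<noteq> 0}"
  have cD: "countable D" unfolding D_def by (rule countable_atoms[OF \<nu>(1)])
  note [measurable] = measurable_emeasure_singleton[OF \<nu>] measurable_emeasure_singleton[OF \<rho>] g
  have "(\<integral>\<^sup>+y. g y * (emeasure \<rho> {y} / emeasure \<nu> {y}) \<partial>\<nu>)
      = (\<integral>\<^sup>+y. g y * (emeasure \<rho> {y} / emeasure \<nu> {y}) * indicator D y \<partial>\<nu>)"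
    by (rule nn_integral_cong_AE, use AE in eventually_elim) (simp add: D_def)
  also have "\<dots> = (\<integral>\<^sup>+y. g y * (emeasure \<rho> {y} / emeasure \<nu> {y}) * emeasure \<nu> {y} \<partial>count_space D)"
    by (intro nn_integral_countable_set \<nu> cD) measurable
  also have "\<dots> = (\<integral>\<^sup>+y. g y * emeasure \<rho> {y} \<partial>count_space D)"
  proof (rule nn_integral_cong)
    fix y assume "y \<in> space (count_space D)"
    then have "emeasure \<nu> {y} \<noteq> 0" by (simp add: D_def)
    then have "emeasure \<rho> {y} / emeasure \<nu> {y} * emeasure \<nu> {y} = emeasure \<rho> {y}"
      using \<nu>.emeasure_finite[of "{y}"]
      by (simp add: ennreal_divide_times ennreal_divide_self less_top[symmetric])
    then show "g y * (emeasure \<rho> {y} / emeasure \<nu> {y}) * emeasure \<nu> {y} = g y * emeasure \<rho> {y}"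
      by (simp only: mult.assoc)
  qed
  also have "\<dots> = (\<integral>\<^sup>+y. g y * indicator D y \<partial>\<rho>)"
    by (rule nn_integral_countable_set[OF \<rho>(2) cD g, symmetric])
  also have "\<dots> \<le> (\<integral>\<^sup>+y. g y \<partial>\<rho>)"
    by (intro nn_integral_mono) (auto split: split_indicator)
  finally show ?thesis .
qed

lemma prob_measure_eqI_le:
  assumes "prob_space P" "prob_space Q" and sets: "sets P = sets Q"
    and le: "\<And>A. A \<in> sets P \<Longrightarrow> emeasure P A \<le> emeasure Q A"
  shows "P = Q"
proof (rule measure_eqI[OF sets])
  interpret P: prob_space P by fact
  interpret Q: prob_space Q by fact
  fix A assume A: "A \<in> sets P"
  have "emeasure P (space P - A) \<le> emeasure Q (space P - A)" using A by (intro le) auto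
  then have "1 - P.prob A \<le> 1 - Q.prob A"
    using A sets sets_eq_imp_space_eq[OF sets] P.prob_compl[OF A] Q.prob_compl[of A]
    by (simp add: P.emeasure_eq_measure Q.emeasure_eq_measure)
  moreover have "P.prob A \<le> Q.prob A"
    using le[OF A] by (simp add: P.emeasure_eq_measure Q.emeasure_eq_measure)
  ultimately show "emeasure P A = emeasure Q A"
    by (simp add: P.emeasure_eq_measure Q.emeasure_eq_measure)
qed

text \<open>With ratio 1 the preceding bound says that \<nu> is dominated by \<rho>, and two
  probability measures so ordered coincide.\<close>

lemma measure_eq_if_atoms_eq:
  fixes \<nu> \<rho> :: "real measure"
  assumes \<nu>: "prob_space \<nu>" "sets \<nu> = sets borel" and \<rho>: "prob_space \<rho>" "sets \<rho> = sets borel"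
    and AE: "AE y in \<nu>. emeasure \<nu> {y} \<noteq> 0" and eq: "AE y in \<nu>. emeasure \<rho> {y} = emeasure \<nu> {y}"
  shows "\<nu> = \<rho>"
proof (rule prob_measure_eqI_le[OF \<nu>(1) \<rho>(1)])
  interpret \<nu>: prob_space \<nu> by fact
  fix A assume A: "A \<in> sets \<nu>"
  have "emeasure \<nu> A = (\<integral>\<^sup>+y. indicator A y \<partial>\<nu>)" using A by simp
  also have "\<dots> = (\<integral>\<^sup>+y. indicator A y * (emeasure \<rho> {y} / emeasure \<nu> {y}) \<partial>\<nu>)"
    using AE eq
  proof (intro nn_integral_cong_AE, eventually_elim)
    case (elim y)
    then have "emeasure \<rho> {y} / emeasure \<nu> {y} = 1"
      by (simp add: ennreal_divide_self less_top[symmetric])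
    then show ?case by simp
  qed
  also have "\<dots> \<le> (\<integral>\<^sup>+y. indicator A y \<partial>\<rho>)"
    using A \<nu>(2) by (intro nn_integral_atom_ratio_le \<nu> \<rho> AE) auto
  also have "\<dots> = emeasure \<rho> A" using A \<nu>(2) \<rho>(2) by simp
  finally show "emeasure \<nu> A \<le> emeasure \<rho> A" .
qed (use \<nu> \<rho> in simp)

text \<open>This is ln r \<le> r - 1 at r = u / v, with equality only at r = 1. It is arranged as a
  comparison of sums because the terms are nonnegative extended reals, where subtraction is
  truncated.\<close>

lemma neg_log_ratio:
  assumes "0 < u" "u \<le> 1" "0 < v" "v \<le> 1"
  shows "neg_log v + 1 \<le> neg_log u + ennreal u / ennreal v"
    and "neg_log v + 1 = neg_log u + ennreal u / ennreal v \<Longrightarrow> u = v"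
proof -
  have ln0: "ln u \<le> 0" "ln v \<le> 0" "0 \<le> u / v" using assms by auto
  have v: "neg_log v + 1 = ennreal (- ln v + 1)"
    using assms by (simp add: neg_log_def ennreal_plus[symmetric] ennreal_1[symmetric] del: ennreal_plus ennreal_1)
  have u: "neg_log u + ennreal u / ennreal v = ennreal (- ln u + u / v)"
    using assms by (simp add: neg_log_def divide_ennreal ennreal_plus[symmetric] del: ennreal_plus)
  have ln: "ln (u / v) = ln u - ln v" using assms by (simp add: ln_div)
  have "ln (u / v) \<le> u / v - 1" using assms by (intro ln_le_minus_one) simp
  then show "neg_log v + 1 \<le> neg_log u + ennreal u / ennreal v"
    unfolding u v ln by (intro ennreal_leI) linarith
  assume "neg_log v + 1 = neg_log u + ennreal u / ennreal v"
  moreover have "0 \<le> - ln v + 1" "0 \<le> - ln u + u / v" using ln0 by linarith+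
  ultimately have "- ln v + 1 = - ln u + u / v" unfolding u v by (simp only: ennreal_inj)
  then have "ln (u / v) = u / v - 1" unfolding ln by linarith
  then have "u / v = 1" using assms by (intro ln_eq_minus_one) auto
  with assms show "u = v" by simp
qed

lemma measurable_neg_log [measurable]: "neg_log \<in> borel_measurable borel"
  unfolding neg_log_def[abs_def] by measurable

lemma measure_completion_eqI:
  assumes A: "AE z in P. z \<in> A \<longleftrightarrow> z \<in> B" and AP: "A \<subseteq> space P" and B: "B \<in> sets P"
  shows "measure (completion P) A = measure P B"
proof -
  have B': "B \<in> sets (completion P)" using B by (rule sets_completionI_sets)
  have AE: "AE z in completion P. z \<in> A \<longleftrightarrow> z \<in> B" using A by (rule AE_completion)
  have "A \<in> sets (completion P)"
    by (rule completion.in_sets_AE[OF _ B']) (use AE AP in \<open>auto elim: eventually_mono\<close>)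
  then have "emeasure (completion P) A = emeasure (completion P) B"
    using AE B' by (intro emeasure_eq_AE)
  then show ?thesis using B by (simp add: measure_def)
qed

lemma AE_eq_if_le_and_nn_integral_eq:
  fixes f g :: "'a \<Rightarrow> ennreal"
  assumes [measurable]: "f \<in> borel_measurable M" "g \<in> borel_measurable M"
    and le: "AE x in M. f x \<le> g x" and eq: "(\<integral>\<^sup>+x. g x \<partial>M) \<le> (\<integral>\<^sup>+x. f x \<partial>M)" and fin: "(\<integral>\<^sup>+x. f x \<partial>M) < \<infinity>"
  shows "AE x in M. f x = g x"
proof -
  have "(\<integral>\<^sup>+x. g x - f x \<partial>M) = (\<integral>\<^sup>+x. g x \<partial>M) - (\<integral>\<^sup>+x. f x \<partial>M)"
    using fin le by (intro nn_integral_diff) auto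
  also have "\<dots> = 0" using eq fin by (intro diff_eq_0_ennreal) auto
  finally have "AE x in M. g x - f x = 0" by (simp add: nn_integral_0_iff_AE)
  moreover have "AE x in M. f x \<noteq> \<infinity>" using fin by (intro nn_integral_PInf_AE) auto
  ultimately show ?thesis using le
  proof eventually_elim
    case (elim x)
    then have "g x \<le> f x" by (auto simp: ennreal_minus_eq_0)
    with elim(3) show ?case by (rule antisym)
  qed
qed

context disintegration
begin

lemma AE_if_AE_disint:
  assumes P [measurable]: "Measurable.pred \<mu> P" and AE: "AE x in \<mu>. AE z in K (t x). P z"
  shows "AE x in \<mu>. P x"
proof -
  have N [measurable]: "{x \<in> space \<mu>. \<not> P x} \<in> sets \<mu>" by measurable
  have "(\<integral>\<^sup>+x. indicator {x \<in> space \<mu>. \<not> P x} x \<partial>\<mu>)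
      = (\<integral>\<^sup>+x. (\<integral>\<^sup>+z. indicator {x \<in> space \<mu>. \<not> P x} z \<partial>K (t x)) \<partial>\<mu>)"
    by (rule nn_integral_disint') measurable
  also have "\<dots> = (\<integral>\<^sup>+x. 0 \<partial>\<mu>)"
    using AE
  proof (intro nn_integral_cong_AE, eventually_elim)
    case (elim x)
    have "(\<integral>\<^sup>+z. indicator {x \<in> space \<mu>. \<not> P x} z \<partial>K (t x)) = (\<integral>\<^sup>+z. 0 \<partial>K (t x))"
      using elim by (intro nn_integral_cong_AE) (auto elim: eventually_mono)
    then show ?case by simp
  qed
  finally have "emeasure \<mu> {x \<in> space \<mu>. \<not> P x} = 0" by simp
  then show ?thesis by (subst AE_iff_measurable[OF N refl])
qed

lemma measurable_K_level [measurable]: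
  assumes [measurable]: "g \<in> borel_measurable \<mu>"
  shows "(\<lambda>x. measure (K (t x)) {z \<in> space \<mu>. g z = (g x :: real)}) \<in> borel_measurable \<mu>"
proof (rule measure_measurable_subprob_algebra2)
  have "(SIGMA x:space \<mu>. {z \<in> space \<mu>. g z = g x}) = {w \<in> space (\<mu> \<Otimes>\<^sub>M \<mu>). g (snd w) = g (fst w)}"
    by (auto simp: space_pair_measure)
  also have "\<dots> \<in> sets (\<mu> \<Otimes>\<^sub>M \<mu>)" by measurable
  finally show "(SIGMA x:space \<mu>. {z \<in> space \<mu>. g z = g x}) \<in> sets (\<mu> \<Otimes>\<^sub>M \<mu>)" .
qed measurable

end

section \<open>Holonomies\<close>

lemma atom_pullback:
  assumes \<alpha>: "partition_on \<Omega> \<alpha>" and h: "h x \<in> \<Omega>" and x: "x \<in> space M"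
  shows "atom (pullback M h \<alpha>) x = h -` atom \<alpha> (h x) \<inter> space M"
  unfolding atom_def[of "pullback M h \<alpha>"]
proof (rule the_equality)
  show "h -` atom \<alpha> (h x) \<inter> space M \<in> pullback M h \<alpha> \<and> x \<in> h -` atom \<alpha> (h x) \<inter> space M"
    using atom_in[OF \<alpha> h] atom_self[OF \<alpha> h] x by (auto simp: pullback_def)
  fix A assume "A \<in> pullback M h \<alpha> \<and> x \<in> A"
  then obtain B where B: "B \<in> \<alpha>" "A = h -` B \<inter> space M" "h x \<in> B" by (auto simp: pullback_def)
  then show "A = h -` atom \<alpha> (h x) \<inter> space M" using atom_unique[OF \<alpha> B(1,3)] by simp
qed

lemma atom_eq_if_finer_pullback:
  assumes \<alpha>: "partition_on (space M) \<alpha>" and fin: "finer (pullback M h \<alpha>) \<alpha>"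
    and h: "h x \<in> space M" "h y \<in> space M" and x: "x \<in> space M" "y \<in> space M"
    and eq: "atom \<alpha> (h x) = atom \<alpha> (h y)"
  shows "atom \<alpha> x = atom \<alpha> y"
proof -
  have "\<exists>C\<subseteq>pullback M h \<alpha>. atom \<alpha> x = \<Union>C"
    by (rule bspec[OF fin[unfolded finer_def] atom_in[OF \<alpha> x(1)]])
  then obtain C where C: "C \<subseteq> pullback M h \<alpha>" "atom \<alpha> x = \<Union>C" by (elim exE conjE)
  have "x \<in> \<Union>C" using atom_self[OF \<alpha> x(1)] unfolding C(2) .
  then obtain c where "c \<in> C" "x \<in> c" by (rule UnionE)
  with C have c: "c \<in> pullback M h \<alpha>" "x \<in> c" "c \<subseteq> atom \<alpha> x" by auto
  then obtain B where B: "B \<in> \<alpha>" "c = h -` B \<inter> space M" by (auto simp: pullback_def)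
  with c have "atom \<alpha> (h x) = B" by (intro atom_unique[OF \<alpha>]) auto
  with eq have "h y \<in> B" using atom_self[OF \<alpha> h(2)] by simp
  with B c x have "y \<in> atom \<alpha> x" by auto
  then show ?thesis by (rule atom_eq[OF \<alpha> x(1), symmetric])
qed

locale holonomy_setting =
  fixes M :: "'a measure" and N :: "'b measure"
    and m :: "'a measure" and \<mu> :: "('a \<times> 'b) measure"
    and f :: "'a \<Rightarrow> 'a" and F :: "'a \<times> 'b \<Rightarrow> 'a \<times> 'b"
    and \<sigma> :: "'a set set" and \<xi>cu \<xi>u :: "('a \<times> 'b) set set"
  assumes binary_coded_M: "binary_coded M" and binary_coded_N: "binary_coded N"
    and prob_m: "prob_space m" and sets_m [measurable_cong]: "sets m = sets M"
    and f_bij: "bimeasurable_bijection M f" and f_inv: "distr m M f = m"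
    and F_bij: "bimeasurable_bijection (M \<Otimes>\<^sub>M N) F"
    and fst_F': "\<forall>x\<in>space (M \<Otimes>\<^sub>M N). fst (F x) = f (fst x)"
    and part_\<sigma>': "partition_on (space m) \<sigma>"
    and gen_\<sigma>: "generating_partition M f \<sigma>"
    and prob_\<mu>: "prob_space \<mu>" and sets_\<mu> [measurable_cong]: "sets \<mu> = sets (M \<Otimes>\<^sub>M N)"
    and F_inv: "distr \<mu> (M \<Otimes>\<^sub>M N) F = \<mu>"
    and marginal: "distr \<mu> M fst = m"
    and \<xi>cu: "\<xi>cu = pullback (M \<Otimes>\<^sub>M N) fst \<sigma>"
    and part_\<xi>: "partition_on (space \<mu>) \<xi>u"
    and incr_\<xi>: "increasing_partition (M \<Otimes>\<^sub>M N) F \<xi>u"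
    and fst_atom': "\<forall>x\<in>space (M \<Otimes>\<^sub>M N). fst ` atom \<xi>u x = atom \<sigma> (fst x)"
    and hol: "holonomies_bijective M N \<xi>cu \<xi>u"
begin

abbreviation E :: "('a \<times> 'b) measure" where
  "E \<equiv> M \<Otimes>\<^sub>M N"

lemma space_m: "space m = space M" using sets_eq_imp_space_eq[OF sets_m] .

lemma space_\<mu>: "space \<mu> = space M \<times> space N"
  using sets_eq_imp_space_eq[OF sets_\<mu>] by (simp add: space_pair_measure)

lemma space_\<mu>': "space E = space \<mu>"
  using sets_eq_imp_space_eq[OF sets_\<mu>] by simp

lemmas part_\<sigma> = part_\<sigma>'[unfolded space_m]
lemmas fst_F = fst_F'[unfolded space_\<mu>', rule_format]
lemmas fst_atom = fst_atom'[unfolded space_\<mu>', rule_format]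

lemma fst_space: "x \<in> space \<mu> \<Longrightarrow> fst x \<in> space M" by (auto simp: space_\<mu>)

lemma f_measurable [measurable]: "f \<in> M \<rightarrow>\<^sub>M M" using f_bij by (simp add: bimeasurable_bijection_def)

lemma F_measurable [measurable]: "F \<in> E \<rightarrow>\<^sub>M E"
  using F_bij by (simp add: bimeasurable_bijection_def)

lemma F_measurable_\<mu> [measurable]: "F \<in> \<mu> \<rightarrow>\<^sub>M \<mu>"
  using F_measurable measurable_cong_sets[OF sets_\<mu> sets_\<mu>] by blast

lemma fst_measurable_\<mu> [measurable]: "fst \<in> \<mu> \<rightarrow>\<^sub>M M"
  using measurable_fst measurable_cong_sets[OF sets_\<mu> refl] by blast

lemma f_space: "p \<in> space M \<Longrightarrow> f p \<in> space M" using measurable_space[OF f_measurable] .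

lemma F_space: "x \<in> space \<mu> \<Longrightarrow> F x \<in> space \<mu>" using measurable_space[OF F_measurable_\<mu>] .

lemma f_inj: "p \<in> space M \<Longrightarrow> q \<in> space M \<Longrightarrow> f p = f q \<Longrightarrow> p = q"
  using f_bij by (auto simp: bimeasurable_bijection_def bij_betw_def inj_on_def)

definition Finv where "Finv = the_inv_into (space \<mu>) F"

lemma Finv_measurable [measurable]: "Finv \<in> \<mu> \<rightarrow>\<^sub>M \<mu>"
proof -
  have "Finv \<in> E \<rightarrow>\<^sub>M E"
    using F_bij by (simp add: bimeasurable_bijection_def space_\<mu>' Finv_def)
  then show ?thesis using measurable_cong_sets[OF sets_\<mu> sets_\<mu>] by blast
qed

lemma Finv_space: "x \<in> space \<mu> \<Longrightarrow> Finv x \<in> space \<mu>" using measurable_space[OF Finv_measurable] .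

lemma F_Finv: "x \<in> space \<mu> \<Longrightarrow> F (Finv x) = x"
  and Finv_F: "x \<in> space \<mu> \<Longrightarrow> Finv (F x) = x"
  using F_bij unfolding bimeasurable_bijection_def space_\<mu>' Finv_def bij_betw_def
  by (auto intro: f_the_inv_into_f the_inv_into_f_f)

lemma AE_f: "AE p in m. P p \<Longrightarrow> AE p in m. P (f p)"
proof -
  have "f \<in> m \<rightarrow>\<^sub>M M" using f_measurable measurable_cong_sets[OF sets_m refl] by blast
  then show "AE p in m. P p \<Longrightarrow> AE p in m. P (f p)" by (rule AE_distrD[of f m M P, unfolded f_inv])
qed

lemma AE_fst: "AE p in m. P p \<Longrightarrow> AE x in \<mu>. P (fst x)"
  by (rule AE_distrD[OF fst_measurable_\<mu>, unfolded marginal])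

lemma nn_integral_fst: "g \<in> borel_measurable M \<Longrightarrow> (\<integral>\<^sup>+p. g p \<partial>m) = (\<integral>\<^sup>+x. g (fst x) \<partial>\<mu>)"
  by (subst marginal[symmetric], subst nn_integral_distr) auto

lemma nn_integral_F:
  assumes g: "g \<in> borel_measurable \<mu>"
  shows "(\<integral>\<^sup>+x. g (F x) \<partial>\<mu>) = (\<integral>\<^sup>+x. g x \<partial>\<mu>)"
proof -
  have "g \<in> borel_measurable E" using g measurable_cong_sets[OF sets_\<mu> refl] by blast
  then have "(\<integral>\<^sup>+x. g x \<partial>distr \<mu> E F) = (\<integral>\<^sup>+x. g (F x) \<partial>\<mu>)" by (subst nn_integral_distr) auto
  then show ?thesis by (simp add: F_inv)
qed

lemma AE_Finv:
  assumes "AE x in \<mu>. P x"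
  shows "AE x in \<mu>. P (Finv x)"
proof -
  have "distr \<mu> \<mu> Finv = \<mu>"
  proof (rule measure_eqI)
    fix B assume "B \<in> sets (distr \<mu> \<mu> Finv)"
    then have B [measurable]: "B \<in> sets \<mu>" by simp
    have "emeasure (distr \<mu> \<mu> Finv) B = (\<integral>\<^sup>+x. indicator B (Finv x) \<partial>\<mu>)"
      by (subst nn_integral_indicator[symmetric], simp, subst nn_integral_distr) auto
    also have "\<dots> = (\<integral>\<^sup>+x. indicator B (Finv (F x)) \<partial>\<mu>)"
      by (rule nn_integral_F[symmetric]) measurable
    also have "\<dots> = (\<integral>\<^sup>+x. indicator B x \<partial>\<mu>)"
      by (intro nn_integral_cong) (simp add: Finv_F)
    finally show "emeasure (distr \<mu> \<mu> Finv) B = emeasure \<mu> B" by simp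
  qed simp
  then show ?thesis using AE_distrD[OF Finv_measurable, of P] assms by (simp only:)
qed

lemma \<xi>_eq_if_F:
  assumes "x \<in> space \<mu>" "y \<in> space \<mu>" "atom \<xi>u (F x) = atom \<xi>u (F y)"
  shows "atom \<xi>u x = atom \<xi>u y"
proof (rule atom_eq_if_finer_pullback)
  show "partition_on (space E) \<xi>u" unfolding space_\<mu>' by (rule part_\<xi>)
  show "finer (pullback E F \<xi>u) \<xi>u" using incr_\<xi> unfolding increasing_partition_def .
  show "F x \<in> space E" "F y \<in> space E" "x \<in> space E" "y \<in> space E"
    unfolding space_\<mu>' using assms F_space by blast+
qed (fact assms(3))

lemma \<sigma>_eq_if_\<xi>:
  assumes "x \<in> space \<mu>" "y \<in> space \<mu>" "atom \<xi>u x = atom \<xi>u y"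
  shows "atom \<sigma> (fst x) = atom \<sigma> (fst y)"
  using fst_atom[OF assms(1)] fst_atom[OF assms(2)] assms(3) by simp

lemma holonomy_unique:
  assumes pq: "q \<in> space M" "atom \<sigma> (fst z) = atom \<sigma> q" and z: "z \<in> space \<mu>"
  shows "\<exists>!w. w \<in> atom \<xi>u z \<inter> fiber N q"
proof -
  let ?p = "fst z"
  have p: "?p \<in> space M" using z by (rule fst_space)
  let ?A = "fst -` atom \<sigma> ?p \<inter> space E"
  have "?A \<in> \<xi>cu" using atom_in[OF part_\<sigma> p] by (simp add: \<xi>cu pullback_def)
  moreover have "fiber N ?p \<subseteq> ?A" "fiber N q \<subseteq> ?A"
    using p pq atom_self[OF part_\<sigma> p] atom_self[OF part_\<sigma> pq(1)]
    by (auto simp: fiber_def space_pair_measure)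
  ultimately have "\<forall>z\<in>fiber N ?p. \<exists>!w. w \<in> atom \<xi>u z \<inter> fiber N q"
    using hol p pq(1) unfolding holonomies_bijective_def by blast
  moreover have "z \<in> fiber N ?p" using z by (auto simp: fiber_def space_\<mu>)
  ultimately show ?thesis by blast
qed

lemma holonomy_eq:
  assumes "z \<in> space \<mu>" "w \<in> space \<mu>" "atom \<xi>u z = atom \<xi>u w"
  shows "holonomy N \<xi>u (fst z) (fst w) z = w"
  unfolding holonomy_def
proof (rule the1_equality)
  show "\<exists>!w'. w' \<in> atom \<xi>u z \<inter> fiber N (fst w)"
    by (rule holonomy_unique[OF fst_space[OF assms(2)] \<sigma>_eq_if_\<xi>[OF assms] assms(1)])
  show "w \<in> atom \<xi>u z \<inter> fiber N (fst w)"
    using assms atom_self[OF part_\<xi>, of w] by (auto simp: fiber_def space_\<mu>)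
qed

lemma holonomy_in:
  assumes "q \<in> space M" "atom \<sigma> (fst z) = atom \<sigma> q" "z \<in> space \<mu>"
  shows "holonomy N \<xi>u (fst z) q z \<in> atom \<xi>u z \<inter> fiber N q"
  unfolding holonomy_def by (rule theI'[OF holonomy_unique[OF assms]])

text \<open>Both points are the image of \<open>x\<close> under the holonomy to their common fiber;
  this is what makes an atom of \<xi>u a graph over the base.\<close>

lemma eq_if_fst_eq:
  assumes "x \<in> space \<mu>" "y \<in> space \<mu>" "atom \<xi>u x = atom \<xi>u y" "fst x = fst y"
  shows "x = y"
  using holonomy_eq[OF assms(1,2,3)] holonomy_eq[OF assms(1,1) refl] assms(4) by simp

text \<open>
  The atoms of \<open>\<xi>u\<close> are graphs over the atoms of \<open>\<sigma>\<close>, hence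
  the atoms of the pullback of \<open>\<xi>u\<close> are those parts of the atoms of \<open>\<xi>u\<close> that lie over
  the atoms of the pullback of \<open>\<sigma>\<close>.
\<close>

lemma \<xi>_F_eq_iff:
  assumes x: "x \<in> space \<mu>" "y \<in> space \<mu>" and eq: "atom \<xi>u x = atom \<xi>u y"
  shows "atom \<xi>u (F x) = atom \<xi>u (F y) \<longleftrightarrow> atom \<sigma> (f (fst x)) = atom \<sigma> (f (fst y))"
proof
  assume "atom \<xi>u (F x) = atom \<xi>u (F y)"
  then show "atom \<sigma> (f (fst x)) = atom \<sigma> (f (fst y))"
    using \<sigma>_eq_if_\<xi>[of "F x" "F y"] x by (simp add: F_space fst_F)
next
  assume "atom \<sigma> (f (fst x)) = atom \<sigma> (f (fst y))"
  then have "f (fst y) \<in> atom \<sigma> (fst (F x))"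
    using atom_self[OF part_\<sigma>, of "f (fst y)"] x by (simp add: f_space fst_space fst_F)
  then have "f (fst y) \<in> fst ` atom \<xi>u (F x)"
    unfolding fst_atom[OF F_space[OF x(1)]] .
  then obtain w where w: "f (fst y) = fst w" "w \<in> atom \<xi>u (F x)" by (rule imageE)
  have ws: "w \<in> space \<mu>" using w(2) atom_subset[OF part_\<xi> F_space[OF x(1)]] by blast
  \<comment> \<open>The atom of \<open>F x\<close> has a point over \<open>f (fst y)\<close>. Its
    preimage lies over \<open>fst y\<close>, since \<open>f\<close> is injective, and in the atom of
    \<open>x\<close>, since \<xi>u is increasing; hence it is \<open>y\<close>.\<close>
  define y' where "y' = Finv w"
  have y': "y' \<in> space \<mu>" "F y' = w" using ws by (auto simp: y'_def Finv_space F_Finv)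
  have "f (fst y') = f (fst y)" using fst_F[OF y'(1)] w(1) y'(2) by simp
  then have "fst y' = fst y" by (rule f_inj[OF fst_space[OF y'(1)] fst_space[OF x(2)]])
  moreover have eqw: "atom \<xi>u w = atom \<xi>u (F x)" by (rule atom_eq[OF part_\<xi> F_space[OF x(1)] w(2)])
  then have "atom \<xi>u y' = atom \<xi>u y" using \<xi>_eq_if_F[OF y'(1) x(1)] y' eq by simp
  ultimately have "y' = y" using x y' by (intro eq_if_fst_eq)
  with y' eqw show "atom \<xi>u (F x) = atom \<xi>u (F y)" by simp
qed

lemma generating:
  assumes "p \<in> space M" "q \<in> space M" "\<And>n. atom \<sigma> ((f ^^ n) p) = atom \<sigma> ((f ^^ n) q)"
  shows "p = q"
proof -
  have fn: "(f ^^ n) r \<in> space M" if "r \<in> space M" for n r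
    by (induction n) (auto simp: that f_space)
  have "(\<Inter>n. atom (pullback M (f ^^ n) \<sigma>) p) \<in> (\<lambda>x. \<Inter>n. atom (pullback M (f ^^ n) \<sigma>) x) ` space M"
    using assms(1) by (rule imageI)
  also have "\<dots> = (\<lambda>x. {x}) ` space M"
    using gen_\<sigma> unfolding generating_partition_def join_def .
  finally obtain y where y: "(\<Inter>n. atom (pullback M (f ^^ n) \<sigma>) p) = {y}" by (rule imageE)
  have in_atoms: "r \<in> (\<Inter>n. atom (pullback M (f ^^ n) \<sigma>) p)"
    if "r \<in> space M" "\<And>n. atom \<sigma> ((f ^^ n) p) = atom \<sigma> ((f ^^ n) r)" for r
  proof (rule INT_I)
    fix n
    have "atom (pullback M (f ^^ n) \<sigma>) p = (f ^^ n) -` atom \<sigma> ((f ^^ n) p) \<inter> space M"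
      by (rule atom_pullback[where h="f ^^ n", OF part_\<sigma> fn[OF assms(1)] assms(1)])
    then show "r \<in> atom (pullback M (f ^^ n) \<sigma>) p"
      unfolding that(2)
      using that(1) atom_self[OF part_\<sigma> fn[OF that(1)]] by simp
  qed
  have "p \<in> {y}" "q \<in> {y}"
    using in_atoms[OF assms(1) refl] in_atoms[OF assms(2,3)] unfolding y .
  then show ?thesis by simp
qed

lemma atom_\<xi>cu: "x \<in> space \<mu> \<Longrightarrow> atom \<xi>cu x = fst -` atom \<sigma> (fst x) \<inter> space \<mu>"
  unfolding \<xi>cu by (subst atom_pullback[OF part_\<sigma>]) (auto simp: space_\<mu>' fst_space)

lemma atom_\<xi>cu_eq_iff:
  assumes "x \<in> space \<mu>" "y \<in> space \<mu>"
  shows "atom \<xi>cu x = atom \<xi>cu y \<longleftrightarrow> atom \<sigma> (fst x) = atom \<sigma> (fst y)"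
proof
  assume "atom \<xi>cu x = atom \<xi>cu y"
  moreover have "x \<in> atom \<xi>cu x"
    using assms atom_self[OF part_\<sigma> fst_space] by (simp add: atom_\<xi>cu)
  ultimately have "fst x \<in> atom \<sigma> (fst y)" using assms by (simp add: atom_\<xi>cu)
  then show "atom \<sigma> (fst x) = atom \<sigma> (fst y)" by (rule atom_eq[OF part_\<sigma> fst_space[OF assms(2)]])
qed (use assms in \<open>simp add: atom_\<xi>cu\<close>)

lemma part_fiber: "partition_on (space \<mu>) (fiber_partition M N)"
proof -
  have "space N \<noteq> {}" using prob_space.not_empty[OF prob_\<mu>] by (auto simp: space_\<mu>)
  then show ?thesis
    by (auto simp: partition_on_def fiber_partition_def fiber_def space_\<mu> disjoint_def)
qed

lemma atom_fiber:
  assumes "x \<in> space \<mu>"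
  shows "atom (fiber_partition M N) x = {y \<in> space \<mu>. fst y = fst x}"
proof -
  have "atom (fiber_partition M N) x = fiber N (fst x)"
    by (rule atom_unique[OF part_fiber]) (use assms in \<open>auto simp: fiber_partition_def fiber_def space_\<mu>\<close>)
  also have "\<dots> = {y \<in> space \<mu>. fst y = fst x}"
    using assms unfolding fiber_def space_\<mu> by (auto simp: mem_Times_iff)
  finally show ?thesis .
qed

lemma binary_coded_\<mu>: "binary_coded \<mu>"
  using binary_coded_pair[OF binary_coded_M binary_coded_N] binary_coded_cong[OF sets_\<mu>] by simp

lemma singleton_sets: "q \<in> space M \<Longrightarrow> {q} \<in> sets M"
proof -
  assume q: "q \<in> space M"
  from binary_coded_imp_separated[OF binary_coded_M] obtain \<phi> :: "'a \<Rightarrow> real"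
    where [measurable]: "\<phi> \<in> borel_measurable M" and inj: "inj_on \<phi> (space M)" by blast
  have "{q} = {p \<in> space M. \<phi> p = \<phi> q}" using q inj by (auto simp: inj_on_def)
  also have "\<dots> \<in> sets M" by measurable
  finally show ?thesis .
qed

lemma fiber_sets: "q \<in> space M \<Longrightarrow> fiber N q \<in> sets \<mu>"
  unfolding fiber_def sets_\<mu> by (intro pair_measureI singleton_sets) auto

text \<open>\<open>P\<close> and \<open>Q\<close> stand for the conditional measures on the fibers
  over \<open>p\<close> and \<open>q\<close>. Holonomies preserve the atoms of \<xi>u, which
  \<open>t\<close> codes on \<open>Y\<close>, so the transport of \<open>P\<close> to
  \<open>Q\<close> amounts to equality of the laws of \<open>t\<close>;
  \<open>level_eq_if_push_forward\<close> and \<open>push_forward_if_distr_eq\<close> are the two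
  implications.\<close>

context
  fixes Y :: "('a \<times> 'b) set" and t :: "'a \<times> 'b \<Rightarrow> real" and P Q :: "('a \<times> 'b) measure" and p q :: 'a
  assumes Y [measurable]: "Y \<in> sets \<mu>" and t [measurable]: "t \<in> borel_measurable \<mu>"
    and code: "\<And>x y. x \<in> Y \<Longrightarrow> y \<in> Y \<Longrightarrow> atom \<xi>u x = atom \<xi>u y \<longleftrightarrow> t x = t y"
    and P: "prob_space P" "sets P = sets \<mu>" and Q: "prob_space Q" "sets Q = sets \<mu>"
    and pq: "p \<in> space M" "q \<in> space M" "atom \<sigma> p = atom \<sigma> q"
    and AE_P: "AE z in P. z \<in> Y \<and> fst z = p" and AE_Q: "AE z in Q. z \<in> Y \<and> fst z = q"
begin

lemma Y_space: "x \<in> Y \<Longrightarrow> x \<in> space \<mu>" using sets.sets_into_space[OF Y] by auto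

lemma space_P: "space P = space \<mu>" and space_Q: "space Q = space \<mu>"
  using sets_eq_imp_space_eq P Q by auto

lemma fiber_restrict: "fiber N p \<inter> space (completion P) = fiber N p" "fiber N p \<in> sets (completion P)"
  using fiber_sets[OF pq(1)] pq(1) P(2) by (auto simp: space_P space_\<mu> fiber_def)

lemma level_eq_if_push_forward:
  assumes push: "push_forward_eq P (fiber N p) (holonomy N \<xi>u p q) E Q"
    and C [measurable]: "C \<in> sets borel"
  shows "emeasure P (t -` C \<inter> space \<mu>) = emeasure Q (t -` C \<inter> space \<mu>)"
proof -
  let ?h = "holonomy N \<xi>u p q" and ?R = "restrict_space (completion P) (fiber N p)"
  have h: "?h \<in> ?R \<rightarrow>\<^sub>M E" and d: "distr ?R E ?h = Q"
    using push unfolding push_forward_eq_def by blast+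
  have spR: "space ?R = fiber N p" using fiber_restrict by (simp add: space_restrict_space)
  have Qe: "emeasure Q B = emeasure (completion P) (?h -` B \<inter> fiber N p)"
    and hB: "?h -` B \<inter> fiber N p \<in> sets (completion P)" if "B \<in> sets \<mu>" for B
  proof -
    have "?h -` B \<inter> fiber N p \<in> sets ?R" using measurable_sets[OF h, of B] that by (simp add: sets_\<mu> spR)
    then show "?h -` B \<inter> fiber N p \<in> sets (completion P)"
      using fiber_restrict by (subst (asm) sets_restrict_space_iff) auto
    have "emeasure Q B = emeasure ?R (?h -` B \<inter> fiber N p)"
      using that h by (subst d[symmetric], subst emeasure_distr) (auto simp: sets_\<mu> spR)
    also have "\<dots> = emeasure (completion P) (?h -` B \<inter> fiber N p)"
      using fiber_restrict by (intro emeasure_restrict_space) auto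
    finally show "emeasure Q B = emeasure (completion P) (?h -` B \<inter> fiber N p)" .
  qed
  \<comment> \<open>The code is known to be constant along the holonomy only where both end points
    lie in \<open>Y\<close>. Almost all starting points do; the images do because their law is
    \<open>Q\<close>, which gives full mass to \<open>Y\<close>.\<close>
  have "emeasure Q (space \<mu> - Y) = 0"
    using AE_Q by (subst AE_iff_measurable[symmetric, where P="\<lambda>x. x \<in> Y"]) (auto simp: Q space_Q elim: eventually_mono)
  then have "?h -` (space \<mu> - Y) \<inter> fiber N p \<in> null_sets (completion P)"
    using Qe[of "space \<mu> - Y"] hB[of "space \<mu> - Y"] by (auto simp: null_sets_def)
  then have "AE z in completion P. z \<notin> ?h -` (space \<mu> - Y) \<inter> fiber N p" by (rule AE_not_in)
  moreover have "AE z in completion P. z \<in> Y \<and> fst z = p" by (rule AE_completion[OF AE_P])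
  ultimately have AE: "AE z in completion P. z \<in> t -` C \<inter> space \<mu> \<longleftrightarrow> z \<in> ?h -` (t -` C \<inter> space \<mu>) \<inter> fiber N p"
  proof eventually_elim
    case (elim z)
    have zs: "z \<in> space \<mu>" using elim(2) Y_space by blast
    then have z: "z \<in> space \<mu>" "fst z = p" "z \<in> fiber N p"
      using elim(2) pq(1) by (auto simp: fiber_def space_\<mu> mem_Times_iff)
    have hz: "?h z \<in> atom \<xi>u z \<inter> fiber N q" using holonomy_in[of q z] z pq by simp
    then have hs: "?h z \<in> space \<mu>" using pq by (auto simp: fiber_def space_\<mu>)
    with elim z have "?h z \<in> Y" by auto
    moreover have "atom \<xi>u (?h z) = atom \<xi>u z" using hz by (intro atom_eq[OF part_\<xi> z(1)]) auto
    ultimately have "t (?h z) = t z" using code elim by blast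
    with z hs show ?case by auto
  qed
  have "emeasure P (t -` C \<inter> space \<mu>) = emeasure (completion P) (t -` C \<inter> space \<mu>)"
    by (subst emeasure_completion) (auto simp: P)
  also have "\<dots> = emeasure (completion P) (?h -` (t -` C \<inter> space \<mu>) \<inter> fiber N p)"
  proof (rule emeasure_eq_AE[OF AE])
    show "t -` C \<inter> space \<mu> \<in> sets (completion P)" by (rule sets_completionI_sets) (simp add: P)
    show "?h -` (t -` C \<inter> space \<mu>) \<inter> fiber N p \<in> sets (completion P)" by (rule hB) simp
  qed
  also have "\<dots> = emeasure Q (t -` C \<inter> space \<mu>)" by (rule Qe[symmetric]) simp
  finally show ?thesis .
qed

text \<open>
  The code \<open>t\<close> is injective on \<open>Y\<close> intersected with a fiber, and disintegrating \<open>Q\<close> over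
  \<open>t\<close> into point masses yields a Borel inverse \<open>j\<close> of \<open>t\<close>; the holonomy is almost everywhere
  equal to the composition of \<open>j\<close> and \<open>t\<close>.
\<close>

lemma push_forward_if_distr_eq:
  assumes eq: "distr P borel t = distr Q borel t"
  shows "push_forward_eq P (fiber N p) (holonomy N \<xi>u p q) E Q"
proof -
  let ?h = "holonomy N \<xi>u p q"
  have tP: "t \<in> P \<rightarrow>\<^sub>M borel" and tQ: "t \<in> Q \<rightarrow>\<^sub>M borel"
    using t measurable_cong_sets[OF P(2) refl] measurable_cong_sets[OF Q(2) refl] by blast+
  have "binary_coded Q" using binary_coded_\<mu> binary_coded_cong[OF Q(2)] by simp
  from disintegration_exists[OF Q(1) this tQ real_separated] obtain K where "disintegration Q borel t K" ..
  then interpret K: disintegration Q borel t K .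
  from binary_coded_imp_retract[OF binary_coded_\<mu>] obtain \<phi> :: "'a \<times> 'b \<Rightarrow> real" and g
    where \<phi> [measurable]: "\<phi> \<in> borel_measurable \<mu>" and g [measurable]: "g \<in> borel \<rightarrow>\<^sub>M \<mu>"
      and g\<phi>: "\<And>x. x \<in> space \<mu> \<Longrightarrow> g (\<phi> x) = x" and \<phi>0: "\<And>x. 0 \<le> \<phi> x" by blast
  \<comment> \<open>Under a point mass at \<open>w\<close> the mean of the code
    \<open>\<phi>\<close> is \<open>\<phi> w\<close>, from which \<open>g\<close> recovers
    \<open>w\<close>; taking the mean makes \<open>j\<close> a total Borel function.\<close>
  define j where "j y = g (enn2real (\<integral>\<^sup>+z. ennreal (\<phi> z) \<partial>K y))" for y
  have \<phi>Q: "(\<lambda>z. ennreal (\<phi> z)) \<in> borel_measurable Q"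
  proof -
    have "(\<lambda>z. ennreal (\<phi> z)) \<in> borel_measurable \<mu>" by measurable
    then show ?thesis using measurable_cong_sets[OF Q(2) refl] by blast
  qed
  have "(\<lambda>y. \<integral>\<^sup>+z. ennreal (\<phi> z) \<partial>K y) \<in> borel_measurable borel"
    by (rule measurable_compose[OF K.measurable_K_subprob nn_integral_measurable_subprob_algebra[OF \<phi>Q]])
  then have "(\<lambda>y. enn2real (\<integral>\<^sup>+z. ennreal (\<phi> z) \<partial>K y)) \<in> borel_measurable borel"
    by (rule borel_measurable_enn2real)
  then have j [measurable]: "j \<in> borel \<rightarrow>\<^sub>M \<mu>" unfolding j_def by (rule measurable_compose[OF _ g])
  have "AE w in Q. AE z in K (t w). z = w"
  proof (rule K.AE_disint_const[OF AE_Q])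
    fix w z assume wz: "w \<in> Y \<and> fst w = q" "z \<in> Y \<and> fst z = q" "t z = t w"
    then have "atom \<xi>u z = atom \<xi>u w" using code by blast
    with wz show "z = w" using Y_space by (intro eq_if_fst_eq) auto
  qed
  then have AE_j: "AE w in Q. j (t w) = w"
    using AE_space
  proof eventually_elim
    case (elim w)
    interpret Kw: prob_space "K (t w)" by (rule K.K_prob_space) simp
    have "(\<integral>\<^sup>+z. ennreal (\<phi> z) \<partial>K (t w)) = (\<integral>\<^sup>+z. ennreal (\<phi> w) \<partial>K (t w))"
      using elim(1) by (intro nn_integral_cong_AE) (auto elim: eventually_mono)
    then have "(\<integral>\<^sup>+z. ennreal (\<phi> z) \<partial>K (t w)) = ennreal (\<phi> w)" by (simp add: Kw.emeasure_space_1)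
    then show ?case using elim(2) g\<phi> \<phi>0 by (simp add: j_def space_Q)
  qed
  \<comment> \<open>This condition involves \<open>w\<close> only through \<open>t w\<close>, so it
    passes from \<open>Q\<close> to \<open>P\<close> by way of the common law of
    \<open>t\<close>.\<close>
  have "AE w in Q. j (t w) \<in> Y \<and> fst (j (t w)) = q \<and> t (j (t w)) = t w"
    using AE_j AE_Q by eventually_elim auto
  moreover have jm: "{y \<in> space borel. j y \<in> Y \<and> fst (j y) = q \<and> t (j y) = y} \<in> sets borel"
  proof -
    have "{y \<in> space borel. j y \<in> Y \<and> fst (j y) \<in> {q} \<and> t (j y) = y} \<in> sets borel"
      using singleton_sets[OF pq(2)] by measurable
    then show ?thesis by simp
  qed
  ultimately have "AE y in distr Q borel t. j y \<in> Y \<and> fst (j y) = q \<and> t (j y) = y"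
    by (subst AE_distr_iff[OF tQ jm])
  then have "AE z in P. j (t z) \<in> Y \<and> fst (j (t z)) = q \<and> t (j (t z)) = t z"
    unfolding eq[symmetric] by (subst (asm) AE_distr_iff[OF tP jm])
  with AE_P have hj: "AE z in P. j (t z) = ?h z"
  proof eventually_elim
    case (elim z)
    then have "atom \<xi>u z = atom \<xi>u (j (t z))" using code[of z "j (t z)"] by simp
    then show ?case using holonomy_eq[of z "j (t z)"] elim Y_space by simp
  qed
  \<comment> \<open>Off the fiber over \<open>p\<close> the holonomy has no controlled value;
    replacing it there by \<open>j (t z)\<close> gives a map into the space that is defined
    everywhere and agrees almost everywhere with a Borel map.\<close>
  define h' where "h' z = (if z \<in> fiber N p then ?h z else j (t z))" for z
  have hj': "AE z in P. j (t z) = h' z"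
    using hj by eventually_elim (simp add: h'_def)
  have jt: "(\<lambda>z. j (t z)) \<in> P \<rightarrow>\<^sub>M E"
  proof -
    have "(\<lambda>z. j (t z)) \<in> \<mu> \<rightarrow>\<^sub>M \<mu>" by measurable
    then show ?thesis using measurable_cong_sets[OF P(2) sets_\<mu>[symmetric]] by blast
  qed
  have h_space: "?h z \<in> space \<mu>" if "z \<in> fiber N p" for z
  proof -
    have "z \<in> space \<mu>" "fst z = p" using that pq(1) by (auto simp: fiber_def space_\<mu>)
    then have "?h z \<in> fiber N q" using holonomy_in[of q z] pq by simp
    then show ?thesis using pq(2) by (auto simp: fiber_def space_\<mu>)
  qed
  have h': "h' \<in> completion P \<rightarrow>\<^sub>M E"
  proof (rule measurable_completion_cong_AE[OF jt hj'])
    show "h' \<in> space P \<rightarrow> space E"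
      using measurable_space[OF jt] h_space by (auto simp: h'_def space_\<mu>')
  qed
  let ?R = "restrict_space (completion P) (fiber N p)"
  have spR: "space ?R = fiber N p" using fiber_restrict by (simp add: space_restrict_space)
  have "h' \<in> ?R \<rightarrow>\<^sub>M E" by (rule measurable_restrict_space1[OF h'])
  then have h: "?h \<in> ?R \<rightarrow>\<^sub>M E"
    by (rule measurable_cong[THEN iffD1, rotated]) (simp add: spR h'_def)
  have "distr ?R E ?h = Q"
  proof (rule measure_eqI)
    fix B assume "B \<in> sets (distr ?R E ?h)"
    then have B: "B \<in> sets E" by simp
    have hB: "?h -` B \<inter> fiber N p \<in> sets (completion P)"
      using measurable_sets[OF h B] fiber_restrict by (simp add: spR sets_restrict_space_iff)
    have jB: "(\<lambda>z. j (t z)) -` B \<inter> space P \<in> sets P" by (rule measurable_sets[OF jt B])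
    have "emeasure (distr ?R E ?h) B = emeasure ?R (?h -` B \<inter> fiber N p)"
      using h B by (simp add: emeasure_distr spR)
    also have "\<dots> = emeasure (completion P) (?h -` B \<inter> fiber N p)"
      using fiber_restrict by (intro emeasure_restrict_space) auto
    also have "\<dots> = emeasure (completion P) ((\<lambda>z. j (t z)) -` B \<inter> space P)"
    proof (rule emeasure_eq_AE[OF _ hB])
      show "AE z in completion P. z \<in> ?h -` B \<inter> fiber N p \<longleftrightarrow> z \<in> (\<lambda>z. j (t z)) -` B \<inter> space P"
        using AE_completion[OF hj] AE_completion[OF AE_P]
        by eventually_elim (use Y_space pq in \<open>auto simp: fiber_def space_P space_\<mu> mem_Times_iff\<close>)
    qed (use jB in auto)
    also have "\<dots> = emeasure P (t -` (j -` B) \<inter> space P)" using jB by (simp add: vimage_def)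
    also have "\<dots> = emeasure (distr P borel t) (j -` B)"
      using tP measurable_sets[OF j, of B] B by (subst emeasure_distr) (auto simp: sets_\<mu>)
    also have "\<dots> = emeasure Q (t -` (j -` B) \<inter> space Q)"
      unfolding eq using tQ measurable_sets[OF j, of B] B by (subst emeasure_distr) (auto simp: sets_\<mu>)
    also have "\<dots> = emeasure Q B"
    proof (rule emeasure_eq_AE)
      show "AE z in Q. z \<in> t -` (j -` B) \<inter> space Q \<longleftrightarrow> z \<in> B"
        using AE_j AE_space by eventually_elim auto
      show "t -` (j -` B) \<inter> space Q \<in> sets Q"
        using measurable_sets[OF tQ, of "j -` B"] measurable_sets[OF j, of B] B by (simp add: sets_\<mu>)
      show "B \<in> sets Q" using B by (simp add: Q sets_\<mu>)
    qed
    finally show "emeasure (distr ?R E ?h) B = emeasure Q B" .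
  qed (simp add: Q sets_\<mu>)
  with h show ?thesis by (simp add: push_forward_eq_def)
qed

end

end

section \<open>The entropy inequality\<close>

lemma nn_integral_indicator_vimage:
  assumes g: "g \<in> P \<rightarrow>\<^sub>M L" and C: "C \<in> sets L"
  shows "(\<integral>\<^sup>+z. indicator C (g z) \<partial>P) = emeasure P (g -` C \<inter> space P)"
proof -
  have "(\<integral>\<^sup>+z. indicator C (g z) \<partial>P) = (\<integral>\<^sup>+z. indicator (g -` C \<inter> space P) z \<partial>P)"
    by (intro nn_integral_cong) (auto split: split_indicator)
  also have "\<dots> = emeasure P (g -` C \<inter> space P)"
    by (rule nn_integral_indicator[OF measurable_sets[OF g C]])
  finally show ?thesis .
qed

context disintegration
begin

lemma measurable_K: "g \<in> \<mu> \<rightarrow>\<^sub>M M' \<Longrightarrow> y \<in> space L \<Longrightarrow> g \<in> K y \<rightarrow>\<^sub>M M'"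
  using measurable_cong_sets[OF sets_K refl] by blast

lemma emeasure_vimage_Int:
  assumes B: "B \<in> sets \<mu>" and D: "D \<in> sets L"
  shows "emeasure \<mu> (t -` D \<inter> B) = (\<integral>\<^sup>+x. indicator D (t x) * indicator B x \<partial>\<mu>)"
proof -
  have "(\<integral>\<^sup>+x. indicator D (t x) * indicator B x \<partial>\<mu>)
      = (\<integral>\<^sup>+x. indicator D (t x) * (\<integral>\<^sup>+z. indicator B z \<partial>K (t x)) \<partial>\<mu>)"
    using B D by (intro nn_integral_disint) auto
  also have "\<dots> = (\<integral>\<^sup>+x. indicator D (t x) * emeasure (K (t x)) B \<partial>\<mu>)"
  proof (rule nn_integral_cong)
    fix x assume "x \<in> space \<mu>"
    then have "B \<in> sets (K (t x))" using B sets_K[OF t_space] by simp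
    then show "indicator D (t x) * (\<integral>\<^sup>+z. indicator B z \<partial>K (t x)) = indicator D (t x) * emeasure (K (t x)) B"
      by (simp only: nn_integral_indicator)
  qed
  finally show ?thesis using disint[OF B D] by simp
qed

text \<open>Meant for factors such as those in \<open>s (fst x)\<close> under \<open>Kx\<close>,
  which are constant on almost every level set of \<open>t\<close> without being given as functions
  of \<open>t\<close>.\<close>

lemma nn_integral_disint_const:
  assumes g [measurable]: "g \<in> borel_measurable \<mu>" and k [measurable]: "k \<in> borel_measurable \<mu>"
    and const: "AE x in \<mu>. AE z in K (t x). g z = g x"
  shows "(\<integral>\<^sup>+x. g x * k x \<partial>\<mu>) = (\<integral>\<^sup>+x. g x * (\<integral>\<^sup>+z. k z \<partial>K (t x)) \<partial>\<mu>)"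
proof -
  have "(\<integral>\<^sup>+x. g x * k x \<partial>\<mu>) = (\<integral>\<^sup>+x. (\<integral>\<^sup>+z. g z * k z \<partial>K (t x)) \<partial>\<mu>)"
    by (rule nn_integral_disint') measurable
  also have "\<dots> = (\<integral>\<^sup>+x. g x * (\<integral>\<^sup>+z. k z \<partial>K (t x)) \<partial>\<mu>)"
    proof (rule nn_integral_cong_AE, use AE_space const in eventually_elim)
    case (elim x)
    have "(\<integral>\<^sup>+z. g z * k z \<partial>K (t x)) = (\<integral>\<^sup>+z. g x * k z \<partial>K (t x))"
      using elim(2) by (intro nn_integral_cong_AE) (auto elim: eventually_mono)
    also have "\<dots> = g x * (\<integral>\<^sup>+z. k z \<partial>K (t x))"
      by (rule nn_integral_cmult[OF measurable_K[OF k t_space[OF elim(1)]]])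
    finally show ?case .
  qed
  finally show ?thesis .
qed

end

text \<open>Atoms of \<beta> may fail to be Borel, but up to null sets of almost every conditional
  measure they agree with level sets of a Borel function, and only their masses enter the
  entropy.\<close>

lemma (in coded_partition) cond_entropy_level:
  assumes g [measurable]: "g \<in> borel_measurable \<mu>"
    and level: "AE x in \<mu>. AE z in K (t x). z \<in> atom \<beta> x \<longleftrightarrow> g z = (g x :: real)"
    and sub: "\<And>x. x \<in> space \<mu> \<Longrightarrow> atom \<beta> x \<subseteq> space \<mu>"
  shows "cond_entropy \<mu> \<beta> \<alpha> = (\<integral>\<^sup>+x. neg_log (measure (K (t x)) {z \<in> space \<mu>. g z = g x}) \<partial>\<mu>)"
  unfolding cond_entropy_def proof (rule nn_integral_cong_AE, use AE_space level AE_cond_measure in eventually_elim)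
  case (elim x)
  note tx = t_space[OF elim(1)]
  have "measure (completion (K (t x))) (atom \<beta> x) = measure (K (t x)) {z \<in> space \<mu>. g z = g x}"
  proof (rule measure_completion_eqI)
    show "AE z in K (t x). z \<in> atom \<beta> x \<longleftrightarrow> z \<in> {z \<in> space \<mu>. g z = g x}"
      using elim(2) AE_space by eventually_elim (simp add: space_K[OF tx])
    show "atom \<beta> x \<subseteq> space (K (t x))" using sub[OF elim(1)] by (simp add: space_K[OF tx])
    show "{z \<in> space \<mu>. g z = g x} \<in> sets (K (t x))" unfolding sets_K[OF tx] by measurable
  qed
  then show ?case by (simp only: elim(3))
qed

text \<open>The four kernels condition on \<sigma> (\<open>Km\<close>), on \<xi>u
  (\<open>Kx\<close>), on the fibers (\<open>Kc\<close>) and on \<xi>cu (\<open>Kcu\<close>). The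
  last one uses the code of \<sigma> at the base point.\<close>

locale coded_setting = holonomy_setting M N m \<mu> f F \<sigma> \<xi>cu \<xi>u +
  sg: coded_partition m "borel :: real measure" s Km \<sigma> X +
  xi: coded_partition \<mu> "borel :: real measure" t Kx \<xi>u Y +
  c: coded_partition \<mu> M fst Kc "fiber_partition M N" "space \<mu>" +
  cu: disintegration \<mu> "borel :: real measure" "\<lambda>x. s (fst x)" Kcu
  for M :: "'a measure" and N :: "'b measure" and m \<mu> f F \<sigma> \<xi>cu \<xi>u
    and s :: "'a \<Rightarrow> real" and Km X and t :: "'a \<times> 'b \<Rightarrow> real" and Kx Y Kc Kcu
begin

abbreviation over :: "'a set \<Rightarrow> ('a \<times> 'b) set" where
  "over B \<equiv> fst -` B \<inter> space \<mu>"

abbreviation level :: "real set \<Rightarrow> ('a \<times> 'b) set" where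
  "level C \<equiv> t -` C \<inter> space \<mu>"

lemma s_measurable [measurable]: "s \<in> borel_measurable M"
  using sg.t measurable_cong_sets[OF sets_m refl] by blast

lemma AE_X: "AE x in \<mu>. fst x \<in> X" by (rule AE_fst[OF sg.X_full])

lemma AE_fX: "AE p in m. f p \<in> X" by (rule AE_f[OF sg.X_full])

lemma s_eq_if_t_eq:
  assumes "x \<in> Y" "z \<in> Y" "fst x \<in> X" "fst z \<in> X" "t z = t x"
  shows "s (fst z) = s (fst x)"
proof -
  have "atom \<xi>u z = atom \<xi>u x" using xi.atom_eq_iff_code[OF assms(2,1)] assms(5) by blast
  then have "atom \<sigma> (fst z) = atom \<sigma> (fst x)"
    by (rule \<sigma>_eq_if_\<xi>[OF xi.X_space[OF assms(2)] xi.X_space[OF assms(1)]])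
  then show ?thesis using sg.atom_eq_iff_code[OF assms(4,3)] by blast
qed

lemma AE_s_const: "AE x in \<mu>. AE z in Kx (t x). s (fst z) = s (fst x)"
proof (rule xi.AE_disint_const)
  show "AE x in \<mu>. x \<in> Y \<and> fst x \<in> X" using xi.X_full AE_X by eventually_elim (rule conjI)
qed (use s_eq_if_t_eq in blast)

definition "u p = measure (Km (s p)) {q \<in> space m. s (f q) = s (f p)}"

definition "v x = measure (Kx (t x)) {z \<in> space \<mu>. s (f (fst z)) = s (f (fst x))}"

text \<open>The law of the code of the atom of \<open>f\<^sup>-\<^sup>1 \<sigma>\<close> given
  \<sigma>; \<open>nu\<close> is its law given \<xi>u. Since \<open>u\<close> and \<open>v\<close>
  are point masses of these laws, comparing entropies becomes comparing two measures on the
  line.\<close>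

definition "rho c = distr (Km c) borel (\<lambda>q. s (f q))"

definition "nu c = distr (Kx c) borel (\<lambda>z. s (f (fst z)))"

lemma sf_measurable [measurable]: "(\<lambda>q. s (f q)) \<in> borel_measurable m" by measurable

lemma sff_measurable [measurable]: "(\<lambda>z. s (f (fst z))) \<in> borel_measurable \<mu>"
  by measurable

lemma sf_Km: "(\<lambda>q. s (f q)) \<in> borel_measurable (Km c)"
  by (rule sg.measurable_K[OF sf_measurable]) simp

lemma sff_Kx: "(\<lambda>z. s (f (fst z))) \<in> borel_measurable (Kx c)"
  by (rule xi.measurable_K[OF sff_measurable]) simp

lemma rho: "prob_space (rho c)" "sets (rho c) = sets borel"
  unfolding rho_def by (rule prob_space.prob_space_distr[OF sg.K_prob_space sf_Km]) simp_all

lemma nu: "prob_space (nu c)" "sets (nu c) = sets borel"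
  unfolding nu_def by (rule prob_space.prob_space_distr[OF xi.K_prob_space sff_Kx]) simp_all

lemma nn_integral_nu:
  "r \<in> borel_measurable borel \<Longrightarrow> (\<integral>\<^sup>+y. r y \<partial>nu c) = (\<integral>\<^sup>+z. r (s (f (fst z))) \<partial>Kx c)"
  unfolding nu_def by (rule nn_integral_distr[OF sff_Kx]) simp

lemma rho_atom: "emeasure (rho (s p)) {s (f p)} = ennreal (u p)"
proof -
  interpret prob_space "Km (s p)" by (rule sg.K_prob_space) simp
  have sp: "space (Km (s p)) = space m" by (rule sg.space_K) simp
  have "emeasure (rho (s p)) {s (f p)} = emeasure (Km (s p)) ((\<lambda>q. s (f q)) -` {s (f p)} \<inter> space (Km (s p)))"
    unfolding rho_def by (rule emeasure_distr[OF sf_Km]) simp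
  also have "(\<lambda>q. s (f q)) -` {s (f p)} \<inter> space (Km (s p)) = {q \<in> space m. s (f q) = s (f p)}"
    unfolding sp by auto
  finally show ?thesis by (simp add: u_def emeasure_eq_measure)
qed

lemma nu_atom: "emeasure (nu (t x)) {s (f (fst x))} = ennreal (v x)"
proof -
  interpret prob_space "Kx (t x)" by (rule xi.K_prob_space) simp
  have sp: "space (Kx (t x)) = space \<mu>" by (rule xi.space_K) simp
  have "emeasure (nu (t x)) {s (f (fst x))}
      = emeasure (Kx (t x)) ((\<lambda>z. s (f (fst z))) -` {s (f (fst x))} \<inter> space (Kx (t x)))"
    unfolding nu_def by (rule emeasure_distr[OF sff_Kx]) simp
  also have "(\<lambda>z. s (f (fst z))) -` {s (f (fst x))} \<inter> space (Kx (t x)) = {z \<in> space \<mu>. s (f (fst z)) = s (f (fst x))}"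
    unfolding sp by auto
  finally show ?thesis by (simp add: v_def emeasure_eq_measure)
qed

lemma rho_atom': "s (fst z) = s (fst x) \<Longrightarrow> emeasure (rho (s (fst x))) {s (f (fst z))} = ennreal (u (fst z))"
  using rho_atom[of "fst z"] by simp

lemma nu_atom': "t z = t x \<Longrightarrow> emeasure (nu (t x)) {s (f (fst z))} = ennreal (v z)"
  using nu_atom[of z] by simp

lemma u_measurable [measurable]: "u \<in> borel_measurable M"
proof -
  have "u \<in> borel_measurable m"
    unfolding u_def[abs_def] by (rule sg.measurable_K_level[OF sf_measurable])
  then show ?thesis using measurable_cong_sets[OF sets_m refl] by blast
qed

lemma v_measurable [measurable]: "v \<in> borel_measurable \<mu>"
  unfolding v_def[abs_def] by (rule xi.measurable_K_level[OF sff_measurable])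

lemma u_bounds: "0 \<le> u p" "u p \<le> 1"
proof -
  interpret prob_space "Km (s p)" by (rule sg.K_prob_space) simp
  show "0 \<le> u p" "u p \<le> 1" by (simp_all add: u_def)
qed

lemma v_bounds: "0 \<le> v x" "v x \<le> 1"
proof -
  interpret prob_space "Kx (t x)" by (rule xi.K_prob_space) simp
  show "0 \<le> v x" "v x \<le> 1" by (simp_all add: v_def)
qed

section \<open>The two entropies as integrals and their comparison\<close>

lemma entropy_base: "partition_entropy m f \<sigma> = (\<integral>\<^sup>+x. neg_log (u (fst x)) \<partial>\<mu>)"
proof -
  have atom: "atom (pullback m f \<sigma>) p = f -` atom \<sigma> (f p) \<inter> space m" if "p \<in> space m" for p
    using that by (intro atom_pullback[OF part_\<sigma>]) (simp_all add: space_m f_space)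
  have "partition_entropy m f \<sigma> = (\<integral>\<^sup>+p. neg_log (u p) \<partial>m)"
    unfolding partition_entropy_def u_def
  proof (rule sg.cond_entropy_level[OF sf_measurable])
    show "AE p in m. AE q in Km (s p). q \<in> atom (pullback m f \<sigma>) p \<longleftrightarrow> s (f q) = s (f p)"
    proof (rule sg.AE_disint_const[OF AE_fX])
      fix p q assume X: "f p \<in> X" "f q \<in> X" and sp: "p \<in> space m" "q \<in> space m"
      have "q \<in> atom (pullback m f \<sigma>) p \<longleftrightarrow> f q \<in> atom \<sigma> (f p)"
        unfolding atom[OF sp(1)] using sp by simp
      also have "\<dots> \<longleftrightarrow> atom \<sigma> (f p) = atom \<sigma> (f q)"
        by (rule atom_eq_iff[OF part_\<sigma>, symmetric]) (use sp in \<open>simp_all add: space_m f_space\<close>)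
      also have "\<dots> \<longleftrightarrow> s (f q) = s (f p)"
        unfolding sg.atom_eq_iff_code[OF X] by (rule eq_commute)
      finally show "q \<in> atom (pullback m f \<sigma>) p \<longleftrightarrow> s (f q) = s (f p)" .
    qed
  qed (use atom in auto)
  also have "\<dots> = (\<integral>\<^sup>+x. neg_log (u (fst x)) \<partial>\<mu>)"
    by (rule nn_integral_fst) measurable
  finally show ?thesis .
qed

lemma entropy_total: "partition_entropy \<mu> F \<xi>u = (\<integral>\<^sup>+x. neg_log (v x) \<partial>\<mu>)"
proof -
  have atom: "atom (pullback \<mu> F \<xi>u) x = F -` atom \<xi>u (F x) \<inter> space \<mu>" if "x \<in> space \<mu>" for x
    by (rule atom_pullback[where h=F, OF part_\<xi> F_space[OF that] that])
  show ?thesis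
    unfolding partition_entropy_def v_def
  proof (rule xi.cond_entropy_level[OF sff_measurable])
    show "AE x in \<mu>. AE z in Kx (t x). z \<in> atom (pullback \<mu> F \<xi>u) x \<longleftrightarrow> s (f (fst z)) = s (f (fst x))"
    proof (rule xi.AE_disint_const)
      show "AE x in \<mu>. x \<in> Y \<and> f (fst x) \<in> X"
        using xi.X_full AE_fst[OF AE_fX] by eventually_elim (rule conjI)
      fix x z assume x: "x \<in> Y \<and> f (fst x) \<in> X" and z: "z \<in> Y \<and> f (fst z) \<in> X"
        and sp: "x \<in> space \<mu>" "z \<in> space \<mu>" and tz: "t z = t x"
      have eq: "atom \<xi>u x = atom \<xi>u z" using xi.atom_eq_iff_code[of x z] x z tz by simp
      have "z \<in> atom (pullback \<mu> F \<xi>u) x \<longleftrightarrow> F z \<in> atom \<xi>u (F x)"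
        unfolding atom[OF sp(1)] using sp by simp
      also have "\<dots> \<longleftrightarrow> atom \<xi>u (F x) = atom \<xi>u (F z)"
        by (rule atom_eq_iff[OF part_\<xi> F_space[OF sp(1)] F_space[OF sp(2)], symmetric])
      also have "\<dots> \<longleftrightarrow> atom \<sigma> (f (fst x)) = atom \<sigma> (f (fst z))"
        by (rule \<xi>_F_eq_iff[OF sp eq])
      also have "\<dots> \<longleftrightarrow> s (f (fst z)) = s (f (fst x))"
        unfolding sg.atom_eq_iff_code[OF conjunct2[OF x] conjunct2[OF z]] by (rule eq_commute)
      finally show "z \<in> atom (pullback \<mu> F \<xi>u) x \<longleftrightarrow> s (f (fst z)) = s (f (fst x))" .
    qed
  qed (use atom in auto)
qed

text \<open>A finite integral of the logarithm forces \<open>u\<close> to be positive almost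
  everywhere. Seen inside almost every conditional measure of \<xi>u, this puts \<open>nu\<close> on
  the countably many atoms of \<open>rho\<close>; so \<open>nu\<close> is purely atomic, and its
  masses \<open>v\<close> are positive too.\<close>

lemma AE_atoms:
  assumes fin: "partition_entropy m f \<sigma> < \<infinity>"
  shows "AE x in \<mu>. u (fst x) \<noteq> 0"
    and "AE x in \<mu>. AE y in nu (t x). emeasure (nu (t x)) {y} \<noteq> 0"
    and "AE x in \<mu>. v x \<noteq> 0"
proof -
  have "AE x in \<mu>. neg_log (u (fst x)) \<noteq> \<infinity>"
    using fin unfolding entropy_base by (intro nn_integral_PInf_AE) auto
  then show u: "AE x in \<mu>. u (fst x) \<noteq> 0"
    by eventually_elim (auto simp: neg_log_def)
  have "AE x in \<mu>. AE z in Kx (t x). emeasure (rho (s (fst x))) {s (f (fst z))} \<noteq> 0"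
    using AE_s_const xi.AE_disint[OF u]
  proof eventually_elim
    case (elim x)
    then show ?case
    proof eventually_elim
      case (elim z)
      then show ?case using u_bounds[of "fst z"] by (simp add: rho_atom' ennreal_eq_0_iff)
    qed
  qed
  then show nu0: "AE x in \<mu>. AE y in nu (t x). emeasure (nu (t x)) {y} \<noteq> 0"
  proof eventually_elim
    case (elim x)
    have "{y \<in> space borel. emeasure (rho (s (fst x))) {y} \<noteq> 0} \<in> sets borel"
      using measurable_emeasure_singleton[OF rho, of "s (fst x)"] by measurable
    with elim have "AE y in nu (t x). emeasure (rho (s (fst x))) {y} \<noteq> 0"
      unfolding nu_def by (subst AE_distr_iff[OF sff_Kx])
    then show ?case by (rule AE_atom_if_AE_atom[OF nu rho(1)])
  qed
  have "AE x in \<mu>. AE z in Kx (t x). v z \<noteq> 0"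
    using nu0 xi.AE_const
  proof eventually_elim
    case (elim x)
    have "{y \<in> space borel. emeasure (nu (t x)) {y} \<noteq> 0} \<in> sets borel"
      using measurable_emeasure_singleton[OF nu, of "t x"] by measurable
    with elim(1) have "AE z in Kx (t x). emeasure (nu (t x)) {s (f (fst z))} \<noteq> 0"
      by (subst (asm) nu_def) (simp only: AE_distr_iff[OF sff_Kx])
    with elim(2) show ?case
    proof eventually_elim
      case (elim z)
      then show ?case using v_bounds[of z] by (simp add: nu_atom' ennreal_eq_0_iff)
    qed
  qed
  then show "AE x in \<mu>. v x \<noteq> 0"
    by (rule xi.AE_if_AE_disint[rotated]) measurable
qed

text \<open>Integrating over one atom of \<xi>u at a time turns the quotient into a ratio of point
  masses of \<open>rho\<close> and \<open>nu\<close>, integrated against \<open>nu\<close>; this is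
  at most the total mass of \<open>rho\<close>.\<close>

lemma nn_integral_ratio_le:
  assumes fin: "partition_entropy m f \<sigma> < \<infinity>"
  shows "(\<integral>\<^sup>+x. ennreal (u (fst x)) / ennreal (v x) \<partial>\<mu>) \<le> 1"
proof -
  have "(\<integral>\<^sup>+x. ennreal (u (fst x)) / ennreal (v x) \<partial>\<mu>)
      = (\<integral>\<^sup>+x. (\<integral>\<^sup>+z. ennreal (u (fst z)) / ennreal (v z) \<partial>Kx (t x)) \<partial>\<mu>)"
    by (rule xi.nn_integral_disint') measurable
  also have "\<dots> \<le> (\<integral>\<^sup>+x. 1 \<partial>\<mu>)"
    proof (rule nn_integral_mono_AE, use AE_s_const xi.AE_const AE_atoms(2)[OF fin] in eventually_elim)
    case (elim x)
    let ?r = "\<lambda>y. emeasure (rho (s (fst x))) {y} / emeasure (nu (t x)) {y}"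
    have [measurable]: "?r \<in> borel_measurable borel"
      by (intro borel_measurable_divide_ennreal measurable_emeasure_singleton[OF rho] measurable_emeasure_singleton[OF nu])
    have "(\<integral>\<^sup>+z. ennreal (u (fst z)) / ennreal (v z) \<partial>Kx (t x)) = (\<integral>\<^sup>+z. ?r (s (f (fst z))) \<partial>Kx (t x))"
      proof (rule nn_integral_cong_AE, use elim(1,2) in eventually_elim)
      case (elim z)
      then show ?case by (simp add: rho_atom' nu_atom')
    qed
    also have "\<dots> = (\<integral>\<^sup>+y. 1 * ?r y \<partial>nu (t x))"
      using nn_integral_nu[of ?r "t x"] by simp
    also have "\<dots> \<le> (\<integral>\<^sup>+y. 1 \<partial>rho (s (fst x)))"
      by (rule nn_integral_atom_ratio_le[OF nu rho elim(3)]) simp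
    also have "\<dots> = 1" using prob_space.emeasure_space_1[OF rho(1)] by simp
    finally show "(\<integral>\<^sup>+z. ennreal (u (fst z)) / ennreal (v z) \<partial>Kx (t x)) \<le> 1" .
  qed
  also have "\<dots> = 1" using prob_space.emeasure_space_1[OF prob_\<mu>] by simp
  finally show ?thesis .
qed

lemma entropy_le_aux:
  assumes fin: "partition_entropy m f \<sigma> < \<infinity>"
  shows "AE x in \<mu>. neg_log (v x) + 1 \<le> neg_log (u (fst x)) + ennreal (u (fst x)) / ennreal (v x)"
    and "(\<integral>\<^sup>+x. neg_log (u (fst x)) + ennreal (u (fst x)) / ennreal (v x) \<partial>\<mu>) \<le> partition_entropy m f \<sigma> + 1"
    and "(\<integral>\<^sup>+x. neg_log (v x) + 1 \<partial>\<mu>) = partition_entropy \<mu> F \<xi>u + 1"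
proof -
  show "AE x in \<mu>. neg_log (v x) + 1 \<le> neg_log (u (fst x)) + ennreal (u (fst x)) / ennreal (v x)"
    using AE_atoms(1,3)[OF fin]
  proof eventually_elim
    case (elim x)
    then show ?case using u_bounds[of "fst x"] v_bounds[of x] by (intro neg_log_ratio) auto
  qed
  have "(\<integral>\<^sup>+x. neg_log (u (fst x)) + ennreal (u (fst x)) / ennreal (v x) \<partial>\<mu>)
      = partition_entropy m f \<sigma> + (\<integral>\<^sup>+x. ennreal (u (fst x)) / ennreal (v x) \<partial>\<mu>)"
    unfolding entropy_base by (rule nn_integral_add) measurable
  also have "\<dots> \<le> partition_entropy m f \<sigma> + 1"
    by (intro add_left_mono nn_integral_ratio_le fin)
  finally show "(\<integral>\<^sup>+x. neg_log (u (fst x)) + ennreal (u (fst x)) / ennreal (v x) \<partial>\<mu>) \<le> partition_entropy m f \<sigma> + 1" .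
  have "(\<integral>\<^sup>+x. neg_log (v x) + 1 \<partial>\<mu>) = (\<integral>\<^sup>+x. neg_log (v x) \<partial>\<mu>) + (\<integral>\<^sup>+x. 1 \<partial>\<mu>)"
    by (rule nn_integral_add) measurable
  then show "(\<integral>\<^sup>+x. neg_log (v x) + 1 \<partial>\<mu>) = partition_entropy \<mu> F \<xi>u + 1"
    using prob_space.emeasure_space_1[OF prob_\<mu>] by (simp add: entropy_total)
qed

lemma entropy_le: "partition_entropy \<mu> F \<xi>u \<le> partition_entropy m f \<sigma>"
proof (cases "partition_entropy m f \<sigma> < \<infinity>")
  case True
  have "partition_entropy \<mu> F \<xi>u + 1 \<le> (\<integral>\<^sup>+x. neg_log (u (fst x)) + ennreal (u (fst x)) / ennreal (v x) \<partial>\<mu>)"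
    unfolding entropy_le_aux(3)[OF True, symmetric] by (rule nn_integral_mono_AE[OF entropy_le_aux(1)[OF True]])
  also have "\<dots> \<le> partition_entropy m f \<sigma> + 1" by (rule entropy_le_aux(2)[OF True])
  finally show ?thesis by (simp add: add.commute[of _ 1] ennreal_add_left_cancel_le)
qed (simp add: less_top[symmetric])

text \<open>Equal entropies squeeze the integrated logarithmic inequality, and for ordered functions
  with equal finite integrals the integrands agree. So \<open>u = v\<close>; the point masses of the
  two laws then coincide \<open>nu\<close>-almost everywhere, which suffices because
  \<open>nu\<close> is purely atomic.\<close>

lemma nu_eq_rho_if_entropy_eq:
  assumes fin: "partition_entropy m f \<sigma> < \<infinity>" and eq: "partition_entropy \<mu> F \<xi>u = partition_entropy m f \<sigma>"
  shows "AE x in \<mu>. nu (t x) = rho (s (fst x))"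
proof -
  have "AE x in \<mu>. neg_log (v x) + 1 = neg_log (u (fst x)) + ennreal (u (fst x)) / ennreal (v x)"
  proof (rule AE_eq_if_le_and_nn_integral_eq[OF _ _ entropy_le_aux(1)[OF fin]])
    show "(\<integral>\<^sup>+x. neg_log (u (fst x)) + ennreal (u (fst x)) / ennreal (v x) \<partial>\<mu>) \<le> (\<integral>\<^sup>+x. neg_log (v x) + 1 \<partial>\<mu>)"
      unfolding entropy_le_aux(3)[OF fin] eq by (rule entropy_le_aux(2)[OF fin])
    show "(\<integral>\<^sup>+x. neg_log (v x) + 1 \<partial>\<mu>) < \<infinity>"
      unfolding entropy_le_aux(3)[OF fin] eq using fin by (simp add: less_top[symmetric])
  qed measurable
  with AE_atoms(1,3)[OF fin] have uv: "AE x in \<mu>. u (fst x) = v x"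
  proof eventually_elim
    case (elim x)
    then show ?case using u_bounds[of "fst x"] v_bounds[of x] by (intro neg_log_ratio(2)) auto
  qed
  show ?thesis
    using AE_s_const xi.AE_const AE_atoms(2)[OF fin] xi.AE_disint[OF uv]
  proof eventually_elim
    case (elim x)
    have "AE z in Kx (t x). emeasure (rho (s (fst x))) {s (f (fst z))} = emeasure (nu (t x)) {s (f (fst z))}"
      using elim(1,2,4)
    proof eventually_elim
      case (elim z)
      then show ?case by (simp add: rho_atom' nu_atom')
    qed
    moreover have "{y \<in> space borel. emeasure (rho (s (fst x))) {y} = emeasure (nu (t x)) {y}} \<in> sets borel"
      using measurable_emeasure_singleton[OF nu, of "t x"] measurable_emeasure_singleton[OF rho, of "s (fst x)"]
      by measurable
    ultimately have "AE y in nu (t x). emeasure (rho (s (fst x))) {y} = emeasure (nu (t x)) {y}"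
      by (subst nu_def) (simp only: AE_distr_iff[OF sff_Kx])
    with elim(3) show ?case by (intro measure_eq_if_atoms_eq nu rho)
  qed
qed

lemma entropy_eq_if_nu_eq_rho:
  assumes "AE x in \<mu>. nu (t x) = rho (s (fst x))"
  shows "partition_entropy \<mu> F \<xi>u = partition_entropy m f \<sigma>"
  unfolding entropy_total entropy_base proof (rule nn_integral_cong_AE, use assms in eventually_elim)
  case (elim x)
  have "ennreal (v x) = ennreal (u (fst x))"
    using nu_atom[of x] rho_atom[of "fst x"] unfolding elim by simp
  then have "v x = u (fst x)" using u_bounds v_bounds by simp
  then show ?case by simp
qed

section \<open>Independence of the base point from the atom of \<xi>u, given \<sigma>\<close>

definition good :: "'a set \<Rightarrow> bool" where
  "good B \<longleftrightarrow> B \<in> sets M \<and> (AE x in \<mu>. emeasure (Kx (t x)) (over B) = emeasure (Km (s (fst x))) B)"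

lemma Kx_fst: "B \<in> sets M \<Longrightarrow> (\<integral>\<^sup>+z. indicator B (fst z) \<partial>Kx c) = emeasure (Kx c) (over B)"
  using nn_integral_indicator_vimage[OF xi.measurable_K[OF fst_measurable_\<mu>], of c B] xi.space_K[of c] by simp

lemma fst_vimage_sets: "B \<in> sets M \<Longrightarrow> over B \<in> sets \<mu>"
  using measurable_sets[OF fst_measurable_\<mu>] .

lemma emeasure_Km_measurable [measurable]: "B \<in> sets M \<Longrightarrow> (\<lambda>c. emeasure (Km c) B) \<in> borel_measurable borel"
  using measurable_compose[OF sg.measurable_K_subprob measurable_emeasure_subprob_algebra[of B m]]
  by (simp add: sets_m)

text \<open>A conditional probability given \<xi>u that depends only on the atom of \<sigma> must be
  the conditional probability given \<sigma>, whatever formula \<open>J\<close> it comes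
  with.\<close>

lemma good_if_function:
  assumes B [measurable]: "B \<in> sets M" and J [measurable]: "J \<in> borel_measurable borel"
    and eq: "AE x in \<mu>. emeasure (Kx (t x)) (over B) = J (s (fst x))"
  shows "good B"
proof -
  have Bm: "B \<in> sets m" using B by (simp add: sets_m)
  have "AE p in m. emeasure (Km (s p)) B = J (s p)"
  proof (rule sg.emeasure_K_eqI[OF Bm])
    show "(\<lambda>p. J (s p)) \<in> borel_measurable m" by measurable
    show "AE p in m. AE q in Km (s p). J (s q) = J (s p)"
      using sg.AE_const by eventually_elim (auto elim: eventually_mono)
    fix D :: "real set" assume D [measurable]: "D \<in> sets borel"
    have "emeasure m (s -` D \<inter> B) = (\<integral>\<^sup>+p. indicator D (s p) * indicator B p \<partial>m)"
      by (rule sg.emeasure_vimage_Int[OF Bm D])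
    also have "\<dots> = (\<integral>\<^sup>+x. indicator D (s (fst x)) * indicator B (fst x) \<partial>\<mu>)"
      by (rule nn_integral_fst) measurable
    also have "\<dots> = (\<integral>\<^sup>+x. indicator D (s (fst x)) * (\<integral>\<^sup>+z. indicator B (fst z) \<partial>Kx (t x)) \<partial>\<mu>)"
    proof (rule xi.nn_integral_disint_const)
      show "AE x in \<mu>. AE z in Kx (t x). indicator D (s (fst z)) = (indicator D (s (fst x)) :: ennreal)"
        using AE_s_const by eventually_elim (auto elim: eventually_mono)
    qed measurable
    also have "\<dots> = (\<integral>\<^sup>+x. indicator D (s (fst x)) * J (s (fst x)) \<partial>\<mu>)"
      by (rule nn_integral_cong_AE, use eq in eventually_elim) (simp only: Kx_fst[OF B])
    also have "\<dots> = (\<integral>\<^sup>+p. indicator D (s p) * J (s p) \<partial>m)"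
      by (rule nn_integral_fst[symmetric]) measurable
    finally show "emeasure m (s -` D \<inter> B) = (\<integral>\<^sup>+p. indicator D (s p) * J (s p) \<partial>m)" .
  qed
  from eq AE_fst[OF this] have "AE x in \<mu>. emeasure (Kx (t x)) (over B) = emeasure (Km (s (fst x))) B"
    by eventually_elim simp
  with B show ?thesis by (simp add: good_def)
qed

text \<open>As \<xi>u is increasing, the inverse of \<open>F\<close> maps each of its atoms into an
  atom; functions of \<open>t (Finv y)\<close> can therefore be pulled out when conditioning on
  \<xi>u.\<close>

lemma AE_t_Finv_const: "AE y in \<mu>. AE z in Kx (t y). t (Finv z) = t (Finv y)"
proof (rule xi.AE_disint_const)
  show "AE y in \<mu>. y \<in> Y \<and> Finv y \<in> Y"
    using xi.X_full AE_Finv[OF xi.X_full] by eventually_elim (rule conjI)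
  fix y z assume y: "y \<in> Y \<and> Finv y \<in> Y" and z: "z \<in> Y \<and> Finv z \<in> Y"
    and sp: "y \<in> space \<mu>" "z \<in> space \<mu>" and tz: "t z = t y"
  have "atom \<xi>u (F (Finv z)) = atom \<xi>u (F (Finv y))"
    using xi.atom_eq_iff_code[of z y] y z tz by (simp add: F_Finv sp)
  then have "atom \<xi>u (Finv z) = atom \<xi>u (Finv y)"
    by (rule \<xi>_eq_if_F[OF Finv_space[OF sp(2)] Finv_space[OF sp(1)]])
  then show "t (Finv z) = t (Finv y)" using xi.atom_eq_iff_code[of "Finv z" "Finv y"] y z by simp
qed

text \<open>
  The conditional law of \<open>f\<^sup>-\<^sup>1 B\<close> given \<open>\<xi>u\<close> is computed in two steps, conditioning first on
  the finer partition \<open>F\<^sup>-\<^sup>1 \<xi>u\<close>, where the invariance of \<open>\<mu>\<close> reduces it to that of \<open>B\<close>.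
\<close>

lemma good_step:
  assumes base: "AE x in \<mu>. nu (t x) = rho (s (fst x))"
    and good: "good B" and C [measurable]: "C \<in> sets borel"
  shows "good {p \<in> space M. f p \<in> B \<and> s p \<in> C}"
proof -
  have B [measurable]: "B \<in> sets M"
    and AE_B: "AE x in \<mu>. emeasure (Kx (t x)) (over B) = emeasure (Km (s (fst x))) B"
    using good by (auto simp: good_def)
  define B' where "B' = {p \<in> space M. f p \<in> B}"
  have B' [measurable]: "B' \<in> sets M" unfolding B'_def by measurable
  \<comment> \<open>The conditional probability of \<open>B\<close> given \<sigma> at the image
    point, averaged over an atom of \<sigma>.\<close>
  define J where "J c = (\<integral>\<^sup>+q. emeasure (Km (s (f q))) B \<partial>Km c)" for c
  have Kmsf: "(\<lambda>q. emeasure (Km (s (f q))) B) \<in> borel_measurable m"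
    by (rule measurable_compose[OF sf_measurable emeasure_Km_measurable[OF B]])
  have J [measurable]: "J \<in> borel_measurable borel"
    unfolding J_def
    by (rule measurable_compose[OF sg.measurable_K_subprob nn_integral_measurable_subprob_algebra[OF Kmsf]])
  have "AE x in \<mu>. emeasure (Kx (t x)) (over B') = J (s (fst x))"
  proof (rule xi.emeasure_K_eqI[OF fst_vimage_sets[OF B']])
    show "(\<lambda>x. J (s (fst x))) \<in> borel_measurable \<mu>" by measurable
    show "AE x in \<mu>. AE z in Kx (t x). J (s (fst z)) = J (s (fst x))"
      using AE_s_const by eventually_elim (auto elim: eventually_mono)
    fix D :: "real set" assume D [measurable]: "D \<in> sets borel"
    have "emeasure \<mu> (t -` D \<inter> (over B'))
        = (\<integral>\<^sup>+x. indicator D (t x) * indicator (over B') x \<partial>\<mu>)"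
      by (rule xi.emeasure_vimage_Int[OF fst_vimage_sets[OF B'] D])
    \<comment> \<open>Substituting y = F x makes \<open>B\<close> an event at \<open>y\<close>,
      where its probability given \<xi>u is known; after conditioning, the substitution is
      undone.\<close>
    also have "\<dots> = (\<integral>\<^sup>+x. indicator D (t (Finv (F x))) * indicator B (fst (F x)) \<partial>\<mu>)"
      by (intro nn_integral_cong) (auto simp: Finv_F fst_F B'_def fst_space split: split_indicator)
    also have "\<dots> = (\<integral>\<^sup>+y. indicator D (t (Finv y)) * indicator B (fst y) \<partial>\<mu>)"
      by (rule nn_integral_F) measurable
    also have "\<dots> = (\<integral>\<^sup>+y. indicator D (t (Finv y)) * (\<integral>\<^sup>+z. indicator B (fst z) \<partial>Kx (t y)) \<partial>\<mu>)"
    proof (rule xi.nn_integral_disint_const)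
      show "AE y in \<mu>. AE z in Kx (t y). indicator D (t (Finv z)) = (indicator D (t (Finv y)) :: ennreal)"
        using AE_t_Finv_const by eventually_elim (auto elim: eventually_mono)
    qed measurable
    also have "\<dots> = (\<integral>\<^sup>+y. indicator D (t (Finv y)) * emeasure (Km (s (fst y))) B \<partial>\<mu>)"
      by (rule nn_integral_cong_AE, use AE_B in eventually_elim) (simp only: Kx_fst[OF B])
    also have "\<dots> = (\<integral>\<^sup>+x. indicator D (t (Finv (F x))) * emeasure (Km (s (fst (F x)))) B \<partial>\<mu>)"
    proof (rule nn_integral_F[symmetric])
      have "(\<lambda>y. emeasure (Km (s (fst y))) B) \<in> borel_measurable \<mu>"
        by (rule measurable_compose[OF _ emeasure_Km_measurable[OF B]]) measurable
      then show "(\<lambda>y. indicator D (t (Finv y)) * emeasure (Km (s (fst y))) B) \<in> borel_measurable \<mu>"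
        by measurable
    qed
    also have "\<dots> = (\<integral>\<^sup>+x. indicator D (t x) * emeasure (Km (s (f (fst x)))) B \<partial>\<mu>)"
      by (intro nn_integral_cong) (simp add: Finv_F fst_F)
    also have "\<dots> = (\<integral>\<^sup>+x. indicator D (t x) * (\<integral>\<^sup>+z. emeasure (Km (s (f (fst z)))) B \<partial>Kx (t x)) \<partial>\<mu>)"
    proof (rule xi.nn_integral_disint)
      show "(\<lambda>z. emeasure (Km (s (f (fst z)))) B) \<in> borel_measurable \<mu>"
        by (rule measurable_compose[OF sff_measurable emeasure_Km_measurable[OF B]])
    qed measurable
    \<comment> \<open>The integrand depends on \<open>s (f (fst z))\<close> alone, whose law is
      \<open>nu\<close> given \<xi>u and \<open>rho\<close> given \<sigma>; this is where their
      equality enters.\<close>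
    also have "\<dots> = (\<integral>\<^sup>+x. indicator D (t x) * J (s (fst x)) \<partial>\<mu>)"
      proof (rule nn_integral_cong_AE, use base in eventually_elim)
      case (elim x)
      have "(\<integral>\<^sup>+z. emeasure (Km (s (f (fst z)))) B \<partial>Kx (t x)) = (\<integral>\<^sup>+c. emeasure (Km c) B \<partial>nu (t x))"
        by (rule nn_integral_nu[symmetric]) (rule emeasure_Km_measurable[OF B])
      also have "\<dots> = J (s (fst x))"
        unfolding elim rho_def J_def
        by (rule nn_integral_distr[OF sf_Km]) (simp add: emeasure_Km_measurable[OF B])
      finally show ?case by (simp only:)
    qed
    finally show "emeasure \<mu> (t -` D \<inter> (over B')) = (\<integral>\<^sup>+x. indicator D (t x) * J (s (fst x)) \<partial>\<mu>)" .
  qed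
  \<comment> \<open>The constraint \<open>s p \<in> C\<close> is decided by the atom of \<sigma> up
    to null sets, so it only contributes an indicator.\<close>
  then have "AE x in \<mu>. emeasure (Kx (t x)) (fst -` {p \<in> space M. f p \<in> B \<and> s p \<in> C} \<inter> space \<mu>)
      = indicator C (s (fst x)) * J (s (fst x))"
    using AE_s_const
  proof eventually_elim
    case (elim x)
    let ?A = "fst -` {p \<in> space M. f p \<in> B \<and> s p \<in> C} \<inter> space \<mu>"
    have A: "?A \<in> sets (Kx (t x))"
      unfolding xi.sets_K[of "t x", simplified] by (rule fst_vimage_sets) measurable
    show ?case
    proof (cases "s (fst x) \<in> C")
      case True
      have "emeasure (Kx (t x)) ?A = emeasure (Kx (t x)) (over B')"
      proof (rule emeasure_eq_AE[OF _ A])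
        show "AE z in Kx (t x). z \<in> ?A \<longleftrightarrow> z \<in> over B'"
          using elim(2) by eventually_elim (use True in \<open>auto simp: B'_def\<close>)
        show "over B' \<in> sets (Kx (t x))"
          unfolding xi.sets_K[of "t x", simplified] by (rule fst_vimage_sets[OF B'])
      qed
      with True elim(1) show ?thesis by simp
    next
      case False
      have "emeasure (Kx (t x)) ?A = emeasure (Kx (t x)) {}"
      proof (rule emeasure_eq_AE[OF _ A])
        show "AE z in Kx (t x). z \<in> ?A \<longleftrightarrow> z \<in> {}"
          using elim(2) by eventually_elim (use False in auto)
      qed simp
      with False show ?thesis by simp
    qed
  qed
  then show ?thesis
    by (intro good_if_function[where J="\<lambda>c. indicator C c * J c"]) measurable
qed

section \<open>Conditional independence and holonomy invariance\<close>

definition cyl :: "nat \<Rightarrow> (nat \<Rightarrow> real set) \<Rightarrow> 'a set" where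
  "cyl n C = {p \<in> space M. \<forall>k<n. s ((f ^^ k) p) \<in> C k}"

definition cylinders :: "'a set set" where
  "cylinders = {cyl n C | n C. \<forall>k. C k \<in> sets borel}"

lemma funpow_measurable [measurable]: "(f ^^ k) \<in> M \<rightarrow>\<^sub>M M"
proof (induction k)
  case (Suc k)
  then show ?case unfolding funpow.simps by (rule measurable_comp[OF _ f_measurable])
qed (simp add: id_def)

lemma cyl_sets:
  assumes "\<forall>k. C k \<in> sets borel"
  shows "cyl n C \<in> sets M"
proof -
  have [measurable]: "C k \<in> sets borel" for k using assms by blast
  show ?thesis unfolding cyl_def by measurable
qed

lemma cylinders_sets: "cylinders \<subseteq> sets M"
  using cyl_sets by (auto simp: cylinders_def)

lemma Int_stable_cylinders: "Int_stable cylinders"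
proof (rule Int_stableI)
  fix A B assume "A \<in> cylinders" "B \<in> cylinders"
  then obtain n C n' C' where A: "A = cyl n C" "\<forall>k. C k \<in> sets borel" and B: "B = cyl n' C'" "\<forall>k. C' k \<in> sets borel"
    unfolding cylinders_def by blast
  \<comment> \<open>A condition missing beyond the length of one cylinder is replaced by the whole
    line.\<close>
  let ?C = "\<lambda>k. (if k < n then C k else UNIV) \<inter> (if k < n' then C' k else UNIV)"
  have if_iff: "x \<in> (if b then A else UNIV) \<longleftrightarrow> (b \<longrightarrow> x \<in> A)" for x :: real and b A by simp
  have "A \<inter> B = cyl (max n n') ?C"
  proof (rule set_eqI)
    fix p
    show "p \<in> A \<inter> B \<longleftrightarrow> p \<in> cyl (max n n') ?C"
      unfolding A(1) B(1) cyl_def Int_iff mem_Collect_eq if_iff less_max_iff_disj by blast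
  qed
  moreover have "\<forall>k. ?C k \<in> sets borel" using A(2) B(2) by auto
  ultimately show "A \<inter> B \<in> cylinders" unfolding cylinders_def by blast
qed

lemma good_space: "good (space M)"
proof (rule good_if_function[where J="\<lambda>_. 1"])
  show "AE x in \<mu>. emeasure (Kx (t x)) (fst -` space M \<inter> space \<mu>) = 1"
  proof (rule AE_I2)
    fix x
    interpret prob_space "Kx (t x)" by (rule xi.K_prob_space) simp
    have "fst -` space M \<inter> space \<mu> = space (Kx (t x))"
      unfolding xi.space_K[of "t x", simplified] by (auto dest: fst_space)
    then show "emeasure (Kx (t x)) (fst -` space M \<inter> space \<mu>) = 1" by (simp add: emeasure_space_1)
  qed
qed auto

lemma good_compl:
  assumes "good B"
  shows "good (space M - B)"
proof (rule good_if_function[where J="\<lambda>c. 1 - emeasure (Km c) B"])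
  have B [measurable]: "B \<in> sets M"
    and AE: "AE x in \<mu>. emeasure (Kx (t x)) (over B) = emeasure (Km (s (fst x))) B"
    using assms by (auto simp: good_def)
  show "space M - B \<in> sets M" by measurable
  show "(\<lambda>c. 1 - emeasure (Km c) B) \<in> borel_measurable borel"
    using emeasure_Km_measurable[OF B] by measurable
  show "AE x in \<mu>. emeasure (Kx (t x)) (fst -` (space M - B) \<inter> space \<mu>) = 1 - emeasure (Km (s (fst x))) B"
    using AE
  proof eventually_elim
    case (elim x)
    interpret prob_space "Kx (t x)" by (rule xi.K_prob_space) simp
    have sp: "space (Kx (t x)) = space \<mu>" by (rule xi.space_K) simp
    have B': "over B \<in> sets (Kx (t x))"
      unfolding xi.sets_K[of "t x", simplified] by (rule fst_vimage_sets[OF B])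
    have "fst -` (space M - B) \<inter> space \<mu> = space (Kx (t x)) - (over B)"
      unfolding sp by (auto dest: fst_space)
    also have "emeasure (Kx (t x)) \<dots> = emeasure (Kx (t x)) (space (Kx (t x))) - emeasure (Kx (t x)) (over B)"
      by (rule emeasure_compl[OF B']) simp
    finally show ?case by (simp add: emeasure_space_1 elim)
  qed
qed

lemma good_UN:
  fixes A :: "nat \<Rightarrow> 'a set"
  assumes disj: "disjoint_family A" and A: "\<And>i. good (A i)"
  shows "good (\<Union>i. A i)"
proof -
  have AM: "range A \<subseteq> sets M" using A by (auto simp: good_def)
  have "AE x in \<mu>. \<forall>i. emeasure (Kx (t x)) (fst -` A i \<inter> space \<mu>) = emeasure (Km (s (fst x))) (A i)"
    unfolding AE_all_countable using A by (auto simp: good_def)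
  then have "AE x in \<mu>. emeasure (Kx (t x)) (fst -` (\<Union>i. A i) \<inter> space \<mu>) = emeasure (Km (s (fst x))) (\<Union>i. A i)"
  proof eventually_elim
    case (elim x)
    have "fst -` (\<Union>i. A i) \<inter> space \<mu> = (\<Union>i. fst -` A i \<inter> space \<mu>)" by auto
    also have "emeasure (Kx (t x)) \<dots> = (\<Sum>i. emeasure (Kx (t x)) (fst -` A i \<inter> space \<mu>))"
    proof (rule suminf_emeasure[symmetric])
      show "range (\<lambda>i. fst -` A i \<inter> space \<mu>) \<subseteq> sets (Kx (t x))"
        unfolding xi.sets_K[of "t x", simplified] using AM fst_vimage_sets by blast
      show "disjoint_family (\<lambda>i. fst -` A i \<inter> space \<mu>)"
        using disj unfolding disjoint_family_on_def by blast
    qed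
    also have "\<dots> = (\<Sum>i. emeasure (Km (s (fst x))) (A i))" using elim by simp
    also have "\<dots> = emeasure (Km (s (fst x))) (\<Union>i. A i)"
      using AM by (intro suminf_emeasure disj) (simp add: sg.sets_K sets_m)
    finally show ?case .
  qed
  moreover have "(\<Union>i. A i) \<in> sets M" using AM by blast
  ultimately show ?thesis by (simp add: good_def)
qed

lemma AE_funpow_X: "AE p in m. \<forall>k. (f ^^ k) p \<in> X"
  unfolding AE_all_countable
proof
  fix k show "AE p in m. (f ^^ k) p \<in> X"
  proof (induction k)
    case 0
    show ?case using sg.X_full by simp
  next
    case (Suc k)
    from AE_f[OF Suc] show ?case by (simp only: funpow_Suc_right o_apply)
  qed
qed

context
  assumes base: "AE x in \<mu>. nu (t x) = rho (s (fst x))"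
begin

text \<open>Splitting off the condition at time 0 exhibits a longer cylinder as the preimage under
  \<open>f\<close> of a shorter one, cut by a condition on \<open>s\<close>; this is the shape that
  \<open>good_step\<close> handles.\<close>

lemma good_cyl: "\<forall>k. C k \<in> sets borel \<Longrightarrow> good (cyl n C)"
proof (induction n arbitrary: C)
  case 0
  have "cyl 0 C = space M" by (simp add: cyl_def)
  then show ?case using good_space by simp
next
  case (Suc n)
  have "cyl (Suc n) C = {p \<in> space M. f p \<in> cyl n (\<lambda>k. C (Suc k)) \<and> s p \<in> C 0}"
  proof (rule set_eqI)
    fix p
    have "(\<forall>k<Suc n. s ((f ^^ k) p) \<in> C k) \<longleftrightarrow> s p \<in> C 0 \<and> (\<forall>k<n. s ((f ^^ k) (f p)) \<in> C (Suc k))"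
      by (simp add: All_less_Suc2 funpow_Suc_right del: funpow.simps)
    then show "p \<in> cyl (Suc n) C \<longleftrightarrow> p \<in> {p \<in> space M. f p \<in> cyl n (\<lambda>k. C (Suc k)) \<and> s p \<in> C 0}"
      using f_space by (auto simp: cyl_def)
  qed
  moreover have "good (cyl n (\<lambda>k. C (Suc k)))" using Suc.prems by (intro Suc.IH) blast
  ultimately show ?case using good_step[OF base, of _ "C 0"] Suc.prems by simp
qed

lemma good_generated:
  assumes "B \<in> sigma_sets (space M) cylinders"
  shows "good B"
proof -
  have "cylinders \<subseteq> Pow (space M)" using cylinders_sets sets.space_closed by blast
  with Int_stable_cylinders show ?thesis using assms
  proof (induction rule: sigma_sets_induct_disjoint)
    case (basic A)
    then show ?case unfolding cylinders_def using good_cyl by blast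
  next
    case empty
    show ?case using good_compl[OF good_space] by simp
  next
    case (compl A)
    then show ?case by (intro good_compl)
  next
    case (union A)
    then show ?case by (intro good_UN)
  qed
qed

text \<open>
  The cylinders separate points only up to a null set. That they generate all measurable
  sets modulo null sets follows by disintegrating \<open>m\<close> over a code of the cylinders: the
  conditional measures are point masses, so that \<open>B\<close> is almost everywhere equal to
  the set of points at which the conditional measure of \<open>B\<close> is \<open>1\<close>.
\<close>

lemma good_if_nu_eq_rho:
  assumes B: "B \<in> sets M"
  shows "good B"
proof -
  define S where "S = sigma (space M) cylinders"
  have cs: "cylinders \<subseteq> Pow (space M)" using cylinders_sets sets.space_closed by blast
  have spS: "space S = space M" and setsS: "sets S = sigma_sets (space M) cylinders"
    using cs by (simp_all add: S_def)
  \<comment> \<open>The index encodes a time \<open>k\<close> and a rational threshold; together the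
    bits determine the whole itinerary \<open>s ((f ^^ k) p)\<close>.\<close>
  define P where "P n p \<longleftrightarrow> s ((f ^^ fst (prod_decode n)) p) \<le> of_rat (from_nat (snd (prod_decode n)) :: rat)" for n p
  define \<Psi> where "\<Psi> p = ternary (\<lambda>n. P n p)" for p
  have PS: "Measurable.pred S (P n)" for n
  proof -
    let ?k = "fst (prod_decode n)" and ?q = "of_rat (from_nat (snd (prod_decode n)) :: rat) :: real"
    have "{p \<in> space S. P n p} = cyl (Suc ?k) (\<lambda>j. if j = ?k then {..?q} else UNIV)"
      by (auto simp: cyl_def P_def spS)
    also have "\<dots> \<in> cylinders"
      unfolding cylinders_def by (rule CollectI, intro exI conjI, rule refl) auto
    also have "cylinders \<subseteq> sets S" unfolding setsS by (rule sigma_sets_superset_generator)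
    finally show ?thesis by (simp add: pred_def)
  qed
  have \<Psi>S: "\<Psi> \<in> borel_measurable S" unfolding \<Psi>_def[abs_def] using PS by (rule measurable_ternary)
  have "sets S \<subseteq> sets m"
    unfolding setsS sets_m by (rule sets.sigma_sets_subset[OF cylinders_sets])
  then have \<Psi>m: "\<Psi> \<in> borel_measurable m"
    using \<Psi>S by (auto simp: measurable_def spS space_m)
  have "binary_coded m" using binary_coded_M binary_coded_cong[OF sets_m] by simp
  from disintegration_exists[OF prob_m this \<Psi>m real_separated] obtain K where "disintegration m borel \<Psi> K" ..
  then interpret K: disintegration m borel \<Psi> K .
  have "AE p in m. AE q in K (\<Psi> p). q = p"
  \<comment> \<open>For points whose whole forward orbit stays in \<open>X\<close>, equal
    itineraries mean equal atoms of \<sigma> at all times, hence equal points, as \<sigma>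
    generates.\<close>
  proof (rule K.AE_disint_const[OF AE_funpow_X])
    fix p q assume X: "\<forall>k. (f ^^ k) p \<in> X" "\<forall>k. (f ^^ k) q \<in> X" and sp: "p \<in> space m" "q \<in> space m" and "\<Psi> q = \<Psi> p"
    then have P: "P n q \<longleftrightarrow> P n p" for n by (simp add: \<Psi>_def ternary_inject)
    have eq: "s ((f ^^ k) q) = s ((f ^^ k) p)" for k
    proof (rule ccontr)
      have "s ((f ^^ k) q) \<le> of_rat r \<longleftrightarrow> s ((f ^^ k) p) \<le> of_rat r" for r :: rat
        using P[of "prod_encode (k, to_nat r)"] by (simp add: P_def)
      moreover assume "s ((f ^^ k) q) \<noteq> s ((f ^^ k) p)"
      then consider "s ((f ^^ k) q) < s ((f ^^ k) p)" | "s ((f ^^ k) p) < s ((f ^^ k) q)" by linarith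
      then obtain r :: rat where "(s ((f ^^ k) q) < of_rat r \<and> of_rat r < s ((f ^^ k) p)) \<or>
          (s ((f ^^ k) p) < of_rat r \<and> of_rat r < s ((f ^^ k) q))"
      proof cases
        case 1
        from of_rat_dense[OF this] show ?thesis using that by blast
      next
        case 2
        from of_rat_dense[OF this] show ?thesis using that by blast
      qed
      ultimately show False by (meson less_imp_le not_le)
    qed
    show "q = p"
    proof (rule generating)
      show "atom \<sigma> ((f ^^ n) q) = atom \<sigma> ((f ^^ n) p)" for n
        using sg.atom_eq_iff_code[of "(f ^^ n) q" "(f ^^ n) p"] X eq by blast
    qed (use sp in \<open>simp_all add: space_m\<close>)
  qed
  then have KB: "AE p in m. emeasure (K (\<Psi> p)) B = indicator B p"
  proof eventually_elim
    case (elim p)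
    interpret Kp: prob_space "K (\<Psi> p)" by (rule K.K_prob_space) simp
    have sB: "B \<in> sets (K (\<Psi> p))" using B K.sets_K[of "\<Psi> p"] by (simp add: sets_m)
    have "emeasure (K (\<Psi> p)) B = (\<integral>\<^sup>+q. indicator B q \<partial>K (\<Psi> p))" using sB by simp
    also have "\<dots> = (\<integral>\<^sup>+q. indicator B p \<partial>K (\<Psi> p))"
      using elim by (intro nn_integral_cong_AE) (auto elim: eventually_mono)
    also have "\<dots> = indicator B p" by (simp add: Kp.emeasure_space_1)
    finally show ?case .
  qed
  define B' where "B' = {p \<in> space M. emeasure (K (\<Psi> p)) B = 1}"
  have Bm: "B \<in> sets m" using B by (simp add: sets_m)
  have "(\<lambda>c. emeasure (K c) B) \<in> borel_measurable borel"
    by (rule measurable_compose[OF K.measurable_K_subprob measurable_emeasure_subprob_algebra[OF Bm]])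
  then have "(\<lambda>p. emeasure (K (\<Psi> p)) B) \<in> borel_measurable S" by (rule measurable_compose[OF \<Psi>S])
  then have "{p \<in> space S. emeasure (K (\<Psi> p)) B = 1} \<in> sets S" by measurable
  then have B'S: "B' \<in> sets S" by (simp add: B'_def spS)
  then have good_B': "good B'" unfolding setsS by (rule good_generated)
  then have B'M: "B' \<in> sets M" by (simp add: good_def)
  have BB': "AE p in m. p \<in> B \<longleftrightarrow> p \<in> B'"
    using KB AE_space by eventually_elim (auto simp: B'_def space_m split: split_indicator_asm)
  have "AE x in \<mu>. emeasure (Kx (t x)) (over B) = emeasure (Kx (t x)) (over B')"
    using xi.AE_disint[OF AE_fst[OF BB']]
  proof eventually_elim
    case (elim x)
    show ?case
    proof (rule emeasure_eq_AE)
      show "AE z in Kx (t x). z \<in> over B \<longleftrightarrow> z \<in> over B'"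
        using elim by eventually_elim auto
    qed (use fst_vimage_sets B B'M xi.sets_K[of "t x"] in simp_all)
  qed
  moreover have "AE p in m. emeasure (Km (s p)) B = emeasure (Km (s p)) B'"
    using sg.AE_disint[OF BB']
  proof eventually_elim
    case (elim p)
    then show ?case
      by (rule emeasure_eq_AE) (use B B'M sg.sets_K[of "s p"] sets_m in simp_all)
  qed
  then have "AE x in \<mu>. emeasure (Km (s (fst x))) B = emeasure (Km (s (fst x))) B'" by (rule AE_fst)
  moreover have "AE x in \<mu>. emeasure (Kx (t x)) (over B') = emeasure (Km (s (fst x))) B'"
    using good_B' by (simp add: good_def)
  ultimately have "AE x in \<mu>. emeasure (Kx (t x)) (over B) = emeasure (Km (s (fst x))) B"
    by eventually_elim simp
  with B show ?thesis by (simp add: good_def)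
qed

end

text \<open>Both are laws of one function of the base point, so independence applied to its rational
  sublevel sets identifies them.\<close>

lemma nu_eq_rho_if_good:
  assumes good: "\<And>B. B \<in> sets M \<Longrightarrow> good B"
  shows "AE x in \<mu>. nu (t x) = rho (s (fst x))"
proof -
  have B: "{p \<in> space M. s (f p) \<le> of_rat q} \<in> sets M" for q by measurable
  have "AE x in \<mu>. \<forall>q. emeasure (Kx (t x)) (fst -` {p \<in> space M. s (f p) \<le> of_rat q} \<inter> space \<mu>)
      = emeasure (Km (s (fst x))) {p \<in> space M. s (f p) \<le> of_rat q}"
    unfolding AE_all_countable using good[OF B] by (simp only: good_def) simp
  then show ?thesis
  proof eventually_elim
    case (elim x)
    show ?case
    proof (rule borel_measure_eqI_rat[OF nu(2) rho(2)])
      fix q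
      show "emeasure (nu (t x)) {..real_of_rat q} \<noteq> \<infinity>"
        using finite_measure.emeasure_finite[OF prob_space.finite_measure[OF nu(1)]] by simp
      have spx: "space (Kx (t x)) = space \<mu>" by (rule xi.space_K) simp
      have spm: "space (Km (s (fst x))) = space m" by (rule sg.space_K) simp
      have "emeasure (nu (t x)) {..real_of_rat q}
          = emeasure (Kx (t x)) ((\<lambda>z. s (f (fst z))) -` {..of_rat q} \<inter> space (Kx (t x)))"
        unfolding nu_def by (rule emeasure_distr[OF sff_Kx]) simp
      also have "(\<lambda>z. s (f (fst z))) -` {..of_rat q} \<inter> space (Kx (t x))
          = fst -` {p \<in> space M. s (f p) \<le> of_rat q} \<inter> space \<mu>"
        unfolding spx by (auto dest: fst_space)
      also have "emeasure (Kx (t x)) \<dots> = emeasure (Km (s (fst x))) {p \<in> space M. s (f p) \<le> of_rat q}"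
        using elim by blast
      also have "{p \<in> space M. s (f p) \<le> of_rat q} = (\<lambda>p. s (f p)) -` {..of_rat q} \<inter> space (Km (s (fst x)))"
        unfolding spm space_m by auto
      also have "emeasure (Km (s (fst x))) \<dots> = emeasure (rho (s (fst x))) {..of_rat q}"
        unfolding rho_def by (rule emeasure_distr[OF sf_Km, symmetric]) simp
      finally show "emeasure (nu (t x)) {..real_of_rat q} = emeasure (rho (s (fst x))) {..real_of_rat q}" .
    qed
  qed
qed

section \<open>Symmetry of conditional independence\<close>

text \<open>
  Both the independence of the base point from \<open>\<xi>u\<close> and that of the code \<open>t\<close> from the base
  point, given \<open>\<sigma>\<close>, are equivalent to \<open>\<mu>\<close> assigning these integrals to the products of sets.
\<close>

definition product_integral :: "'a set \<Rightarrow> real set \<Rightarrow> ennreal" where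
  "product_integral B C =
     (\<integral>\<^sup>+x. emeasure (Km (s (fst x))) B * emeasure (Kcu (s (fst x))) (level C) \<partial>\<mu>)"

lemma t_vimage_sets: "C \<in> sets borel \<Longrightarrow> level C \<in> sets \<mu>"
  using measurable_sets[OF xi.t] .

lemma emeasure_Kcu_measurable: "C \<in> sets borel \<Longrightarrow> (\<lambda>c. emeasure (Kcu c) (level C)) \<in> borel_measurable borel"
  by (rule measurable_compose[OF cu.measurable_K_subprob measurable_emeasure_subprob_algebra[OF t_vimage_sets]])

lemma Kcu_t: "C \<in> sets borel \<Longrightarrow> (\<integral>\<^sup>+z. indicator C (t z) \<partial>Kcu c) = emeasure (Kcu c) (level C)"
  using nn_integral_indicator_vimage[OF cu.measurable_K[OF xi.t], of c C] cu.space_K[of c] by simp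

text \<open>The factor with \<open>Km\<close> is a function of \<open>s (fst x)\<close>, so
  conditioning on \<xi>cu averages only the indicator.\<close>

lemma product_integral_t:
  assumes B: "B \<in> sets M" and C [measurable]: "C \<in> sets borel"
  shows "(\<integral>\<^sup>+x. indicator C (t x) * emeasure (Km (s (fst x))) B \<partial>\<mu>) = product_integral B C"
proof -
  have "(\<integral>\<^sup>+x. indicator C (t x) * emeasure (Km (s (fst x))) B \<partial>\<mu>)
      = (\<integral>\<^sup>+x. emeasure (Km (s (fst x))) B * indicator C (t x) \<partial>\<mu>)"
    by (simp only: mult.commute)
  also have "\<dots> = (\<integral>\<^sup>+x. emeasure (Km (s (fst x))) B * (\<integral>\<^sup>+z. indicator C (t z) \<partial>Kcu (s (fst x))) \<partial>\<mu>)"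
    by (rule cu.nn_integral_disint[OF _ emeasure_Km_measurable[OF B]]) measurable
  finally show ?thesis by (simp only: Kcu_t[OF C] product_integral_def)
qed

text \<open>The factor with \<open>Kcu\<close> depends on the base point through \<open>s\<close>
  alone, so the computation takes place in the base, and conditioning on \<sigma> averages only the
  indicator of \<open>B\<close>.\<close>

lemma product_integral_base:
  assumes B: "B \<in> sets M" and C: "C \<in> sets borel"
  shows "(\<integral>\<^sup>+x. indicator B (fst x) * emeasure (Kcu (s (fst x))) (level C) \<partial>\<mu>) = product_integral B C"
proof -
  let ?\<tau> = "\<lambda>c. emeasure (Kcu c) (level C)"
  note [measurable] = emeasure_Kcu_measurable[OF C] emeasure_Km_measurable[OF B] B
  have Bm [measurable]: "B \<in> sets m" using B by (simp add: sets_m)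
  have "(\<integral>\<^sup>+x. indicator B (fst x) * ?\<tau> (s (fst x)) \<partial>\<mu>) = (\<integral>\<^sup>+p. indicator B p * ?\<tau> (s p) \<partial>m)"
    by (rule nn_integral_fst[symmetric]) measurable
  also have "\<dots> = (\<integral>\<^sup>+p. ?\<tau> (s p) * indicator B p \<partial>m)" by (simp only: mult.commute)
  also have "\<dots> = (\<integral>\<^sup>+p. ?\<tau> (s p) * (\<integral>\<^sup>+q. indicator B q \<partial>Km (s p)) \<partial>m)"
    by (rule sg.nn_integral_disint) measurable
  also have "\<dots> = (\<integral>\<^sup>+p. emeasure (Km (s p)) B * ?\<tau> (s p) \<partial>m)"
    using Bm sg.sets_K by (intro nn_integral_cong) (simp add: mult.commute)
  also have "\<dots> = product_integral B C"
    unfolding product_integral_def by (rule nn_integral_fst) measurable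
  finally show ?thesis .
qed

text \<open>Independence replaces the conditional probability of \<open>D\<close> given \<xi>u by
  the one given \<sigma>. The resulting integral is then reread with the roles of base point and
  code exchanged, which identifies the law of the code on fibers.\<close>

lemma t_law_if_good:
  assumes good: "\<And>B. B \<in> sets M \<Longrightarrow> good B" and C [measurable]: "C \<in> sets borel"
  shows "AE x in \<mu>. emeasure (Kc (fst x)) (level C) = emeasure (Kcu (s (fst x))) (level C)"
proof (rule c.emeasure_K_eqI[OF t_vimage_sets[OF C]])
  show "(\<lambda>x. emeasure (Kcu (s (fst x))) (level C)) \<in> borel_measurable \<mu>"
    by (rule measurable_compose[OF cu.t emeasure_Kcu_measurable[OF C]])
  show "AE x in \<mu>. AE z in Kc (fst x). emeasure (Kcu (s (fst z))) (level C) = emeasure (Kcu (s (fst x))) (level C)"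
    using c.AE_const by eventually_elim (auto elim: eventually_mono)
  fix D assume D [measurable]: "D \<in> sets M"
  have "emeasure \<mu> (fst -` D \<inter> (level C)) = (\<integral>\<^sup>+x. indicator D (fst x) * indicator (level C) x \<partial>\<mu>)"
    by (rule c.emeasure_vimage_Int[OF t_vimage_sets[OF C] D])
  also have "\<dots> = (\<integral>\<^sup>+x. indicator C (t x) * indicator D (fst x) \<partial>\<mu>)"
    by (intro nn_integral_cong) (auto split: split_indicator)
  also have "\<dots> = (\<integral>\<^sup>+x. indicator C (t x) * (\<integral>\<^sup>+z. indicator D (fst z) \<partial>Kx (t x)) \<partial>\<mu>)"
    by (rule xi.nn_integral_disint) measurable
  also have "\<dots> = (\<integral>\<^sup>+x. indicator C (t x) * emeasure (Km (s (fst x))) D \<partial>\<mu>)"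
    by (rule nn_integral_cong_AE, use good[OF D, unfolded good_def, THEN conjunct2] in eventually_elim)
      (simp only: Kx_fst[OF D])
  also have "\<dots> = product_integral D C" by (rule product_integral_t[OF D C])
  also have "\<dots> = (\<integral>\<^sup>+x. indicator D (fst x) * emeasure (Kcu (s (fst x))) (level C) \<partial>\<mu>)"
    by (rule product_integral_base[OF D C, symmetric])
  finally show "emeasure \<mu> (fst -` D \<inter> (level C))
      = (\<integral>\<^sup>+x. indicator D (fst x) * emeasure (Kcu (s (fst x))) (level C) \<partial>\<mu>)" .
qed

lemma Kc_t: "C \<in> sets borel \<Longrightarrow> p \<in> space M \<Longrightarrow> (\<integral>\<^sup>+z. indicator C (t z) \<partial>Kc p) = emeasure (Kc p) (level C)"
  using nn_integral_indicator_vimage[OF c.measurable_K[OF xi.t], of p C] c.space_K[of p] by simp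

text \<open>The same integrals are linked in the opposite direction, conditioning on the fibers
  instead of on \<xi>u.\<close>

lemma good_if_t_law:
  assumes law: "\<And>C. C \<in> sets borel \<Longrightarrow>
      AE x in \<mu>. emeasure (Kc (fst x)) (level C) = emeasure (Kcu (s (fst x))) (level C)"
    and B [measurable]: "B \<in> sets M"
  shows "good B"
proof -
  have "AE x in \<mu>. emeasure (Kx (t x)) (over B) = emeasure (Km (s (fst x))) B"
  proof (rule xi.emeasure_K_eqI[OF fst_vimage_sets[OF B]])
    show "(\<lambda>x. emeasure (Km (s (fst x))) B) \<in> borel_measurable \<mu>"
      by (rule measurable_compose[OF cu.t emeasure_Km_measurable[OF B]])
    show "AE x in \<mu>. AE z in Kx (t x). emeasure (Km (s (fst z))) B = emeasure (Km (s (fst x))) B"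
      using AE_s_const by eventually_elim (auto elim: eventually_mono)
    fix D :: "real set" assume D [measurable]: "D \<in> sets borel"
    have "emeasure \<mu> (t -` D \<inter> (over B)) = (\<integral>\<^sup>+x. indicator D (t x) * indicator (over B) x \<partial>\<mu>)"
      by (rule xi.emeasure_vimage_Int[OF fst_vimage_sets[OF B] D])
    also have "\<dots> = (\<integral>\<^sup>+x. indicator B (fst x) * indicator D (t x) \<partial>\<mu>)"
      by (intro nn_integral_cong) (auto split: split_indicator)
    also have "\<dots> = (\<integral>\<^sup>+x. indicator B (fst x) * (\<integral>\<^sup>+z. indicator D (t z) \<partial>Kc (fst x)) \<partial>\<mu>)"
      by (rule c.nn_integral_disint) measurable
    also have "\<dots> = (\<integral>\<^sup>+x. indicator B (fst x) * emeasure (Kcu (s (fst x))) (level D) \<partial>\<mu>)"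
      by (rule nn_integral_cong_AE, use law[OF D] AE_space in eventually_elim)
        (simp only: Kc_t[OF D fst_space])
    also have "\<dots> = product_integral B D" by (rule product_integral_base[OF B D])
    also have "\<dots> = (\<integral>\<^sup>+x. indicator D (t x) * emeasure (Km (s (fst x))) B \<partial>\<mu>)"
      by (rule product_integral_t[OF B D, symmetric])
    finally show "emeasure \<mu> (t -` D \<inter> (over B)) = (\<integral>\<^sup>+x. indicator D (t x) * emeasure (Km (s (fst x))) B \<partial>\<mu>)" .
  qed
  with B show ?thesis by (simp add: good_def)
qed

lemma AE_Kc: "AE x in \<mu>. AE z in Kc (fst x). z \<in> Y \<and> fst z = fst x"
  using c.AE_disint[OF xi.X_full] c.AE_const
proof eventually_elim
  case (elim x)
  then show ?case by eventually_elim (rule conjI)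
qed

text \<open>Invariance gives the same law of the code on almost all fibers over an atom of \<sigma>.
  Conditioning on \<xi>cu averages these laws, and the average of a constant is that
  constant.\<close>

lemma t_law_if_holonomy_invariant:
  assumes "holonomy_invariant M N \<mu> \<xi>cu \<xi>u" and C [measurable]: "C \<in> sets borel"
  shows "AE x in \<mu>. emeasure (Kc (fst x)) (level C) = emeasure (Kcu (s (fst x))) (level C)"
proof -
  let ?c = "cond_measure \<mu> (fiber_partition M N)"
  from assms(1) obtain S where S: "S \<in> sets \<mu>" "emeasure \<mu> (space \<mu> - S) = 0"
    and push: "\<And>x y. x \<in> S \<Longrightarrow> y \<in> S \<Longrightarrow> atom \<xi>cu x = atom \<xi>cu y \<Longrightarrow>
      push_forward_eq (?c x) (fiber N (fst x)) (holonomy N \<xi>u (fst x) (fst y)) E (?c y)"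
    unfolding holonomy_invariant_def by blast
  define G where "G x \<longleftrightarrow> x \<in> S \<and> ?c x = Kc (fst x) \<and> fst x \<in> X \<and> (AE z in Kc (fst x). z \<in> Y \<and> fst z = fst x)" for x
  have "AE x in \<mu>. x \<in> S"
    by (rule AE_I'[of "space \<mu> - S"]) (use S in \<open>auto simp: null_sets_def\<close>)
  then have AE: "AE x in \<mu>. G x"
    unfolding G_def using c.AE_cond_measure AE_X AE_Kc by eventually_elim (intro conjI)
  have const: "AE x in \<mu>. AE z in Kcu (s (fst x)).
      emeasure (Kc (fst z)) (level C) = emeasure (Kc (fst x)) (level C)"
  proof (rule cu.AE_disint_const[OF AE])
    fix x z assume "G x" "G z"
      and sp: "x \<in> space \<mu>" "z \<in> space \<mu>" and eq: "s (fst z) = s (fst x)"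
    note x = \<open>G x\<close>[unfolded G_def] and z = \<open>G z\<close>[unfolded G_def]
    have \<sigma>: "atom \<sigma> (fst z) = atom \<sigma> (fst x)" using sg.atom_eq_iff_code[of "fst z" "fst x"] x z eq by blast
    then have "atom \<xi>cu z = atom \<xi>cu x" using atom_\<xi>cu_eq_iff[OF sp(2,1)] by blast
    then have p: "push_forward_eq (Kc (fst z)) (fiber N (fst z)) (holonomy N \<xi>u (fst z) (fst x)) E (Kc (fst x))"
      using push[of z x] x z by simp
    note fsp = fst_space[OF sp(1)] fst_space[OF sp(2)]
    show "emeasure (Kc (fst z)) (level C) = emeasure (Kc (fst x)) (level C)"
      by (rule level_eq_if_push_forward[OF xi.X xi.t xi.atom_eq_iff_code c.K_prob_space[OF fsp(2)] c.sets_K[OF fsp(2)]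
            c.K_prob_space[OF fsp(1)] c.sets_K[OF fsp(1)] fsp(2) fsp(1) \<sigma> _ _ p C]) (use x z in blast)+
  qed
  have m: "(\<lambda>x. emeasure (Kc (fst x)) (level C)) \<in> borel_measurable \<mu>"
    by (rule measurable_compose[OF fst_measurable_\<mu> measurable_compose[OF c.measurable_K_subprob
            measurable_emeasure_subprob_algebra[OF t_vimage_sets[OF C]]]])
  have "AE x in \<mu>. emeasure (Kcu (s (fst x))) (level C) = emeasure (Kc (fst x)) (level C)"
  proof (rule cu.emeasure_K_eqI[OF t_vimage_sets[OF C] m const])
    fix D :: "real set" assume D [measurable]: "D \<in> sets borel"
    have "emeasure \<mu> ((\<lambda>x. s (fst x)) -` D \<inter> (level C))
        = (\<integral>\<^sup>+x. indicator D (s (fst x)) * indicator (level C) x \<partial>\<mu>)"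
      by (rule cu.emeasure_vimage_Int[OF t_vimage_sets[OF C] D])
    also have "\<dots> = (\<integral>\<^sup>+x. indicator D (s (fst x)) * indicator C (t x) \<partial>\<mu>)"
      by (intro nn_integral_cong) (auto split: split_indicator)
    also have "\<dots> = (\<integral>\<^sup>+x. indicator D (s (fst x)) * (\<integral>\<^sup>+z. indicator C (t z) \<partial>Kc (fst x)) \<partial>\<mu>)"
    proof (rule c.nn_integral_disint)
      show "(\<lambda>p. indicator D (s p) :: ennreal) \<in> borel_measurable M" by measurable
    qed measurable
    also have "\<dots> = (\<integral>\<^sup>+x. indicator D (s (fst x)) * emeasure (Kc (fst x)) (level C) \<partial>\<mu>)"
      by (intro nn_integral_cong) (simp only: Kc_t[OF C fst_space])
    finally show "emeasure \<mu> ((\<lambda>x. s (fst x)) -` D \<inter> (level C))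
        = (\<integral>\<^sup>+x. indicator D (s (fst x)) * emeasure (Kc (fst x)) (level C) \<partial>\<mu>)" .
  qed
  then show ?thesis by eventually_elim simp
qed

text \<open>The law given \<xi>cu is shared by all fibers over an atom of \<sigma>. Comparing each
  fiber with it costs a single null set, and off that set any two fibers over the same atom are
  comparable, although there may be uncountably many pairs.\<close>

lemma holonomy_invariant_if_t_law:
  assumes law: "\<And>C. C \<in> sets borel \<Longrightarrow>
      AE x in \<mu>. emeasure (Kc (fst x)) (level C) = emeasure (Kcu (s (fst x))) (level C)"
  shows "holonomy_invariant M N \<mu> \<xi>cu \<xi>u"
proof -
  let ?c = "cond_measure \<mu> (fiber_partition M N)"
  have "AE x in \<mu>. \<forall>q. emeasure (Kc (fst x)) (t -` {..real_of_rat q} \<inter> space \<mu>)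
      = emeasure (Kcu (s (fst x))) (t -` {..real_of_rat q} \<inter> space \<mu>)"
    unfolding AE_all_countable by (intro allI law) simp
  with AE_space have AE_distr: "AE x in \<mu>. distr (Kc (fst x)) borel t = distr (Kcu (s (fst x))) borel t"
  proof eventually_elim
    case (elim x)
    note fsp = fst_space[OF elim(1)]
    have tc: "t \<in> borel_measurable (Kc (fst x))" by (rule c.measurable_K[OF xi.t fsp])
    have tcu: "t \<in> borel_measurable (Kcu (s (fst x)))" by (rule cu.measurable_K[OF xi.t]) simp
    show ?case
    proof (rule borel_measure_eqI_rat)
      show "emeasure (distr (Kc (fst x)) borel t) {..real_of_rat q} \<noteq> \<infinity>" for q
        using finite_measure.emeasure_finite[OF prob_space.finite_measure[OF c.K_prob_space[OF fsp]]]
        by (simp add: emeasure_distr[OF tc])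
      show "emeasure (distr (Kc (fst x)) borel t) {..real_of_rat q} = emeasure (distr (Kcu (s (fst x))) borel t) {..real_of_rat q}" for q
        using elim(2) by (simp add: emeasure_distr[OF tc] emeasure_distr[OF tcu] c.space_K[OF fsp] cu.space_K)
    qed simp_all
  qed
  define G where "G x \<longleftrightarrow> x \<in> space \<mu> \<and> ?c x = Kc (fst x) \<and> fst x \<in> X \<and> (AE z in Kc (fst x). z \<in> Y \<and> fst z = fst x) \<and>
      distr (Kc (fst x)) borel t = distr (Kcu (s (fst x))) borel t" for x
  have "AE x in \<mu>. G x"
    unfolding G_def using AE_space c.AE_cond_measure AE_X AE_Kc AE_distr by eventually_elim (intro conjI)
  then obtain Z where Z: "emeasure \<mu> Z = 0" "Z \<in> sets \<mu>" and good: "{x \<in> space \<mu>. \<not> G x} \<subseteq> Z"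
    by (rule AE_E)
  define S where "S = space \<mu> - Z"
  have S: "x \<in> space \<mu>" "?c x = Kc (fst x)" "fst x \<in> X" "AE z in Kc (fst x). z \<in> Y \<and> fst z = fst x"
    "distr (Kc (fst x)) borel t = distr (Kcu (s (fst x))) borel t" if "x \<in> S" for x
    using that good by (auto simp: S_def G_def)
  show ?thesis
    unfolding holonomy_invariant_def
  proof (intro bexI[of _ S] conjI ballI impI)
    show "S \<in> sets \<mu>" using Z by (simp add: S_def)
    have "space \<mu> - S = Z" using sets.sets_into_space[OF Z(2)] by (auto simp: S_def)
    then show "emeasure \<mu> (space \<mu> - S) = 0" using Z by simp
    fix x y assume x: "x \<in> S" and y: "y \<in> S" and eq: "atom \<xi>cu x = atom \<xi>cu y"
    have \<sigma>: "atom \<sigma> (fst x) = atom \<sigma> (fst y)" using atom_\<xi>cu_eq_iff[OF S(1)[OF x] S(1)[OF y]] eq by blast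
    then have "s (fst x) = s (fst y)" using sg.atom_eq_iff_code[OF S(3)[OF x] S(3)[OF y]] by blast
    then have d: "distr (Kc (fst x)) borel t = distr (Kc (fst y)) borel t" using S(5)[OF x] S(5)[OF y] by simp
    note fsp = fst_space[OF S(1)[OF x]] fst_space[OF S(1)[OF y]]
    show "push_forward_eq (?c x) (fiber N (fst x)) (holonomy N \<xi>u (fst x) (fst y)) E (?c y)"
      unfolding S(2)[OF x] S(2)[OF y]
      by (rule push_forward_if_distr_eq[OF xi.X xi.t xi.atom_eq_iff_code c.K_prob_space[OF fsp(1)] c.sets_K[OF fsp(1)]
            c.K_prob_space[OF fsp(2)] c.sets_K[OF fsp(2)] fsp \<sigma> S(4)[OF x] S(4)[OF y] d])
  qed
qed

end

text \<open>The equivalence is split because its halves differ in strength: invariance yields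
  equality of the entropies as extended reals, whereas recovering invariance compares integrands of
  equal integrals, and this requires a finite common value.\<close>

theorem theorem4p7:
  fixes M :: "'a measure" and N :: "'b measure"
    and m :: "'a measure" and \<mu> :: "('a \<times> 'b) measure"
    and f :: "'a \<Rightarrow> 'a" and F :: "'a \<times> 'b \<Rightarrow> 'a \<times> 'b"
    and \<sigma> :: "'a set set" and \<xi>cu \<xi>u :: "('a \<times> 'b) set set"
  assumes "standard_borel_space M" and "standard_borel_space N"
    and "prob_space m" and "sets m = sets M"
    and "bimeasurable_bijection M f" and "distr m M f = m"
    and "bimeasurable_bijection (M \<Otimes>\<^sub>M N) F"
    and "\<forall>x\<in>space (M \<Otimes>\<^sub>M N). fst (F x) = f (fst x)"
    and "measurable_partition m \<sigma>"
    and "increasing_partition M f \<sigma>"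
    and "generating_partition M f \<sigma>"
    and "prob_space \<mu>" and "sets \<mu> = sets (M \<Otimes>\<^sub>M N)"
    and "distr \<mu> (M \<Otimes>\<^sub>M N) F = \<mu>"
    and "distr \<mu> M fst = m"
    and "\<xi>cu = pullback (M \<Otimes>\<^sub>M N) fst \<sigma>"
    and "measurable_partition \<mu> \<xi>u"
    and "increasing_partition (M \<Otimes>\<^sub>M N) F \<xi>u"
    and "finer \<xi>u \<xi>cu"
    and "\<forall>x\<in>space (M \<Otimes>\<^sub>M N). fst ` atom \<xi>u x = atom \<sigma> (fst x)"
    and "holonomies_bijective M N \<xi>cu \<xi>u"
  shows "partition_entropy \<mu> F \<xi>u \<le> partition_entropy m f \<sigma>
    \<and> (holonomy_invariant M N \<mu> \<xi>cu \<xi>u \<longrightarrow>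
         partition_entropy \<mu> F \<xi>u = partition_entropy m f \<sigma>)
    \<and> (partition_entropy m f \<sigma> < \<infinity> \<longrightarrow>
         partition_entropy \<mu> F \<xi>u = partition_entropy m f \<sigma> \<longrightarrow>
         holonomy_invariant M N \<mu> \<xi>cu \<xi>u)"
proof -
  have "space (M \<Otimes>\<^sub>M N) \<noteq> {}"
    using prob_space.not_empty[OF assms(12)] sets_eq_imp_space_eq[OF assms(13)] by simp
  then have ne: "space M \<noteq> {}" "space N \<noteq> {}" by (auto simp: space_pair_measure)
  interpret H: holonomy_setting M N m \<mu> f F \<sigma> \<xi>cu \<xi>u
  proof (rule holonomy_setting.intro)
    show "binary_coded M" "binary_coded N"
      using assms(1,2) ne by (auto intro: standard_borel_space_imp_binary_coded)
    show "partition_on (space m) \<sigma>" "partition_on (space \<mu>) \<xi>u"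
      using assms(9,17) by (simp_all add: measurable_partition_def)
  qed (fact assms)+
  from measurable_partition_code[OF assms(9)] obtain X s where X: "X \<in> sets m" "AE p in m. p \<in> X"
    "s \<in> borel_measurable m" "\<And>p. p \<in> X \<Longrightarrow> atom \<sigma> p \<inter> X = {q \<in> X. s q = (s p :: real)}" by blast
  from measurable_partition_code[OF assms(17)] obtain Y t where Y: "Y \<in> sets \<mu>" "AE x in \<mu>. x \<in> Y"
    "t \<in> borel_measurable \<mu>" "\<And>x. x \<in> Y \<Longrightarrow> atom \<xi>u x \<inter> Y = {y \<in> Y. t y = (t x :: real)}" by blast
  have bm: "binary_coded m" using H.binary_coded_M binary_coded_cong[OF assms(4)] by simp
  have sM: "s \<in> borel_measurable M" using X(3) measurable_cong_sets[OF assms(4) refl] by blast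
  have sfst: "(\<lambda>x. s (fst x)) \<in> borel_measurable \<mu>" by (rule measurable_compose[OF H.fst_measurable_\<mu> sM])
  obtain Km where Km: "disintegration m borel s Km"
    using disintegration_exists[OF assms(3) bm X(3) real_separated] ..
  obtain Kx where Kx: "disintegration \<mu> borel t Kx"
    using disintegration_exists[OF assms(12) H.binary_coded_\<mu> Y(3) real_separated] ..
  obtain Kc where Kc: "disintegration \<mu> M fst Kc"
    using disintegration_exists[OF assms(12) H.binary_coded_\<mu> H.fst_measurable_\<mu>
        binary_coded_imp_separated[OF H.binary_coded_M]] ..
  obtain Kcu where Kcu: "disintegration \<mu> borel (\<lambda>x. s (fst x)) Kcu"
    using disintegration_exists[OF assms(12) H.binary_coded_\<mu> sfst real_separated] ..
  have "coded_partition m borel s Km \<sigma> X"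
    by (intro coded_partition.intro Km coded_partition_axioms.intro H.part_\<sigma>' X bm)
  moreover have "coded_partition \<mu> borel t Kx \<xi>u Y"
    by (intro coded_partition.intro Kx coded_partition_axioms.intro H.part_\<xi> Y H.binary_coded_\<mu>)
  \<comment> \<open>For the partition into fibers the base point itself is a code that is valid
    everywhere, so no exceptional set arises.\<close>
  moreover have "coded_partition \<mu> M fst Kc (fiber_partition M N) (space \<mu>)"
    by (intro coded_partition.intro Kc coded_partition_axioms.intro H.part_fiber H.binary_coded_\<mu>)
      (auto simp: H.atom_fiber)
  ultimately interpret coded_setting M N m \<mu> f F \<sigma> \<xi>cu \<xi>u s Km X t Kx Y Kc Kcu
    using H.holonomy_setting_axioms Kcu by (intro coded_setting.intro)
  show ?thesis
  proof (intro conjI impI)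
    show "partition_entropy \<mu> F \<xi>u \<le> partition_entropy m f \<sigma>" by (rule entropy_le)
    assume "holonomy_invariant M N \<mu> \<xi>cu \<xi>u"
    then show "partition_entropy \<mu> F \<xi>u = partition_entropy m f \<sigma>"
      by (intro entropy_eq_if_nu_eq_rho nu_eq_rho_if_good good_if_t_law t_law_if_holonomy_invariant)
  next
    assume "partition_entropy m f \<sigma> < \<infinity>" "partition_entropy \<mu> F \<xi>u = partition_entropy m f \<sigma>"
    then have "AE x in \<mu>. nu (t x) = rho (s (fst x))" by (rule nu_eq_rho_if_entropy_eq)
    then show "holonomy_invariant M N \<mu> \<xi>cu \<xi>u"
      by (intro holonomy_invariant_if_t_law t_law_if_good good_if_nu_eq_rho)
  qed
qed

end
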